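(* Let $s\in(0,1)$, $N>2s$, $2^*=\frac{2N}{N-2s}$ and $q>p>2^*-1$. Let $$F(v,\mathbb{R}^N)=\frac12\int_{\mathbb{R}^N}\int_{\mathbb{R}^N}\frac{|v(x)-v(y)|^2}{|x-y|^{N+2s}}\,dx\,dy+\frac1{q+1}\int_{\mathbb{R}^N}|v|^{q+1}\,dx$$ and $$\mathcal K=\inf\Big\{F(v,\mathbb{R}^N): v\in\dot H^s(\mathbb{R}^N)\cap L^{q+1}(\mathbb{R}^N),\ \int_{\mathbb{R}^N}|v|^{p+1}dx=1\Big\}.$$ Then $\mathcal K$ is achieved by a radially decreasing function $u\in\dot H^s(\mathbb{R}^N)\cap L^{q+1}(\mathbb{R}^N)$, and the equation $$(-\Delta)^s u=u^p-u^q\ \text{ in }\mathbb{R}^N,\qquad u\in\dot H^s(\mathbb{R}^N)\cap L^{q+1}(\mathbb{R}^N),$$ admits a nontrivial nonnegative (weak) solution. Furthermore, if $q>(p-1)\frac N{2s}-1$, then this equation admits a positive solution, i.e. a weak solution with $u>0$ in $\mathbb{R}^N$.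
   Context: $c_{N,s}=\frac{2^{2s}s\,\Gamma(\frac N2+s)}{\pi^{N/2}\Gamma(1-s)}$. Set $\|u\|^2_{\dot H^s(\mathbb{R}^N)}=\frac{c_{N,s}}{2}\int_{\mathbb{R}^N}\int_{\mathbb{R}^N}\frac{|u(x)-u(y)|^2}{|x-y|^{N+2s}}\,dx\,dy$; $\dot H^s(\mathbb{R}^N)$ is the completion of $C_0^\infty(\mathbb{R}^N)$ with respect to $\|u\|_{\dot H^s(\mathbb{R}^N)}+|u|_{L^{2^*}(\mathbb{R}^N)}$. A nonnegative function $u\in\dot H^s(\mathbb{R}^N)\cap L^{q+1}(\mathbb{R}^N)$ is a weak solution of the equation if for every $\varphi\in\dot H^s(\mathbb{R}^N)$ $$\frac{c_{N,s}}{2}\int_{\mathbb{R}^N}\int_{\mathbb{R}^N}\frac{(u(x)-u(y))(\varphi(x)-\varphi(y))}{|x-y|^{N+2s}}\,dx\,dy=\int_{\mathbb{R}^N}u^p\varphi\,dx-\int_{\mathbb{R}^N}u^q\varphi\,dx .$$ *)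

theory Defs
  imports "HOL-Analysis.Analysis"
begin

section \<open>Test functions and Lebesgue spaces\<close>

primrec Ck_fun :: "nat \<Rightarrow> ('a::euclidean_space \<Rightarrow> real) \<Rightarrow> bool" where
  "Ck_fun 0 f \<longleftrightarrow> continuous_on UNIV f"
| "Ck_fun (Suc k) f \<longleftrightarrow> f differentiable_on UNIV \<and>
     (\<forall>b\<in>Basis. Ck_fun k (\<lambda>x. frechet_derivative f (at x) b))"

definition test_functions :: "('a::euclidean_space \<Rightarrow> real) set" where
  "test_functions = {f. (\<forall>k. Ck_fun k f) \<and> compact (closure {x. f x \<noteq> 0})}"

text \<open>
  The function spaces below consist of functions rather than of classes of functions modulo
  equality almost everywhere. Borel measurability loses nothing, since every Lebesgue measurable
  function agrees almost everywhere with a Borel measurable one.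
\<close>

definition Lp_space :: "real \<Rightarrow> ('a::euclidean_space \<Rightarrow> real) set" where
  "Lp_space r = {u \<in> borel_measurable borel. integrable lborel (\<lambda>x. \<bar>u x\<bar> powr r)}"

definition Lp_norm :: "real \<Rightarrow> ('a::euclidean_space \<Rightarrow> real) \<Rightarrow> real" where
  "Lp_norm r u = (LINT x|lborel. \<bar>u x\<bar> powr r) powr (1 / r)"


section \<open>The homogeneous fractional Sobolev space\<close>

definition frac_const :: "real \<Rightarrow> real \<Rightarrow> real" where
  "frac_const N s =
     2 powr (2 * s) * s * Gamma (N / 2 + s) / (pi powr (N / 2) * Gamma (1 - s))"

definition crit_exp :: "real \<Rightarrow> real \<Rightarrow> real" where
  "crit_exp N s = 2 * N / (N - 2 * s)"

definition gagliardo_integrand ::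
  "real \<Rightarrow> (real^'n \<Rightarrow> real) \<Rightarrow> (real^'n \<Rightarrow> real) \<Rightarrow> (real^'n) \<times> (real^'n) \<Rightarrow> real" where
  "gagliardo_integrand s u v = (\<lambda>(x, y).
     (u x - u y) * (v x - v y) / norm (x - y) powr (real CARD('n) + 2 * s))"

definition gagliardo_form ::
  "real \<Rightarrow> (real^'n \<Rightarrow> real) \<Rightarrow> (real^'n \<Rightarrow> real) \<Rightarrow> real" where
  "gagliardo_form s u v =
     (LINT z|(lborel \<Otimes>\<^sub>M lborel). gagliardo_integrand s u v z)"

definition Hs_seminorm :: "real \<Rightarrow> (real^'n \<Rightarrow> real) \<Rightarrow> real" where
  "Hs_seminorm s u = sqrt (frac_const (real CARD('n)) s / 2 * gagliardo_form s u u)"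

definition finite_energy :: "real \<Rightarrow> (real^'n \<Rightarrow> real) set" where
  "finite_energy s = {u \<in> Lp_space (crit_exp (real CARD('n)) s).
     integrable (lborel \<Otimes>\<^sub>M lborel) (gagliardo_integrand s u u)}"

text \<open>
  The completion of the test functions with respect to the sum of the Gagliardo seminorm and the
  critical Lebesgue norm is realised as their closure in \<^term>\<open>finite_energy s\<close>, which (modulo
  equality almost everywhere) is complete for that norm and contains the test functions. In
  particular both integrals in the convergence condition are over integrable functions.
\<close>

definition Hs_dot :: "real \<Rightarrow> (real^'n \<Rightarrow> real) set" where
  "Hs_dot s = {u \<in> finite_energy s. \<exists>\<phi>. (\<forall>k. \<phi> k \<in> test_functions) \<and>
     (\<lambda>k. Hs_seminorm s (\<lambda>x. u x - \<phi> k x)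
          + Lp_norm (crit_exp (real CARD('n)) s) (\<lambda>x. u x - \<phi> k x)) \<longlonglongrightarrow> 0}"


section \<open>The variational problem and the equation\<close>

definition energy :: "real \<Rightarrow> real \<Rightarrow> (real^'n \<Rightarrow> real) \<Rightarrow> real" where
  "energy s q v = 1 / 2 * gagliardo_form s v v
     + 1 / (q + 1) * (LINT x|lborel. \<bar>v x\<bar> powr (q + 1))"

definition admissible :: "real \<Rightarrow> real \<Rightarrow> real \<Rightarrow> (real^'n \<Rightarrow> real) set" where
  "admissible s p q = {v \<in> Hs_dot s \<inter> Lp_space (q + 1).
     (LINT x|lborel. \<bar>v x\<bar> powr (p + 1)) = 1}"

text \<open>Monotonicity in the norm includes that the function is radial.\<close>

definition radially_decreasing :: "('a::real_normed_vector \<Rightarrow> real) \<Rightarrow> bool" where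
  "radially_decreasing u \<longleftrightarrow> (\<forall>x y. norm x \<le> norm y \<longrightarrow> u y \<le> u x)"

text \<open>
  For an arbitrary \<open>\<phi>\<close> in the test space the two integrals on the right-hand side need not
  converge a priori, so their convergence is part of the definition. The integral on the left
  always converges absolutely, by the Cauchy--Schwarz inequality.
\<close>

definition weak_solution :: "real \<Rightarrow> real \<Rightarrow> real \<Rightarrow> (real^'n \<Rightarrow> real) \<Rightarrow> bool" where
  "weak_solution s p q u \<longleftrightarrow>
     u \<in> Hs_dot s \<inter> Lp_space (q + 1) \<and> (\<forall>x. 0 \<le> u x) \<and>
     (\<forall>\<phi>\<in>Hs_dot s.
        integrable lborel (\<lambda>x. u x powr p * \<phi> x) \<and>
        integrable lborel (\<lambda>x. u x powr q * \<phi> x) \<and>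
        frac_const (real CARD('n)) s / 2 * gagliardo_form s u \<phi> =
          (LINT x|lborel. u x powr p * \<phi> x) - (LINT x|lborel. u x powr q * \<phi> x))"

end

theory Submission
  imports Defs "HOL-Probability.Helly_Selection" "HOL-Complex_Analysis.Great_Picard"
begin

text \<open>
  Truncating an admissible function at a high level and dilating it back to the constraint does not
  increase the energy, so minimising sequences may be taken bounded by a fixed constant. Each member
  is approximated by Lipschitz functions of compact support, and these are made radially decreasing by
  polarization, which preserves the integral terms and does not increase the Gagliardo energy. For
  radially decreasing functions the Hardy and Sobolev inequalities are elementary and give a decay
  at infinity that dominates the constraint integral, so Helly selection yields a minimiser. Varying
  its amplitude gives the Euler--Lagrange equation, a dilation removes the multiplier, and a bump
  supported where the solution vanishes shows that it vanishes nowhere.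
\<close>

section \<open>Lebesgue measure on Euclidean space\<close>

text \<open>Boundedness does more than provide a majorant. A general element of
  \<open>Hs_dot s\<close> is only known to be integrable to the critical power r, so testing with it
  requires u^q in the space dual to L^r; this asks for integrability of u beyond the power q + 1,
  which a bounded u in L^r has. Helly selection gives convergence almost everywhere and nothing in
  norm. That is enough because p + 1 and q + 1 both exceed r: the decay |x|^(-(N - 2s)/2) raised to
  such a power is integrable at infinity, so the power integrals converge by domination, while the
  Gagliardo energy only has to be lower semicontinuous. The rearrangement is found variationally
  instead of from level sets, and its competitors must form a compact class stable under
  polarization; a common Lipschitz constant and a common support ball provide this, whence the
  detour through approximants. The functional F lacks the constant c_{N,s} of the equation.
  Amplitude and dilation together give two free parameters, one for the multiplier and one for this
  constant.\<close>

lemma nn_integral_lborel_translate: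
  fixes c :: "'a::euclidean_space"
  assumes [measurable]: "f \<in> borel_measurable borel"
  shows "(\<integral>\<^sup>+x. f (x + c) \<partial>lborel) = (\<integral>\<^sup>+x. f x \<partial>lborel)"
proof -
  have "(\<integral>\<^sup>+x. f x \<partial>lborel) = (\<integral>\<^sup>+x. f x \<partial>distr lborel borel ((+) c))"
    by (simp add: lborel_distr_plus)
  also have "\<dots> = (\<integral>\<^sup>+x. f (x + c) \<partial>lborel)"
    by (subst nn_integral_distr) (auto simp: add.commute)
  finally show ?thesis by simp
qed

lemma nn_integral_lborel_scale:
  fixes f :: "'a::euclidean_space \<Rightarrow> ennreal"
  assumes [measurable]: "f \<in> borel_measurable borel" and "c \<noteq> 0"
  shows "(\<integral>\<^sup>+x. f x \<partial>lborel) = ennreal (\<bar>c\<bar> ^ DIM('a)) * (\<integral>\<^sup>+x. f (c *\<^sub>R x) \<partial>lborel)"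
proof -
  have "(\<integral>\<^sup>+x. f x \<partial>lborel) = (\<integral>\<^sup>+x. f x \<partial>density (distr lborel borel (\<lambda>x. 0 + c *\<^sub>R x))
      (\<lambda>_. ennreal (\<bar>c\<bar> ^ DIM('a))))"
    using lborel_affine[OF assms(2), of "0::'a"] by simp
  also have "\<dots> = ennreal (\<bar>c\<bar> ^ DIM('a)) * (\<integral>\<^sup>+x. f (c *\<^sub>R x) \<partial>lborel)"
    by (subst nn_integral_density, simp, simp, subst nn_integral_distr)
       (simp_all add: nn_integral_cmult)
  finally show ?thesis .
qed

lemma nn_integral_lborel_scale':
  fixes f :: "'a::euclidean_space \<Rightarrow> ennreal"
  assumes [measurable]: "f \<in> borel_measurable borel" and "c > 0"
  shows "(\<integral>\<^sup>+x. f (c *\<^sub>R x) \<partial>lborel) = ennreal (c powr - real DIM('a)) * (\<integral>\<^sup>+x. f x \<partial>lborel)"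
proof -
  have "c powr - real DIM('a) * c ^ DIM('a) = 1"
    using assms(2) by (simp add: powr_minus powr_realpow)
  then show ?thesis
    using assms(2) by (subst nn_integral_lborel_scale[of f c])
      (simp_all add: mult.assoc[symmetric] ennreal_mult[symmetric])
qed

lemma nn_integral_lborel_translate_minus:
  fixes c :: "'a::euclidean_space"
  assumes [measurable]: "f \<in> borel_measurable borel"
  shows "(\<integral>\<^sup>+x. f (c - x) \<partial>lborel) = (\<integral>\<^sup>+x. f x \<partial>lborel)"
proof -
  have "(\<integral>\<^sup>+x. f x \<partial>lborel) = (\<integral>\<^sup>+x. f (x + c) \<partial>lborel)"
    by (simp add: nn_integral_lborel_translate)
  also have "\<dots> = (\<integral>\<^sup>+x. f (c - x) \<partial>lborel)"
    by (subst nn_integral_lborel_scale[where c="-1"]) auto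
  finally show ?thesis by simp
qed

text \<open>
  Uniqueness of translation-invariant measures via Tonelli: both sides are multiplied by the volume
  of the unit ball, which a linear isometry maps to itself.
\<close>

lemma nn_integral_lborel_involution:
  fixes T :: "'a::euclidean_space \<Rightarrow> 'a"
  assumes lin: "linear T" and inv: "\<And>x. T (T x) = x" and iso: "\<And>x. norm (T x) = norm x"
    and f[measurable]: "f \<in> borel_measurable borel"
  shows "(\<integral>\<^sup>+x. f (T x) \<partial>lborel) = (\<integral>\<^sup>+x. f x \<partial>lborel)"
proof -
  define g :: "'a \<Rightarrow> ennreal" where "g = indicator (ball 0 1)"
  have [measurable]: "T \<in> borel_measurable borel"
    using lin by (intro borel_measurable_continuous_onI linear_continuous_on) (simp add: linear_conv_bounded_linear)
  have [measurable]: "g \<in> borel_measurable borel"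
    unfolding g_def by (rule borel_measurable_indicator) simp
  have gT: "g (- T x) = g x" for x by (simp add: g_def indicator_def iso)
  have gi: "(\<integral>\<^sup>+x. g x \<partial>lborel) = emeasure lborel (ball (0::'a) 1)"
    by (simp add: g_def)
  have "(\<integral>\<^sup>+x. f (T x) \<partial>lborel) * (\<integral>\<^sup>+y. g y \<partial>lborel) = (\<integral>\<^sup>+x. f (T x) * (\<integral>\<^sup>+y. g y \<partial>lborel) \<partial>lborel)"
    by (simp add: nn_integral_multc)
  also have "\<dots> = (\<integral>\<^sup>+x. (\<integral>\<^sup>+y. f (T x) * g (y - T x) \<partial>lborel) \<partial>lborel)"
  proof (rule nn_integral_cong)
    fix x show "f (T x) * (\<integral>\<^sup>+y. g y \<partial>lborel) = (\<integral>\<^sup>+y. f (T x) * g (y - T x) \<partial>lborel)"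
      using nn_integral_lborel_translate[of g "- T x"] by (simp add: nn_integral_cmult)
  qed
  also have "\<dots> = (\<integral>\<^sup>+y. (\<integral>\<^sup>+x. f (T x) * g (y - T x) \<partial>lborel) \<partial>lborel)"
    by (rule lborel_pair.Fubini') measurable
  \<comment> \<open>Translating x by T y moves the involution away from the argument of f and onto
    that of g, where it is invisible because g depends on the norm only.\<close>
  also have "\<dots> = (\<integral>\<^sup>+y. (\<integral>\<^sup>+x. f (T x + y) * g (- T x) \<partial>lborel) \<partial>lborel)"
  proof (rule nn_integral_cong)
    fix y
    have "(\<integral>\<^sup>+x. f (T x) * g (y - T x) \<partial>lborel) = (\<integral>\<^sup>+x. f (T (x + T y)) * g (y - T (x + T y)) \<partial>lborel)"
      by (rule nn_integral_lborel_translate[symmetric, of "\<lambda>x. f (T x) * g (y - T x)"]) measurable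
    then show "(\<integral>\<^sup>+x. f (T x) * g (y - T x) \<partial>lborel) = (\<integral>\<^sup>+x. f (T x + y) * g (- T x) \<partial>lborel)"
      by (simp add: linear_add[OF lin] inv)
  qed
  also have "\<dots> = (\<integral>\<^sup>+x. (\<integral>\<^sup>+y. f (T x + y) * g x \<partial>lborel) \<partial>lborel)"
    unfolding gT by (rule lborel_pair.Fubini') measurable
  also have "\<dots> = (\<integral>\<^sup>+x. (\<integral>\<^sup>+y. f y \<partial>lborel) * g x \<partial>lborel)"
  proof (rule nn_integral_cong)
    fix x show "(\<integral>\<^sup>+y. f (T x + y) * g x \<partial>lborel) = (\<integral>\<^sup>+y. f y \<partial>lborel) * g x"
      using nn_integral_lborel_translate[of f "T x"] by (simp add: nn_integral_multc add.commute)
  qed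
  also have "\<dots> = (\<integral>\<^sup>+x. f x \<partial>lborel) * (\<integral>\<^sup>+y. g y \<partial>lborel)"
    by (simp add: nn_integral_cmult)
  finally have "(\<integral>\<^sup>+x. f (T x) \<partial>lborel) * emeasure lborel (ball (0::'a) 1) =
      (\<integral>\<^sup>+x. f x \<partial>lborel) * emeasure lborel (ball (0::'a) 1)" by (simp add: gi)
  moreover have "emeasure lborel (ball (0::'a) 1) \<noteq> 0" "emeasure lborel (ball (0::'a) 1) \<noteq> \<infinity>"
    by (simp_all add: emeasure_ball)
       (metis less_numeral_extra(3) of_nat_0_le_iff unit_ball_vol_pos)
  ultimately show ?thesis
    by (simp add: mult.commute[of _ "emeasure lborel (ball (0::'a) 1)"] ennreal_mult_cancel_left)
qed

section \<open>Reflections in the hyperplane a . x = b, for a unit normal a\<close>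

definition hreflect :: "'a::euclidean_space \<Rightarrow> real \<Rightarrow> 'a \<Rightarrow> 'a" where
  "hreflect a b x = x - (2 * (a \<bullet> x - b)) *\<^sub>R a"

lemma hreflect_involution: "norm a = 1 \<Longrightarrow> hreflect a b (hreflect a b x) = x"
  by (simp add: hreflect_def algebra_simps norm_eq_1)

lemma hreflect_dist: "norm a = 1 \<Longrightarrow> norm (hreflect a b x - hreflect a b y) = norm (x - y)"
  by (simp add: hreflect_def norm_eq_sqrt_inner algebra_simps inner_commute norm_eq_1)

lemma hreflect_side: "norm a = 1 \<Longrightarrow> a \<bullet> hreflect a b x - b = - (a \<bullet> x - b)"
  by (simp add: hreflect_def algebra_simps norm_eq_1)

lemma norm_hreflect: "norm a = 1 \<Longrightarrow> (norm (hreflect a b x))\<^sup>2 = (norm x)\<^sup>2 - 4 * b * (a \<bullet> x - b)"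
  by (simp add: hreflect_def power2_norm_eq_inner algebra_simps inner_commute norm_eq_1)

text \<open>The sign of the product tells whether x and y lie on the same side, and hence whether y
  or its mirror image is nearer to x. Both the Lipschitz bound and the energy comparison for
  polarization rest on this identity.\<close>

lemma hreflect_cross:
  assumes "norm a = 1"
  shows "(norm (x - hreflect a b y))\<^sup>2 = (norm (x - y))\<^sup>2 + 4 * ((a \<bullet> x - b) * (a \<bullet> y - b))"
  using assms by (simp add: hreflect_def power2_norm_eq_inner algebra_simps inner_commute norm_eq_1)

lemma continuous_hreflect: "continuous_on A (hreflect a b)"
  unfolding hreflect_def by (intro continuous_intros)

lemma measurable_hreflect [measurable]: "hreflect a b \<in> borel_measurable borel"
  by (intro borel_measurable_continuous_onI continuous_hreflect)

lemma nn_integral_lborel_hreflect: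
  fixes a :: "'a::euclidean_space"
  assumes a: "norm a = 1" and [measurable]: "f \<in> borel_measurable borel"
  shows "(\<integral>\<^sup>+x. f (hreflect a b x) \<partial>lborel) = (\<integral>\<^sup>+x. f x \<partial>lborel)"
proof -
  have lin: "linear (hreflect a 0)"
    by (rule linearI) (auto simp: hreflect_def algebra_simps)
  have eq: "hreflect a b x = hreflect a 0 x + (2 * b) *\<^sub>R a" for x
    by (simp add: hreflect_def algebra_simps)
  have iso: "norm (hreflect a 0 x) = norm x" for x
    using hreflect_dist[OF a, of 0 x 0] by (simp add: hreflect_def)
  have "(\<integral>\<^sup>+x. f (hreflect a b x) \<partial>lborel) = (\<integral>\<^sup>+x. f (x + (2 * b) *\<^sub>R a) \<partial>lborel)"
    unfolding eq
    by (rule nn_integral_lborel_involution[OF lin hreflect_involution[OF a] iso,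
          where f="\<lambda>x. f (x + (2 * b) *\<^sub>R a)"]) measurable
  then show ?thesis by (simp add: nn_integral_lborel_translate)
qed

text \<open>A substitute for polar coordinates: f is dominated by the sum of the constants c k on
  the balls of radius r k, whose integral is a numerical series. The origin is exempt because
  shrinking shells never reach it.\<close>

lemma nn_integral_dyadic_shells:
  assumes r: "\<And>k. 0 \<le> r k" and c: "\<And>k. 0 \<le> c k"
    and sm: "summable (\<lambda>k. c k * r k ^ DIM('a))"
    and f: "\<And>x::'a::euclidean_space. x \<noteq> 0 \<Longrightarrow> f x \<noteq> 0 \<Longrightarrow> \<exists>k::nat. norm x \<le> r k \<and> f x \<le> ennreal (c k)"
  shows "(\<integral>\<^sup>+x. f x \<partial>lborel) < \<infinity>"
proof -
  let ?V = "unit_ball_vol DIM('a)"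
  have "(\<integral>\<^sup>+x. f x \<partial>lborel) \<le> (\<integral>\<^sup>+x. (\<Sum>k. ennreal (c k) * indicator (cball (0::'a) (r k)) x) \<partial>lborel)"
  proof (rule nn_integral_mono_AE, use AE_lborel_singleton[of "0::'a"] in eventually_elim)
    fix x :: 'a assume "x \<noteq> 0"
    show "f x \<le> (\<Sum>k. ennreal (c k) * indicator (cball 0 (r k)) x)"
    proof (cases "f x = 0")
      case False
      then obtain k where k: "norm x \<le> r k" "f x \<le> ennreal (c k)" using f[OF \<open>x \<noteq> 0\<close>] by blast
      have "f x \<le> (\<Sum>i\<in>{k}. ennreal (c i) * indicator (cball 0 (r i)) x)"
        using k by simp
      also have "\<dots> \<le> (\<Sum>k. ennreal (c k) * indicator (cball 0 (r k)) x)"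
        by (rule sum_le_suminf) auto
      finally show ?thesis .
    qed simp
  qed
  also have "\<dots> = (\<Sum>k. ennreal (?V * (c k * r k ^ DIM('a))))"
  proof (subst nn_integral_suminf)
    have [measurable]: "(indicator (cball 0 (r i)) :: 'a \<Rightarrow> ennreal) \<in> borel_measurable borel" for i
      by (rule borel_measurable_indicator) simp
    show "(\<lambda>x::'a. ennreal (c i) * indicator (cball 0 (r i)) x) \<in> borel_measurable lborel" for i
      by measurable
    have "(\<integral>\<^sup>+x. ennreal (c i) * indicator (cball (0::'a) (r i)) x \<partial>lborel)
        = ennreal (?V * (c i * r i ^ DIM('a)))" for i
      by (subst nn_integral_cmult)
         (auto simp: emeasure_cball r c ennreal_mult[symmetric] mult_ac)
    then show "(\<Sum>i. \<integral>\<^sup>+x. ennreal (c i) * indicator (cball (0::'a) (r i)) x \<partial>lborel)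
        = (\<Sum>k. ennreal (?V * (c k * r k ^ DIM('a))))" by simp
  qed
  also have "\<dots> < \<infinity>"
    using summable_mult[OF sm, of ?V] r c
    by (subst suminf_ennreal2) (auto simp: less_top)
  finally show ?thesis .
qed

text \<open>On the shell where norm x lies between 2^k and 2^(k + 1), the bound on the integrand
  uses the inner radius and the ball the outer one. The series is geometric with ratio 2^(N -
  \<alpha>), N being the dimension.\<close>

lemma nn_integral_norm_powr_outside:
  assumes "\<alpha> > real DIM('a)"
  shows "(\<integral>\<^sup>+x. ennreal (norm x powr - \<alpha>) * indicator {x. 1 \<le> norm x} (x::'a::euclidean_space) \<partial>lborel) < \<infinity>"
proof (rule nn_integral_dyadic_shells[where r="\<lambda>k. 2 powr (real k + 1)" and c="\<lambda>k. 2 powr - (real k * \<alpha>)"])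
  let ?n = "real DIM('a)"
  have "2 powr - (real k * \<alpha>) * (2 powr (real k + 1)) ^ DIM('a) = 2 powr ?n * (2 powr (?n - \<alpha>)) ^ k" for k
    by (simp add: powr_powr powr_add[symmetric] powr_realpow[symmetric] algebra_simps)
  moreover have "2 powr (?n - \<alpha>) < (1::real)"
    using assms powr_less_mono[of "?n - \<alpha>" 0 "2::real"] by simp
  ultimately show "summable (\<lambda>k. 2 powr - (real k * \<alpha>) * (2 powr (real k + 1)) ^ DIM('a))"
    by (auto intro!: summable_mult summable_geometric)
next
  fix x :: 'a
  assume "ennreal (norm x powr - \<alpha>) * indicator {x. 1 \<le> norm x} x \<noteq> 0"
  then have x1: "1 \<le> norm x" by (auto simp: indicator_def split: if_splits)
  define k where "k = nat \<lfloor>log 2 (norm x)\<rfloor>"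
  have "0 \<le> log 2 (norm x)" using x1 by (subst zero_le_log_cancel_iff) auto
  then have k: "real k \<le> log 2 (norm x)" "log 2 (norm x) < real k + 1"
    unfolding k_def by linarith+
  have "0 < norm x" using x1 by linarith
  then have b: "2 powr real k \<le> norm x" "norm x \<le> 2 powr (real k + 1)"
    using k le_log_iff[of 2 "norm x" "real k"] log_less_iff[of 2 "norm x" "real k + 1"] by auto
  have "norm x powr - \<alpha> \<le> (2 powr real k) powr - \<alpha>"
    using b assms by (intro powr_mono2') auto
  then show "\<exists>k. norm x \<le> 2 powr (real k + 1) \<and>
      ennreal (norm x powr - \<alpha>) * indicator {x. 1 \<le> norm x} x \<le> ennreal (2 powr - (real k * \<alpha>))"
    using x1 b by (intro exI[of _ k]) (auto simp: powr_powr intro!: ennreal_leI)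
qed auto

lemma nn_integral_norm_powr_inside:
  assumes "0 \<le> \<alpha>" "\<alpha> < real DIM('a)"
  shows "(\<integral>\<^sup>+x. ennreal (norm x powr - \<alpha>) * indicator {x. norm x \<le> 1} (x::'a::euclidean_space) \<partial>lborel) < \<infinity>"
proof (rule nn_integral_dyadic_shells[where r="\<lambda>k. 2 powr - real k" and c="\<lambda>k. 2 powr ((real k + 1) * \<alpha>)"])
  let ?n = "real DIM('a)"
  have "2 powr ((real k + 1) * \<alpha>) * (2 powr - real k) ^ DIM('a) = 2 powr \<alpha> * (2 powr (\<alpha> - ?n)) ^ k" for k
    by (simp add: powr_powr powr_add[symmetric] powr_realpow[symmetric] algebra_simps)
  moreover have "2 powr (\<alpha> - ?n) < (1::real)"
    using assms powr_less_mono[of "\<alpha> - ?n" 0 "2::real"] by simp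
  ultimately show "summable (\<lambda>k. 2 powr ((real k + 1) * \<alpha>) * (2 powr - real k) ^ DIM('a))"
    by (auto intro!: summable_mult summable_geometric)
next
  fix x :: 'a
  assume x0: "x \<noteq> 0" and "ennreal (norm x powr - \<alpha>) * indicator {x. norm x \<le> 1} x \<noteq> 0"
  then have x1: "norm x \<le> 1" by (auto simp: indicator_def split: if_splits)
  \<comment> \<open>Mirror image of the outer case: the shells shrink towards the origin, so now the
    bound carries the index k + 1 and the ball the index k.\<close>
  define k where "k = nat \<lfloor>- log 2 (norm x)\<rfloor>"
  have "0 \<le> - log 2 (norm x)" using x1 x0 by simp
  then have k: "real k \<le> - log 2 (norm x)" "- log 2 (norm x) < real k + 1"
    unfolding k_def by linarith+
  have b: "2 powr - (real k + 1) \<le> norm x" "norm x \<le> 2 powr - real k"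
    using k x1 x0 by (auto simp: le_log_iff[symmetric] log_le_iff[symmetric])
  have "norm x powr - \<alpha> \<le> (2 powr - (real k + 1)) powr - \<alpha>"
    using b assms by (intro powr_mono2') auto
  then have b': "norm x powr - \<alpha> \<le> 2 powr ((real k + 1) * \<alpha>)"
    by (simp add: powr_powr algebra_simps)
  then show "\<exists>k. norm x \<le> 2 powr - real k \<and>
      ennreal (norm x powr - \<alpha>) * indicator {x. norm x \<le> 1} x \<le> ennreal (2 powr ((real k + 1) * \<alpha>))"
    using x1 b b' by (intro exI[of _ k]) (auto intro!: ennreal_leI)
qed auto

section \<open>The Gagliardo energy\<close>

text \<open>Power integrals and energies live in \<open>ennreal\<close>, where finiteness can be
  read from the value; a divergent Bochner integral would have the value 0. No root is taken and no
  constant is attached, so that the scaling laws stay linear.\<close>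

definition Lpow :: "real \<Rightarrow> (real^'n \<Rightarrow> real) \<Rightarrow> ennreal" where
  "Lpow r u = (\<integral>\<^sup>+x. ennreal (\<bar>u x\<bar> powr r) \<partial>lborel)"

definition gag :: "real \<Rightarrow> (real^'n \<Rightarrow> real) \<Rightarrow> ennreal" where
  "gag s u = (\<integral>\<^sup>+z. ennreal (gagliardo_integrand s u u z) \<partial>(lborel \<Otimes>\<^sub>M lborel))"

lemma integrable_Lpow_iff:
  assumes [measurable]: "u \<in> borel_measurable borel"
  shows "integrable lborel (\<lambda>x. \<bar>u x\<bar> powr r) \<longleftrightarrow> Lpow r u < \<infinity>"
  unfolding Lpow_def by (subst integrable_iff_bounded) auto

lemma Lp_space_iff: "u \<in> Lp_space r \<longleftrightarrow> u \<in> borel_measurable borel \<and> Lpow r u < \<infinity>"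
  unfolding Lp_space_def using integrable_Lpow_iff by auto

lemma integral_Lpow:
  assumes "u \<in> Lp_space r"
  shows "ennreal (LINT x|lborel. \<bar>u x\<bar> powr r) = Lpow r u"
  using assms unfolding Lp_space_def Lpow_def by (subst nn_integral_eq_integral) auto

lemma gagliardo_integrand_self:
  "gagliardo_integrand s u u (x, y) = (u x - u y)\<^sup>2 / norm (x - y) powr (real CARD('n) + 2 * s)"
  for u :: "real^'n \<Rightarrow> real"
  by (simp add: gagliardo_integrand_def power2_eq_square)

lemma gagliardo_integrand_nonneg: "0 \<le> gagliardo_integrand s u u z"
  by (cases z) (simp add: gagliardo_integrand_self)

lemma measurable_gagliardo_integrand [measurable]:
  fixes u :: "real^'n \<Rightarrow> real"
  assumes [measurable]: "u \<in> borel_measurable borel" "v \<in> borel_measurable borel"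
  shows "gagliardo_integrand s u v \<in> borel_measurable (lborel \<Otimes>\<^sub>M lborel)"
  unfolding gagliardo_integrand_def by measurable

lemma gag_eq_iterated:
  fixes u :: "real^'n \<Rightarrow> real"
  assumes [measurable]: "u \<in> borel_measurable borel"
  shows "gag s u = (\<integral>\<^sup>+x. (\<integral>\<^sup>+y. ennreal ((u x - u y)\<^sup>2 / norm (x - y) powr (real CARD('n) + 2 * s)) \<partial>lborel) \<partial>lborel)"
  unfolding gag_def by (subst lborel.nn_integral_fst[symmetric]) (auto simp: gagliardo_integrand_self)

lemma integrable_gag_iff:
  fixes u :: "real^'n \<Rightarrow> real"
  assumes [measurable]: "u \<in> borel_measurable borel"
  shows "integrable (lborel \<Otimes>\<^sub>M lborel) (gagliardo_integrand s u u) \<longleftrightarrow> gag s u < \<infinity>"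
  unfolding gag_def by (subst integrable_iff_bounded) (auto simp: gagliardo_integrand_nonneg)

lemma finite_energy_iff:
  fixes u :: "real^'n \<Rightarrow> real"
  shows "u \<in> finite_energy s \<longleftrightarrow>
    u \<in> borel_measurable borel \<and> Lpow (crit_exp (real CARD('n)) s) u < \<infinity> \<and> gag s u < \<infinity>"
  unfolding finite_energy_def Lp_space_iff using integrable_gag_iff by auto

lemma gagliardo_form_gag:
  fixes u :: "real^'n \<Rightarrow> real"
  assumes "u \<in> borel_measurable borel" "gag s u < \<infinity>"
  shows "ennreal (gagliardo_form s u u) = gag s u"
  unfolding gagliardo_form_def gag_def using assms integrable_gag_iff[of u s]
  by (subst nn_integral_eq_integral) (auto simp: gagliardo_integrand_nonneg)

lemma gagliardo_form_nonneg: "0 \<le> gagliardo_form s u u"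
  unfolding gagliardo_form_def by (intro integral_nonneg_AE) (auto simp: gagliardo_integrand_nonneg)

section \<open>Contractions, sums and scaling\<close>

lemma gag_mono:
  fixes u v :: "real^'n \<Rightarrow> real"
  assumes "\<And>x y. \<bar>u x - u y\<bar> \<le> \<bar>v x - v y\<bar>"
  shows "gag s u \<le> gag s v"
  unfolding gag_def
proof (rule nn_integral_mono)
  fix z :: "(real^'n) \<times> (real^'n)"
  obtain x y where "z = (x, y)" by (cases z)
  then show "ennreal (gagliardo_integrand s u u z) \<le> ennreal (gagliardo_integrand s v v z)"
    using assms[of x y] abs_le_square_iff[of "u x - u y" "v x - v y"]
    by (auto simp: gagliardo_integrand_self intro!: ennreal_leI divide_right_mono)
qed

text \<open>Young's inequality for the mixed term. The free weight t matters in approximation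
  arguments: once the energy of v has tended to zero, t can be sent to 0 and the constant in front
  of u tends to 1.\<close>

lemma gag_add_le_weighted:
  fixes u v :: "real^'n \<Rightarrow> real"
  assumes [measurable]: "u \<in> borel_measurable borel" "v \<in> borel_measurable borel" and t: "t > 0"
  shows "gag s (\<lambda>x. u x + v x) \<le> ennreal (1 + t) * gag s u + ennreal (1 + 1 / t) * gag s v"
proof -
  have "gag s (\<lambda>x. u x + v x) \<le> (\<integral>\<^sup>+z. ennreal (1 + t) * ennreal (gagliardo_integrand s u u z)
      + ennreal (1 + 1 / t) * ennreal (gagliardo_integrand s v v z) \<partial>(lborel \<Otimes>\<^sub>M lborel))"
    unfolding gag_def
  proof (rule nn_integral_mono)
    fix z :: "(real^'n) \<times> (real^'n)"
    obtain x y where z: "z = (x, y)" by (cases z)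
    let ?a = "u x - u y" and ?b = "v x - v y" and ?d = "norm (x - y) powr (real CARD('n) + 2 * s)"
    have "0 \<le> (t * ?a - ?b)\<^sup>2 / t" using t by simp
    also have "\<dots> = t * ?a\<^sup>2 + ?b\<^sup>2 / t - 2 * ?a * ?b" using t by (simp add: power2_eq_square field_simps)
    finally have "2 * ?a * ?b \<le> t * ?a\<^sup>2 + ?b\<^sup>2 / t" by simp
    moreover have "(u x + v x - (u y + v y))\<^sup>2 = ?a\<^sup>2 + ?b\<^sup>2 + 2 * ?a * ?b"
      by (simp add: power2_eq_square algebra_simps)
    ultimately have "(u x + v x - (u y + v y))\<^sup>2 \<le> (1 + t) * ?a\<^sup>2 + (1 + 1 / t) * ?b\<^sup>2"
      by (simp add: algebra_simps)
    then have "(u x + v x - (u y + v y))\<^sup>2 / ?d \<le> ((1 + t) * ?a\<^sup>2 + (1 + 1 / t) * ?b\<^sup>2) / ?d"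
      by (rule divide_right_mono) simp
    then have "gagliardo_integrand s (\<lambda>x. u x + v x) (\<lambda>x. u x + v x) z
        \<le> (1 + t) * gagliardo_integrand s u u z + (1 + 1 / t) * gagliardo_integrand s v v z"
      unfolding z gagliardo_integrand_self by (simp add: add_divide_distrib)
    then have "ennreal (gagliardo_integrand s (\<lambda>x. u x + v x) (\<lambda>x. u x + v x) z)
        \<le> ennreal ((1 + t) * gagliardo_integrand s u u z + (1 + 1 / t) * gagliardo_integrand s v v z)"
      by (rule ennreal_leI)
    also have "\<dots> = ennreal (1 + t) * ennreal (gagliardo_integrand s u u z)
        + ennreal (1 + 1 / t) * ennreal (gagliardo_integrand s v v z)"
      using t gagliardo_integrand_nonneg[of s u z] gagliardo_integrand_nonneg[of s v z]
      by (subst ennreal_plus) (auto simp: ennreal_mult)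
    finally show "ennreal (gagliardo_integrand s (\<lambda>x. u x + v x) (\<lambda>x. u x + v x) z)
        \<le> ennreal (1 + t) * ennreal (gagliardo_integrand s u u z)
        + ennreal (1 + 1 / t) * ennreal (gagliardo_integrand s v v z)" .
  qed
  also have "\<dots> = ennreal (1 + t) * gag s u + ennreal (1 + 1 / t) * gag s v"
    unfolding gag_def by (subst nn_integral_add) (auto simp: nn_integral_cmult)
  finally show ?thesis .
qed

corollary gag_add_le:
  fixes u v :: "real^'n \<Rightarrow> real"
  assumes "u \<in> borel_measurable borel" "v \<in> borel_measurable borel"
  shows "gag s (\<lambda>x. u x + v x) \<le> 2 * gag s u + 2 * gag s v"
  using gag_add_le_weighted[OF assms, of 1 s] by simp

lemma gag_minus: "gag s (\<lambda>x. - u x) = gag s u"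
proof -
  have "(- a - - b)\<^sup>2 = (a - b)\<^sup>2" for a b :: real
    by (simp add: power2_eq_square algebra_simps)
  then have "gagliardo_integrand s (\<lambda>x. - u x) (\<lambda>x. - u x) z = gagliardo_integrand s u u z" for z
    by (cases z) (simp only: gagliardo_integrand_self)
  then show ?thesis by (simp add: gag_def)
qed

lemma gag_diff_commute: "gag s (\<lambda>x. u x - v x) = gag s (\<lambda>x. v x - u x)"
  using gag_minus[of s "\<lambda>x. u x - v x"] by simp

lemma gag_cmult:
  fixes u :: "real^'n \<Rightarrow> real"
  assumes [measurable]: "u \<in> borel_measurable borel"
  shows "gag s (\<lambda>x. c * u x) = ennreal (c\<^sup>2) * gag s u"
proof -
  have "gagliardo_integrand s (\<lambda>x. c * u x) (\<lambda>x. c * u x) z = c\<^sup>2 * gagliardo_integrand s u u z" for z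
    by (cases z) (simp add: gagliardo_integrand_self power2_eq_square algebra_simps)
  then show ?thesis
    unfolding gag_def
    by (simp add: ennreal_mult' gagliardo_integrand_nonneg nn_integral_cmult)
qed

text \<open>Each of the two variables contributes c^(-N) and the kernel contributes c^(N + 2s),
  which leaves c^(2s - N).\<close>

lemma gag_dilate:
  fixes u :: "real^'n \<Rightarrow> real"
  assumes [measurable]: "u \<in> borel_measurable borel" and c: "c > 0"
  shows "gag s (\<lambda>x. u (c *\<^sub>R x)) = ennreal (c powr - (real CARD('n) - 2 * s)) * gag s u"
proof -
  let ?n = "real CARD('n)"
  define h where "h x y = ennreal ((u x - u y)\<^sup>2 / norm (x - y) powr (?n + 2 * s))" for x y
  have [measurable]: "(\<lambda>(x, y). h x y) \<in> borel_measurable (borel \<Otimes>\<^sub>M borel)"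
    unfolding h_def by measurable
  have h: "ennreal ((u (c *\<^sub>R x) - u (c *\<^sub>R y))\<^sup>2 / norm (x - y) powr (?n + 2 * s))
      = ennreal (c powr (?n + 2 * s)) * h (c *\<^sub>R x) (c *\<^sub>R y)" for x y
  proof -
    have "norm (c *\<^sub>R x - c *\<^sub>R y) = c * norm (x - y)"
      using c by (simp add: scaleR_diff_right[symmetric])
    then show ?thesis
      unfolding h_def using c by (simp add: powr_mult ennreal_mult'[symmetric])
  qed
  have "gag s (\<lambda>x. u (c *\<^sub>R x)) =
      (\<integral>\<^sup>+x. (\<integral>\<^sup>+y. ennreal (c powr (?n + 2 * s)) * h (c *\<^sub>R x) (c *\<^sub>R y) \<partial>lborel) \<partial>lborel)"
    by (subst gag_eq_iterated) (simp_all add: h)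
  also have "\<dots> = (\<integral>\<^sup>+x. ennreal (c powr (?n + 2 * s)) * (ennreal (c powr - ?n) * (\<integral>\<^sup>+y. h (c *\<^sub>R x) y \<partial>lborel)) \<partial>lborel)"
  proof (rule nn_integral_cong)
    fix x
    show "(\<integral>\<^sup>+y. ennreal (c powr (?n + 2 * s)) * h (c *\<^sub>R x) (c *\<^sub>R y) \<partial>lborel)
        = ennreal (c powr (?n + 2 * s)) * (ennreal (c powr - ?n) * (\<integral>\<^sup>+y. h (c *\<^sub>R x) y \<partial>lborel))"
      using nn_integral_lborel_scale'[of "h (c *\<^sub>R x)" c] c by (simp add: nn_integral_cmult)
  qed
  also have "\<dots> = ennreal (c powr (?n + 2 * s)) * (ennreal (c powr - ?n) *
      (ennreal (c powr - ?n) * (\<integral>\<^sup>+x. (\<integral>\<^sup>+y. h x y \<partial>lborel) \<partial>lborel)))"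
    using nn_integral_lborel_scale'[of "\<lambda>x. (\<integral>\<^sup>+y. h x y \<partial>lborel)" c] c
    by (simp add: nn_integral_cmult)
  also have "\<dots> = ennreal (c powr - (?n - 2 * s)) * gag s u"
    unfolding gag_eq_iterated[OF assms(1)] h_def
    by (simp add: mult.assoc[symmetric] ennreal_mult'[symmetric] powr_add[symmetric])
  finally show ?thesis .
qed

lemma Lpow_mono: "r \<ge> 0 \<Longrightarrow> (\<And>x. \<bar>u x\<bar> \<le> \<bar>v x\<bar>) \<Longrightarrow> Lpow r u \<le> Lpow r v"
  unfolding Lpow_def by (intro nn_integral_mono ennreal_leI powr_mono2) auto

lemma Lpow_cmult:
  fixes u :: "real^'n \<Rightarrow> real"
  assumes [measurable]: "u \<in> borel_measurable borel"
  shows "Lpow r (\<lambda>x. c * u x) = ennreal (\<bar>c\<bar> powr r) * Lpow r u"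
  unfolding Lpow_def by (simp add: abs_mult powr_mult ennreal_mult' nn_integral_cmult)

lemma Lpow_dilate:
  fixes u :: "real^'n \<Rightarrow> real"
  assumes [measurable]: "u \<in> borel_measurable borel" and c: "c > 0"
  shows "Lpow r (\<lambda>x. u (c *\<^sub>R x)) = ennreal (c powr - real CARD('n)) * Lpow r u"
  unfolding Lpow_def using nn_integral_lborel_scale'[of "\<lambda>x. ennreal (\<bar>u x\<bar> powr r)" c] c by simp

lemma abs_add_powr_le:
  fixes a b :: real assumes "r \<ge> 0"
  shows "\<bar>a + b\<bar> powr r \<le> 2 powr r * (\<bar>a\<bar> powr r + \<bar>b\<bar> powr r)"
proof -
  have "\<bar>a + b\<bar> powr r \<le> (2 * max \<bar>a\<bar> \<bar>b\<bar>) powr r"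
    using assms by (intro powr_mono2) auto
  also have "\<dots> = 2 powr r * max \<bar>a\<bar> \<bar>b\<bar> powr r" by (simp add: powr_mult)
  also have "\<dots> \<le> 2 powr r * (\<bar>a\<bar> powr r + \<bar>b\<bar> powr r)"
    by (intro mult_left_mono) (auto simp: max_def)
  finally show ?thesis .
qed

lemma Lpow_add_le:
  fixes u v :: "real^'n \<Rightarrow> real"
  assumes [measurable]: "u \<in> borel_measurable borel" "v \<in> borel_measurable borel" and r: "r \<ge> 0"
  shows "Lpow r (\<lambda>x. u x + v x) \<le> ennreal (2 powr r) * (Lpow r u + Lpow r v)"
proof -
  have "Lpow r (\<lambda>x. u x + v x) \<le> (\<integral>\<^sup>+x. ennreal (2 powr r) * (ennreal (\<bar>u x\<bar> powr r) + ennreal (\<bar>v x\<bar> powr r)) \<partial>lborel)"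
    unfolding Lpow_def
    by (intro nn_integral_mono) (simp add: ennreal_mult'[symmetric] ennreal_plus[symmetric] abs_add_powr_le[OF r]
         ennreal_leI del: ennreal_plus)
  also have "\<dots> = ennreal (2 powr r) * (Lpow r u + Lpow r v)"
    unfolding Lpow_def by (simp add: nn_integral_cmult nn_integral_add)
  finally show ?thesis .
qed

section \<open>Lower semicontinuity and strong convergence of the energy\<close>

lemma AE_lborel_pair:
  assumes "AE x in lborel. P (x::'a::euclidean_space)"
  shows "AE z in lborel \<Otimes>\<^sub>M lborel. P (fst z) \<and> P (snd z)"
proof -
  obtain N where N: "{x. \<not> P x} \<subseteq> N" "N \<in> null_sets lborel"
    using assms unfolding eventually_ae_filter by auto
  have "N \<times> UNIV \<union> UNIV \<times> N \<in> null_sets (lborel \<Otimes>\<^sub>M lborel)"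
    using N(2) by (intro null_sets.Un null_setsI)
       (auto simp: lborel.emeasure_pair_measure_Times null_sets_def)
  then show ?thesis
    unfolding eventually_ae_filter
    by (rule bexI[rotated]) (use N(1) in auto)
qed

lemma gag_fatou:
  fixes u :: "real^'n \<Rightarrow> real"
  assumes [measurable]: "u \<in> borel_measurable borel" "\<And>k. f k \<in> borel_measurable borel"
    and lim: "AE x in lborel. (\<lambda>k. f k x) \<longlonglongrightarrow> u x"
  shows "gag s u \<le> liminf (\<lambda>k. gag s (f k))"
proof -
  have "gag s u \<le> (\<integral>\<^sup>+z. liminf (\<lambda>k. ennreal (gagliardo_integrand s (f k) (f k) z)) \<partial>(lborel \<Otimes>\<^sub>M lborel))"
    unfolding gag_def
  proof (rule nn_integral_mono_AE, use AE_lborel_pair[OF lim] in eventually_elim)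
    case (elim z)
    then have "(\<lambda>k. gagliardo_integrand s (f k) (f k) z) \<longlonglongrightarrow> gagliardo_integrand s u u z"
      by (cases z) (auto simp: gagliardo_integrand_def divide_inverse intro!: tendsto_intros)
    then have "liminf (\<lambda>k. ennreal (gagliardo_integrand s (f k) (f k) z)) = ennreal (gagliardo_integrand s u u z)"
      by (intro lim_imp_Liminf) (auto intro: tendsto_ennrealI)
    then show ?case by simp
  qed
  also have "\<dots> \<le> liminf (\<lambda>k. gag s (f k))"
    unfolding gag_def by (rule nn_integral_liminf) measurable
  finally show ?thesis .
qed

lemma Lpow_fatou:
  fixes u :: "real^'n \<Rightarrow> real"
  assumes [measurable]: "u \<in> borel_measurable borel" "\<And>k. f k \<in> borel_measurable borel"
    and lim: "AE x in lborel. (\<lambda>k. f k x) \<longlonglongrightarrow> u x" and r: "r > 0"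
  shows "Lpow r u \<le> liminf (\<lambda>k. Lpow r (f k))"
proof -
  have "Lpow r u \<le> (\<integral>\<^sup>+x. liminf (\<lambda>k. ennreal (\<bar>f k x\<bar> powr r)) \<partial>lborel)"
    unfolding Lpow_def
  proof (rule nn_integral_mono_AE, use lim in eventually_elim)
    case (elim x)
    then have "(\<lambda>k. \<bar>f k x\<bar> powr r) \<longlonglongrightarrow> \<bar>u x\<bar> powr r"
      using r by (intro tendsto_powr2 tendsto_intros) auto
    then have "liminf (\<lambda>k. ennreal (\<bar>f k x\<bar> powr r)) = ennreal (\<bar>u x\<bar> powr r)"
      by (intro lim_imp_Liminf) (auto intro: tendsto_ennrealI)
    then show ?case by simp
  qed
  also have "\<dots> \<le> liminf (\<lambda>k. Lpow r (f k))"
    unfolding Lpow_def by (rule nn_integral_liminf) measurable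
  finally show ?thesis .
qed

text \<open>The signed square turns convergence of squares (Scheffe) into strong convergence in \<open>L\<^sup>2\<close>.\<close>

lemma diff_square_le_signed_square:
  fixes a b :: real
  shows "(a - b)\<^sup>2 \<le> 2 * \<bar>a * \<bar>a\<bar> - b * \<bar>b\<bar>\<bar>"
proof -
  consider "0 \<le> a" "0 \<le> b" | "a \<le> 0" "b \<le> 0" | "0 \<le> a" "b \<le> 0" | "a \<le> 0" "0 \<le> b" by linarith
  then show ?thesis
  proof cases
    case 1
    have "(a - b)\<^sup>2 = \<bar>a - b\<bar> * \<bar>a - b\<bar>" by (simp add: power2_eq_square)
    also have "\<dots> \<le> \<bar>a - b\<bar> * \<bar>a + b\<bar>" using 1 by (intro mult_left_mono) auto
    also have "\<dots> = \<bar>(a - b) * (a + b)\<bar>" by (rule abs_mult[symmetric])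
    also have "(a - b) * (a + b) = a * \<bar>a\<bar> - b * \<bar>b\<bar>" using 1 by (simp add: algebra_simps)
    finally show ?thesis by (rule order_trans) simp
  next
    case 2
    have "(a - b)\<^sup>2 = \<bar>a - b\<bar> * \<bar>a - b\<bar>" by (simp add: power2_eq_square)
    also have "\<dots> \<le> \<bar>a - b\<bar> * \<bar>a + b\<bar>" using 2 by (intro mult_left_mono) auto
    also have "\<dots> = \<bar>- ((a - b) * (a + b))\<bar>" by (simp add: abs_mult)
    also have "- ((a - b) * (a + b)) = a * \<bar>a\<bar> - b * \<bar>b\<bar>" using 2 by (simp add: algebra_simps)
    finally show ?thesis by (rule order_trans) simp
  next
    case 3
    have "0 \<le> (a + b)\<^sup>2" by simp
    then have "(a - b)\<^sup>2 \<le> 2 * (a * a + b * b)" by (simp add: power2_eq_square algebra_simps)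
    then show ?thesis using 3 by simp
  next
    case 4
    have "0 \<le> (a + b)\<^sup>2" by simp
    then have "(a - b)\<^sup>2 \<le> 2 * (a * a + b * b)" by (simp add: power2_eq_square algebra_simps)
    moreover have "a * \<bar>a\<bar> - b * \<bar>b\<bar> = - (a * a + b * b)" using 4 by simp
    ultimately show ?thesis by (simp only: abs_minus_cancel) simp
  qed
qed

text \<open>Bounding the energies by that of the limit rules out excess energy that disappears in
  the limit, so convergence almost everywhere upgrades to convergence in the seminorm. This replaces
  the usual argument from weak convergence and convergence of norms in a Hilbert space.\<close>

lemma gag_strong_convergence:
  fixes u :: "real^'n \<Rightarrow> real"
  assumes [measurable]: "u \<in> borel_measurable borel" "\<And>k. f k \<in> borel_measurable borel"
    and lim: "AE x in lborel. (\<lambda>k. f k x) \<longlonglongrightarrow> u x"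
    and le: "\<And>k. gag s (f k) \<le> gag s u" and fin: "gag s u < \<infinity>"
  shows "(\<lambda>k. gag s (\<lambda>x. f k x - u x)) \<longlonglongrightarrow> 0"
proof -
  let ?M = "lborel \<Otimes>\<^sub>M lborel :: ((real^'n) \<times> (real^'n)) measure"
  \<comment> \<open>\<open>S v\<close> is the Gagliardo integrand with the sign of v x - v y
    attached. Its absolute value integrates to \<open>gag s v\<close>, so the hypotheses are those
    of Scheffe's lemma, and the sign is what lets closeness in L^1 control the square of the
    difference.\<close>
  define S where "S v = (\<lambda>(x, y). (v x - v y) * \<bar>v x - v y\<bar> / norm (x - y) powr (real CARD('n) + 2 * s))"
    for v :: "real^'n \<Rightarrow> real"
  have mS: "S v \<in> borel_measurable ?M" if [measurable]: "v \<in> borel_measurable borel" for v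
    unfolding S_def by measurable
  have [measurable]: "S u \<in> borel_measurable ?M" "\<And>k. S (f k) \<in> borel_measurable ?M"
    by (rule mS, fact)+
  have nS: "norm (S v z) = gagliardo_integrand s v v z" for v z
    by (cases z) (simp add: S_def gagliardo_integrand_def abs_mult)
  have iS: "integrable ?M (S u)"
  proof (rule integrableI_bounded)
    show "(\<integral>\<^sup>+z. ennreal (norm (S u z)) \<partial>?M) < \<infinity>" using fin by (simp only: nS gag_def)
  qed fact
  have "(\<lambda>k. \<integral>\<^sup>+z. ennreal (norm (S (f k) z - S u z)) \<partial>?M) \<longlonglongrightarrow> 0"
  proof (rule Scheffe_lemma2[OF _ iS])
    show "S (f k) \<in> borel_measurable ?M" for k by fact
    show "AE z in ?M. (\<lambda>k. S (f k) z) \<longlonglongrightarrow> S u z"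
    proof (use AE_lborel_pair[OF lim] in eventually_elim)
      case (elim z)
      then show ?case
        by (cases z) (auto simp: S_def divide_inverse intro!: tendsto_intros)
    qed
    show "(\<integral>\<^sup>+z. ennreal (norm (S (f k) z)) \<partial>?M) \<le> (\<integral>\<^sup>+z. ennreal (norm (S u z)) \<partial>?M)" for k
      using le[of k] by (simp only: nS gag_def)
  qed
  then have h0: "(\<lambda>k. 2 * (\<integral>\<^sup>+z. ennreal (norm (S (f k) z - S u z)) \<partial>?M)) \<longlonglongrightarrow> 0"
    by (subst mult_zero_right[of "2::ennreal", symmetric], intro ennreal_tendsto_cmult) simp
  have bd: "gag s (\<lambda>x. f k x - u x) \<le> 2 * (\<integral>\<^sup>+z. ennreal (norm (S (f k) z - S u z)) \<partial>?M)" for k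
  proof -
    have "gag s (\<lambda>x. f k x - u x) \<le> (\<integral>\<^sup>+z. 2 * ennreal (norm (S (f k) z - S u z)) \<partial>?M)"
      unfolding gag_def
    proof (rule nn_integral_mono)
      fix z :: "(real^'n) \<times> (real^'n)"
      obtain x y where z: "z = (x, y)" by (cases z)
      let ?d = "norm (x - y) powr (real CARD('n) + 2 * s)"
      have "gagliardo_integrand s (\<lambda>x. f k x - u x) (\<lambda>x. f k x - u x) z
          = ((f k x - f k y) - (u x - u y))\<^sup>2 / ?d"
        unfolding z gagliardo_integrand_self
        by (rule arg_cong[of _ _ "\<lambda>t. t\<^sup>2 / ?d"]) simp
      also have "\<dots> \<le> 2 * \<bar>(f k x - f k y) * \<bar>f k x - f k y\<bar> - (u x - u y) * \<bar>u x - u y\<bar>\<bar> / ?d"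
        by (intro divide_right_mono diff_square_le_signed_square) simp
      also have "\<dots> = 2 * norm (S (f k) z - S u z)"
      proof -
        have "S (f k) z - S u z = ((f k x - f k y) * \<bar>f k x - f k y\<bar> - (u x - u y) * \<bar>u x - u y\<bar>) / ?d"
          by (simp add: z S_def diff_divide_distrib)
        then show ?thesis by (simp only: real_norm_def abs_divide) simp
      qed
      finally have "ennreal (gagliardo_integrand s (\<lambda>x. f k x - u x) (\<lambda>x. f k x - u x) z)
          \<le> ennreal (2 * norm (S (f k) z - S u z))" by (rule ennreal_leI)
      then show "ennreal (gagliardo_integrand s (\<lambda>x. f k x - u x) (\<lambda>x. f k x - u x) z)
          \<le> 2 * ennreal (norm (S (f k) z - S u z))"
        by (simp add: ennreal_mult)
    qed
    also have "\<dots> = 2 * (\<integral>\<^sup>+z. ennreal (norm (S (f k) z - S u z)) \<partial>?M)"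
      by (rule nn_integral_cmult) measurable
    finally show ?thesis .
  qed
  show ?thesis
  proof (rule tendsto_sandwich[OF _ _ tendsto_const h0])
    show "\<forall>\<^sub>F k in sequentially. gag s (\<lambda>x. f k x - u x) \<le> 2 * (\<integral>\<^sup>+z. ennreal (norm (S (f k) z - S u z)) \<partial>?M)"
      by (rule always_eventually, rule allI, rule bd)
  qed simp
qed

text \<open>Near the diagonal the Lipschitz bound leaves norm (x - y) to the power 2 - N - 2s,
  integrable because s < 1; far from it boundedness and the power - N - 2s suffice because s >
  0.\<close>

lemma gag_finite_Lipschitz:
  fixes u :: "real^'n \<Rightarrow> real"
  assumes s: "0 < s" "s < 1"
    and [measurable]: "u \<in> borel_measurable borel"
    and L: "\<And>x y. \<bar>u x - u y\<bar> \<le> L * norm (x - y)"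
    and B: "\<And>x. \<bar>u x\<bar> \<le> B" and R: "\<And>x. R < norm x \<Longrightarrow> u x = 0"
  shows "gag s u < \<infinity>"
proof -
  let ?n = "real CARD('n)"
  \<comment> \<open>The exponent N + 2s - 2 is negative for N = 1 and s < 1/2, a case outside the
    integrability lemma for inner powers; replacing it by 0 only enlarges the bound on the unit
    ball.\<close>
  define \<beta> where "\<beta> = max 0 (?n + 2 * s - 2)"
  define h :: "real^'n \<Rightarrow> ennreal" where
    "h z = ennreal (L\<^sup>2) * (ennreal (norm z powr - \<beta>) * indicator {z. norm z \<le> 1} z)
      + ennreal (4 * B\<^sup>2) * (ennreal (norm z powr - (?n + 2 * s)) * indicator {z. 1 \<le> norm z} z)" for z
  have [measurable]: "h \<in> borel_measurable borel" unfolding h_def by measurable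
  define b :: "real^'n \<Rightarrow> ennreal" where "b = indicator (cball 0 R)"
  have [measurable]: "b \<in> borel_measurable borel" unfolding b_def by (rule borel_measurable_indicator) simp
  have n1: "?n \<ge> 1" by simp
  have hfin: "(\<integral>\<^sup>+z. h z \<partial>lborel) < \<infinity>"
  proof -
    have "\<beta> < ?n" using s n1 by (auto simp: \<beta>_def)
    then have "(\<integral>\<^sup>+z. ennreal (norm z powr - \<beta>) * indicator {z. norm z \<le> 1} (z::real^'n) \<partial>lborel) < \<infinity>"
      by (intro nn_integral_norm_powr_inside) (auto simp: \<beta>_def)
    moreover have "(\<integral>\<^sup>+z. ennreal (norm z powr - (?n + 2 * s)) * indicator {z. 1 \<le> norm z} (z::real^'n) \<partial>lborel) < \<infinity>"
      using s by (intro nn_integral_norm_powr_outside) auto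
    ultimately show ?thesis
      unfolding h_def by (subst nn_integral_add) (auto simp: nn_integral_cmult ennreal_mult_less_top)
  qed
  have bfin: "(\<integral>\<^sup>+x. b x \<partial>lborel) < \<infinity>"
    unfolding b_def by (cases "R \<ge> 0") (auto simp: emeasure_cball)
  have pt: "ennreal ((u x - u y)\<^sup>2 / norm (x - y) powr (?n + 2 * s)) \<le> b x * h (y - x) + b y * h (y - x)" for x y
  proof (cases "u x = u y")
    case False
    then have xy: "norm (x - y) > 0" by auto
    \<comment> \<open>Unequal values force one of the two points into the support ball, so the
      double integral is bounded by two products of single integrals.\<close>
    have bxy: "1 \<le> b x + b y"
      using R[of x] R[of y] False by (cases "norm x \<le> R"; cases "norm y \<le> R") (auto simp: b_def indicator_def)
    have "ennreal ((u x - u y)\<^sup>2 / norm (x - y) powr (?n + 2 * s)) \<le> h (y - x)"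
    proof (cases "norm (x - y) \<le> 1")
      case True
      have "(u x - u y)\<^sup>2 \<le> (L * norm (x - y))\<^sup>2"
        using power_mono[OF L[of x y], of 2] by simp
      also have "\<dots> = L\<^sup>2 * norm (x - y) powr 2" using xy by (simp add: power_mult_distrib powr_realpow[symmetric] del: powr_numeral)
      finally have "(u x - u y)\<^sup>2 / norm (x - y) powr (?n + 2 * s) \<le> L\<^sup>2 * norm (x - y) powr 2 / norm (x - y) powr (?n + 2 * s)"
        by (rule divide_right_mono) simp
      also have "\<dots> = L\<^sup>2 * norm (x - y) powr - (?n + 2 * s - 2)"
        using powr_diff[of "norm (x - y)" 2 "?n + 2 * s"] by (simp del: powr_numeral)
      also have "\<dots> \<le> L\<^sup>2 * norm (x - y) powr - \<beta>"
        using True xy by (intro mult_left_mono powr_mono') (auto simp: \<beta>_def)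
      finally show ?thesis
        using True unfolding h_def
        by (intro add_increasing2) (auto simp: norm_minus_commute ennreal_mult'[symmetric] intro!: ennreal_leI)
    next
      case False
      have "\<bar>u x - u y\<bar> \<le> 2 * B" using B[of x] B[of y] by linarith
      then have "(u x - u y)\<^sup>2 \<le> (2 * B)\<^sup>2"
        using power_mono[of "\<bar>u x - u y\<bar>" "2 * B" 2] by simp
      then have "(u x - u y)\<^sup>2 / norm (x - y) powr (?n + 2 * s) \<le> 4 * B\<^sup>2 * norm (x - y) powr - (?n + 2 * s)"
        by (subst powr_minus_divide) (auto simp: intro!: divide_right_mono)
      then show ?thesis
        using False unfolding h_def
        by (intro add_increasing) (auto simp: norm_minus_commute ennreal_mult'[symmetric] intro!: ennreal_leI)
    qed
    also have "\<dots> = 1 * h (y - x)" by simp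
    also have "\<dots> \<le> (b x + b y) * h (y - x)" by (intro mult_right_mono bxy) auto
    finally show ?thesis by (simp add: distrib_right)
  qed simp
  have hx: "(\<integral>\<^sup>+y. h (y - x) \<partial>lborel) = (\<integral>\<^sup>+z. h z \<partial>lborel)" for x
    using nn_integral_lborel_translate[of h "-x"] by simp
  have hy: "(\<integral>\<^sup>+x. h (y - x) \<partial>lborel) = (\<integral>\<^sup>+z. h z \<partial>lborel)" for y
    using nn_integral_lborel_translate_minus[of h y] by simp
  have "gag s u \<le> (\<integral>\<^sup>+x. (\<integral>\<^sup>+y. b x * h (y - x) + b y * h (y - x) \<partial>lborel) \<partial>lborel)"
    by (subst gag_eq_iterated) (auto intro!: nn_integral_mono pt)
  also have "\<dots> = (\<integral>\<^sup>+x. (\<integral>\<^sup>+y. b x * h (y - x) \<partial>lborel) \<partial>lborel) + (\<integral>\<^sup>+x. (\<integral>\<^sup>+y. b y * h (y - x) \<partial>lborel) \<partial>lborel)"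
    by (simp add: nn_integral_add)
  also have "(\<integral>\<^sup>+x. (\<integral>\<^sup>+y. b y * h (y - x) \<partial>lborel) \<partial>lborel) = (\<integral>\<^sup>+y. (\<integral>\<^sup>+x. b y * h (y - x) \<partial>lborel) \<partial>lborel)"
    by (rule lborel_pair.Fubini') measurable
  also have "(\<integral>\<^sup>+x. (\<integral>\<^sup>+y. b x * h (y - x) \<partial>lborel) \<partial>lborel) = (\<integral>\<^sup>+x. b x \<partial>lborel) * (\<integral>\<^sup>+z. h z \<partial>lborel)"
    by (simp add: nn_integral_cmult hx nn_integral_multc)
  also have "(\<integral>\<^sup>+y. (\<integral>\<^sup>+x. b y * h (y - x) \<partial>lborel) \<partial>lborel) = (\<integral>\<^sup>+x. b x \<partial>lborel) * (\<integral>\<^sup>+z. h z \<partial>lborel)"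
    by (simp add: nn_integral_cmult hy nn_integral_multc)
  also have "(\<integral>\<^sup>+x. b x \<partial>lborel) * (\<integral>\<^sup>+z. h z \<partial>lborel) + (\<integral>\<^sup>+x. b x \<partial>lborel) * (\<integral>\<^sup>+z. h z \<partial>lborel) < \<infinity>"
    using bfin hfin by (simp add: ennreal_mult_less_top)
  finally show ?thesis .
qed

section \<open>Smooth functions of compact support\<close>

text \<open>Uniqueness of the Frechet derivative frees smoothness proofs from
  \<open>frechet_derivative\<close>: any explicit derivative will do.\<close>

lemma Ck_fun_SucI:
  assumes "\<And>x. (f has_derivative f' x) (at x)" "\<And>b. b \<in> Basis \<Longrightarrow> Ck_fun k (\<lambda>x. f' x b)"
  shows "Ck_fun (Suc k) f"
proof -
  have "frechet_derivative f (at x) = f' x" for x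
    using frechet_derivative_at[OF assms(1)[of x]] by simp
  moreover have "f differentiable_on UNIV"
    using assms(1) by (auto simp: differentiable_on_def differentiable_def intro: has_derivative_at_withinI)
  ultimately show ?thesis using assms(2) by simp
qed

lemma Ck_fun_has_derivative:
  "Ck_fun (Suc k) f \<Longrightarrow> (f has_derivative frechet_derivative f (at x)) (at x)"
  by (simp add: differentiable_on_def frechet_derivative_works[symmetric])

lemma Ck_fun_Suc_imp: "Ck_fun (Suc k) f \<Longrightarrow> Ck_fun k f"
proof (induction k arbitrary: f)
  case 0
  then show ?case by (auto intro: differentiable_imp_continuous_on)
qed auto

lemma Ck_fun_const: "Ck_fun k (\<lambda>x. c)"
proof (induction k arbitrary: c)
  case (Suc k)
  show ?case by (rule Ck_fun_SucI[of _ "\<lambda>x h. 0"]) (auto intro: Suc)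
qed simp

lemma Ck_fun_inner: "Ck_fun k (\<lambda>x. x \<bullet> c)"
proof (cases k)
  case (Suc j)
  have "Ck_fun (Suc j) (\<lambda>x. x \<bullet> c)"
    by (rule Ck_fun_SucI[of _ "\<lambda>x h. h \<bullet> c"]) (auto intro!: derivative_eq_intros Ck_fun_const)
  then show ?thesis using Suc by simp
qed (auto intro!: continuous_intros)

lemma Ck_fun_add: "Ck_fun k f \<Longrightarrow> Ck_fun k g \<Longrightarrow> Ck_fun k (\<lambda>x. f x + g x)"
proof (induction k arbitrary: f g)
  case (Suc k)
  show ?case
    by (rule Ck_fun_SucI, rule has_derivative_add[OF Suc.prems[THEN Ck_fun_has_derivative]])
       (use Suc in auto)
qed (auto intro: continuous_intros)

lemma Ck_fun_mult: "Ck_fun k f \<Longrightarrow> Ck_fun k g \<Longrightarrow> Ck_fun k (\<lambda>x. f x * g x)"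
proof (induction k arbitrary: f g)
  case (Suc k)
  have fg: "Ck_fun k f" "Ck_fun k g" using Suc.prems by (auto intro: Ck_fun_Suc_imp)
  show ?case
    by (rule Ck_fun_SucI, rule has_derivative_mult[OF Suc.prems[THEN Ck_fun_has_derivative]])
       (use Suc fg in \<open>auto intro!: Ck_fun_add\<close>)
qed (auto intro: continuous_intros)

lemma Ck_fun_sum: "(\<And>i. i \<in> I \<Longrightarrow> Ck_fun k (f i)) \<Longrightarrow> Ck_fun k (\<lambda>x. \<Sum>i\<in>I. f i x)"
  by (induction I rule: infinite_finite_induct) (auto intro: Ck_fun_const Ck_fun_add)

lemma Ck_fun_affine: "Ck_fun k f \<Longrightarrow> Ck_fun k (\<lambda>x. f (a *\<^sub>R x + c))"
proof (induction k arbitrary: f)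
  case 0
  then show ?case by (auto intro!: continuous_on_compose2[of UNIV f] continuous_intros)
next
  case (Suc k)
  show ?case
  proof (rule Ck_fun_SucI[where f'="\<lambda>x h. frechet_derivative f (at (a *\<^sub>R x + c)) (a *\<^sub>R h)"])
    fix x
    show "((\<lambda>x. f (a *\<^sub>R x + c)) has_derivative (\<lambda>h. frechet_derivative f (at (a *\<^sub>R x + c)) (a *\<^sub>R h))) (at x)"
      by (rule has_derivative_compose[of "\<lambda>x. a *\<^sub>R x + c", OF _ Ck_fun_has_derivative[OF Suc.prems]])
         (auto intro!: derivative_eq_intros)
  next
    fix b :: 'a assume b: "b \<in> Basis"
    have "linear (frechet_derivative f (at y))" for y
      using Ck_fun_has_derivative[OF Suc.prems] by (rule has_derivative_linear)
    then have "(\<lambda>x. frechet_derivative f (at (a *\<^sub>R x + c)) (a *\<^sub>R b))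
        = (\<lambda>x. a * frechet_derivative f (at (a *\<^sub>R x + c)) b)"
      by (auto simp: linear_scale)
    moreover have "Ck_fun k (\<lambda>x. frechet_derivative f (at (a *\<^sub>R x + c)) b)"
      using Suc.IH[of "\<lambda>x. frechet_derivative f (at x) b"] Suc.prems b by auto
    ultimately show "Ck_fun k (\<lambda>x. frechet_derivative f (at (a *\<^sub>R x + c)) (a *\<^sub>R b))"
      by (auto intro: Ck_fun_mult Ck_fun_const)
  qed
qed

text \<open>Powers of 1/t are built in because the derivative of the m-th function is a combination
  of those with index m + 1 and m + 2; smoothness of the whole family is then a single
  induction.\<close>

definition flat_exp :: "nat \<Rightarrow> real \<Rightarrow> real" where
  "flat_exp m t = (if 0 < t then (1 / t) ^ m * exp (- (1 / t)) else 0)"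

lemma flat_exp_tendsto_0: "(flat_exp m \<longlongrightarrow> 0) (at 0)"
proof -
  have "((\<lambda>y::real. y ^ m / exp y) \<longlongrightarrow> 0) at_top" by (rule tendsto_power_div_exp_0)
  then have "((\<lambda>t::real. (inverse t) ^ m / exp (inverse t)) \<longlongrightarrow> 0) (at_right 0)"
    by (rule filterlim_compose[OF _ filterlim_inverse_at_top_right])
  then have "(flat_exp m \<longlongrightarrow> 0) (at_right 0)"
    by (rule Lim_transform_eventually)
       (auto simp: flat_exp_def eventually_at_right_field exp_minus field_simps intro!: exI[of _ 1])
  moreover have "(flat_exp m \<longlongrightarrow> 0) (at_left 0)"
    by (rule Lim_transform_eventually[OF tendsto_const])
       (auto simp: flat_exp_def eventually_at_left_field intro!: exI[of _ "-1"])
  ultimately show ?thesis by (simp add: filterlim_split_at)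
qed

lemma DERIV_flat_exp:
  "(flat_exp m has_real_derivative - real m * flat_exp (m + 1) t + flat_exp (m + 2) t) (at t)"
proof -
  consider "t > 0" | "t < 0" | "t = 0" by linarith
  then show ?thesis
  proof cases
    case 1
    define u where "u = 1 / t"
    have d: "((\<lambda>t. 1 / t) has_real_derivative - (u\<^sup>2)) (at t)"
      using 1 by (auto intro!: derivative_eq_intros simp: u_def power2_eq_square)
    have "((\<lambda>t. (1 / t) ^ m * exp (- (1 / t))) has_real_derivative
        real m * u ^ (m - 1) * - (u\<^sup>2) * exp (- u) + u ^ m * (exp (- u) * u\<^sup>2)) (at t)"
      by (rule DERIV_cong[OF DERIV_mult[OF DERIV_power[OF d] DERIV_chain2[OF DERIV_exp DERIV_minus[OF d]]]])
         (simp add: u_def[symmetric])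
    also have "real m * u ^ (m - 1) * - (u\<^sup>2) * exp (- u) + u ^ m * (exp (- u) * u\<^sup>2)
        = - real m * flat_exp (m + 1) t + flat_exp (m + 2) t"
      using 1 by (cases m) (auto simp: flat_exp_def u_def[symmetric] power2_eq_square algebra_simps)
    finally have "((\<lambda>t. (1 / t) ^ m * exp (- (1 / t))) has_real_derivative
        - real m * flat_exp (m + 1) t + flat_exp (m + 2) t) (at t)" .
    moreover have "eventually (\<lambda>t. (1 / t) ^ m * exp (- (1 / t)) = flat_exp m t) (nhds t)"
      using eventually_nhds_in_open[of "{0<..}" t] 1
      by (auto elim!: eventually_mono simp: flat_exp_def)
    ultimately show ?thesis
      by (subst DERIV_cong_ev[OF refl _ refl, symmetric])
  next
    case 2
    have "((\<lambda>t. 0::real) has_real_derivative 0) (at t)" by simp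
    moreover have "eventually (\<lambda>t. 0 = flat_exp m t) (nhds t)"
      using eventually_nhds_in_open[of "{..<0}" t] 2
      by (auto elim!: eventually_mono simp: flat_exp_def)
    ultimately have "(flat_exp m has_real_derivative 0) (at t)"
      by (subst DERIV_cong_ev[OF refl _ refl, symmetric])
    then show ?thesis using 2 by (simp add: flat_exp_def)
  next
    case 3
    \<comment> \<open>At the origin the difference quotient of \<open>flat_exp m\<close> is
      \<open>flat_exp (m + 1)\<close>, which tends to 0.\<close>
    have "(flat_exp m has_real_derivative 0) (at 0)"
      unfolding has_field_derivative_iff
      by (rule Lim_transform_eventually[OF flat_exp_tendsto_0[of "m + 1"]])
         (auto simp: flat_exp_def eventually_at_filter divide_simps)
    then show ?thesis using 3 by (simp add: flat_exp_def)
  qed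
qed

lemma Ck_fun_flat_exp: "Ck_fun k (\<lambda>x::'a::euclidean_space. flat_exp m (1 - x \<bullet> x))"
proof (induction k arbitrary: m)
  case 0
  have "continuous_on UNIV (flat_exp m)"
    by (intro continuous_at_imp_continuous_on ballI DERIV_isCont[OF DERIV_flat_exp])
  then show ?case
    by (auto intro!: continuous_on_compose2[of UNIV "flat_exp m"] continuous_intros)
next
  case (Suc k)
  let ?d = "\<lambda>x::'a. - real m * flat_exp (m + 1) (1 - x \<bullet> x) + flat_exp (m + 2) (1 - x \<bullet> x)"
  show ?case
  proof (rule Ck_fun_SucI[where f'="\<lambda>x h. - (2 * (x \<bullet> h)) * ?d x"])
    show "((\<lambda>x. flat_exp m (1 - x \<bullet> x)) has_derivative (\<lambda>h. - (2 * (x \<bullet> h)) * ?d x)) (at x)" for x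
      by (rule has_derivative_compose[of "\<lambda>x. 1 - x \<bullet> x" "\<lambda>h. - (2 * (x \<bullet> h))", OF _
            DERIV_flat_exp[unfolded has_field_derivative_def, THEN has_derivative_eq_rhs]])
         (auto intro!: derivative_eq_intros simp: inner_commute)
    show "Ck_fun k (\<lambda>x. - (2 * (x \<bullet> b)) * ?d x)" for b
      using Ck_fun_mult[OF Ck_fun_mult[OF Ck_fun_const[of k "-2"] Ck_fun_inner[of k b]]
          Ck_fun_add[OF Ck_fun_mult[OF Ck_fun_const[of k "- real m"] Suc[of "m + 1"]] Suc[of "m + 2"]]]
      by simp
  qed
qed

section \<open>Bounds and closure properties of test functions\<close>

lemma test_functions_iff:
  "f \<in> test_functions \<longleftrightarrow> (\<forall>k. Ck_fun k f) \<and> (\<exists>R. \<forall>x. R < norm x \<longrightarrow> f x = 0)"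
proof -
  have "compact (closure {x. f x \<noteq> 0}) \<longleftrightarrow> bounded {x. f x \<noteq> 0}" by simp
  also have "\<dots> \<longleftrightarrow> (\<exists>R. \<forall>x. R < norm x \<longrightarrow> f x = 0)"
    unfolding bounded_iff by (auto simp: not_less[symmetric])
  finally show ?thesis unfolding test_functions_def by blast
qed

lemma test_function_continuous: "f \<in> test_functions \<Longrightarrow> continuous_on UNIV f"
  unfolding test_functions_iff by (metis Ck_fun.simps(1))

lemma test_function_measurable: "f \<in> test_functions \<Longrightarrow> f \<in> borel_measurable borel"
  by (intro borel_measurable_continuous_onI test_function_continuous)

lemma test_function_bounded:
  fixes f :: "'a::euclidean_space \<Rightarrow> real"
  assumes "f \<in> test_functions"
  obtains B where "B > 0" "\<And>x. \<bar>f x\<bar> \<le> B"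
proof -
  obtain R where R: "\<And>x. R < norm x \<Longrightarrow> f x = 0" using assms unfolding test_functions_iff by blast
  have "compact (f ` cball 0 R)"
    using test_function_continuous[OF assms] by (intro compact_continuous_image) (auto intro: continuous_on_subset)
  then have "bounded (f ` cball 0 R)" by (rule compact_imp_bounded)
  then obtain B where "\<forall>y\<in>f ` cball 0 R. norm y \<le> B"
    unfolding bounded_iff by blast
  then have B: "\<bar>f x\<bar> \<le> B" if "norm x \<le> R" for x using that by auto
  have "\<bar>f x\<bar> \<le> max 1 B" for x
    using R[of x] B[of x] by (cases "norm x \<le> R") auto
  then show ?thesis using that[of "max 1 B"] by simp
qed

lemma test_function_has_derivative:
  "f \<in> test_functions \<Longrightarrow> (f has_derivative frechet_derivative f (at x)) (at x)"
  unfolding test_functions_iff using Ck_fun_has_derivative by blast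

lemma test_function_partial:
  assumes "f \<in> test_functions" "b \<in> Basis"
  shows "(\<lambda>x. frechet_derivative f (at x) b) \<in> test_functions"
proof -
  obtain R where R: "\<And>x. R < norm x \<Longrightarrow> f x = 0" using assms unfolding test_functions_iff by blast
  have "frechet_derivative f (at x) b = 0" if x: "R < norm x" for x
  proof -
    have "open {x::'a. R < norm x}" by (intro open_Collect_less continuous_intros)
    then have "((\<lambda>_. 0) has_derivative frechet_derivative f (at x)) (at x)"
      using x R by (intro has_derivative_transform_within_open[OF test_function_has_derivative[OF assms(1)]]) auto
    then have "frechet_derivative f (at x) = (\<lambda>_. 0)"
      using has_derivative_unique[of "\<lambda>_. 0" _ x "\<lambda>_. 0"] by auto
    then show ?thesis by simp
  qed
  moreover have "Ck_fun k (\<lambda>x. frechet_derivative f (at x) b)" for k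
  proof -
    have "Ck_fun (Suc k) f" using assms unfolding test_functions_iff by blast
    then show ?thesis using assms(2) by simp
  qed
  ultimately show ?thesis unfolding test_functions_iff by blast
qed

lemma test_function_derivative_expand:
  assumes "f \<in> test_functions"
  shows "frechet_derivative f (at x) h = (\<Sum>b\<in>Basis. (h \<bullet> b) * frechet_derivative f (at x) b)"
proof -
  have lin: "linear (frechet_derivative f (at x))"
    using test_function_has_derivative[OF assms] by (rule has_derivative_linear)
  have "frechet_derivative f (at x) (\<Sum>b\<in>Basis. (h \<bullet> b) *\<^sub>R b)
      = (\<Sum>b\<in>Basis. (h \<bullet> b) * frechet_derivative f (at x) b)"
    by (simp add: linear_sum[OF lin] linear_scale[OF lin])
  then show ?thesis by (simp add: euclidean_representation)
qed

text \<open>One constant, the sum of bounds for the partial derivatives, serves both the increments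
  and the derivative; the mollification argument needs both estimates together.\<close>

lemma test_function_Lipschitz:
  fixes f :: "'a::euclidean_space \<Rightarrow> real"
  assumes f: "f \<in> test_functions"
  obtains L where "L > 0" "\<And>x y. \<bar>f x - f y\<bar> \<le> L * norm (x - y)"
    "\<And>x h. \<bar>frechet_derivative f (at x) h\<bar> \<le> L * norm h"
proof -
  have "\<exists>B>0. \<forall>x. \<bar>frechet_derivative f (at x) b\<bar> \<le> B" if "b \<in> Basis" for b
    using test_function_bounded[OF test_function_partial[OF f that]] by metis
  then obtain B where B: "\<And>b. b \<in> Basis \<Longrightarrow> B b > 0"
    "\<And>b x. b \<in> Basis \<Longrightarrow> \<bar>frechet_derivative f (at x) b\<bar> \<le> B b"
    by metis
  define L where "L = (\<Sum>b\<in>(Basis::'a set). B b)"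
  have L0: "L > 0" unfolding L_def using B by (intro sum_pos) auto
  have bd: "\<bar>frechet_derivative f (at x) h\<bar> \<le> L * norm h" for x h
  proof -
    have "\<bar>frechet_derivative f (at x) h\<bar> \<le> (\<Sum>b\<in>Basis. \<bar>h \<bullet> b\<bar> * \<bar>frechet_derivative f (at x) b\<bar>)"
      by (subst test_function_derivative_expand[OF f]) (auto simp: abs_mult[symmetric])
    also have "\<dots> \<le> (\<Sum>b\<in>Basis. norm h * B b)"
      using B by (intro sum_mono mult_mono) (auto simp: Basis_le_norm)
    finally show ?thesis by (simp add: L_def sum_distrib_left mult.commute)
  qed
  have "norm (f x - f y) \<le> L * norm (x - y)" for x y
    by (rule differentiable_bound[where S=UNIV and f'="\<lambda>x. frechet_derivative f (at x)"])
       (auto intro!: has_derivative_at_withinI test_function_has_derivative[OF f] onorm_bound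
         simp: bd L0[THEN less_imp_le])
  then show ?thesis using that[of L] L0 bd by auto
qed

lemma test_function_affine:
  fixes f :: "'a::euclidean_space \<Rightarrow> real"
  assumes f: "f \<in> test_functions" and a: "a \<noteq> 0"
  shows "(\<lambda>x. f (a *\<^sub>R x + c)) \<in> test_functions"
proof -
  obtain R where R: "\<And>x. R < norm x \<Longrightarrow> f x = 0" using f unfolding test_functions_iff by blast
  have "f (a *\<^sub>R x + c) = 0" if "(R + norm c) / \<bar>a\<bar> < norm x" for x
  proof -
    have "R + norm c < \<bar>a\<bar> * norm x" using that a by (simp add: pos_divide_less_eq mult.commute)
    also have "\<bar>a\<bar> * norm x = norm ((a *\<^sub>R x + c) - c)" by simp
    also have "\<dots> \<le> norm (a *\<^sub>R x + c) + norm c" by (rule norm_triangle_ineq4)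
    finally show ?thesis by (intro R) simp
  qed
  then show ?thesis using f Ck_fun_affine[of _ f a c] unfolding test_functions_iff by blast
qed

lemma test_function_cmult: "f \<in> test_functions \<Longrightarrow> (\<lambda>x. c * f x) \<in> test_functions"
  unfolding test_functions_iff by (auto intro!: Ck_fun_mult Ck_fun_const)

lemma test_function_add:
  assumes "f \<in> test_functions" "g \<in> test_functions"
  shows "(\<lambda>x. f x + g x) \<in> test_functions"
proof -
  obtain R S where "\<And>x. R < norm x \<Longrightarrow> f x = 0" "\<And>x. S < norm x \<Longrightarrow> g x = 0"
    using assms unfolding test_functions_iff by blast
  then have "\<forall>x. max R S < norm x \<longrightarrow> f x + g x = 0" by simp
  then show ?thesis using assms unfolding test_functions_iff by (blast intro: Ck_fun_add)
qed

definition bump :: "'a::euclidean_space \<Rightarrow> real" where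
  "bump x = flat_exp 0 (1 - x \<bullet> x)"

lemma bump_pos_iff: "0 < bump x \<longleftrightarrow> norm x < 1"
  and bump_nonneg: "0 \<le> bump x"
  and bump_le_1: "bump x \<le> 1"
  and bump_eq_0: "1 \<le> norm x \<Longrightarrow> bump x = 0"
  by (auto simp: bump_def flat_exp_def norm_eq_sqrt_inner real_sqrt_less_iff[of _ 1, simplified]
        real_sqrt_le_iff[of 1, simplified])

lemma bump_test: "(bump :: 'a::euclidean_space \<Rightarrow> real) \<in> test_functions"
proof -
  have "\<forall>k. Ck_fun k (bump :: 'a::euclidean_space \<Rightarrow> real)"
    by (auto simp: bump_def[abs_def] intro: Ck_fun_flat_exp)
  moreover have "\<forall>x::'a. 1 < norm x \<longrightarrow> bump x = 0" by (simp add: bump_eq_0)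
  ultimately show ?thesis unfolding test_functions_iff by blast
qed

lemma measurable_bump [measurable]: "bump \<in> borel_measurable borel"
  by (rule test_function_measurable[OF bump_test])

lemma integrable_bounded_support:
  fixes f :: "'a::euclidean_space \<Rightarrow> real"
  assumes [measurable]: "f \<in> borel_measurable borel"
    and B: "\<And>x. \<bar>f x\<bar> \<le> B" and R: "\<And>x. R < norm x \<Longrightarrow> f x = 0"
  shows "integrable lborel f"
proof (rule Bochner_Integration.integrable_bound)
  show "integrable lborel (\<lambda>x::'a. B * indicator (cball 0 R) x)"
    by (intro integrable_mult_right integrable_real_indicator emeasure_lborel_cball_finite) auto
  show "AE x in lborel. norm (f x) \<le> norm (B * indicator (cball 0 R) x)"
    using R B by (auto simp: indicator_def not_le intro!: AE_I2 order_trans[OF B])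
qed simp

section \<open>Mollification of bounded measurable functions with bounded support\<close>

definition convolve :: "('a::euclidean_space \<Rightarrow> real) \<Rightarrow> ('a \<Rightarrow> real) \<Rightarrow> 'a \<Rightarrow> real" where
  "convolve f g x = (LINT y|lborel. f y * g (x - y))"

context
  fixes f :: "'a::euclidean_space \<Rightarrow> real" and M R :: real
  assumes f[measurable]: "f \<in> borel_measurable borel"
    and M: "\<And>x. \<bar>f x\<bar> \<le> M" and R: "\<And>x. R < norm x \<Longrightarrow> f x = 0"
begin

lemma integrable_convolve:
  assumes [measurable]: "g \<in> borel_measurable borel" and B: "\<And>x. \<bar>g x\<bar> \<le> B"
  shows "integrable lborel (\<lambda>y. f y * g (x - y))"
proof (rule integrable_bounded_support[where R=R and B="M * B"])
  show "\<bar>f y * g (x - y)\<bar> \<le> M * B" for y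
    unfolding abs_mult using M[of y] B[of "x - y"] by (intro mult_mono) auto
qed (use R in auto)

lemma continuous_convolve:
  assumes g: "g \<in> test_functions"
  shows "continuous_on UNIV (convolve f g)"
proof -
  note [measurable] = test_function_measurable[OF g]
  obtain B where B: "\<And>x. \<bar>g x\<bar> \<le> B" using test_function_bounded[OF g] by metis
  have "(\<lambda>i. convolve f g (X i)) \<longlonglongrightarrow> convolve f g x" if X: "X \<longlonglongrightarrow> x" for X x
    unfolding convolve_def
  proof (rule integral_dominated_convergence[where w="\<lambda>y. M * B * indicator (cball 0 R) y"])
    show "integrable lborel (\<lambda>y::'a. M * B * indicator (cball 0 R) y)"
      by (intro integrable_mult_right integrable_real_indicator emeasure_lborel_cball_finite) auto
    show "AE y in lborel. (\<lambda>i. f y * g (X i - y)) \<longlonglongrightarrow> f y * g (x - y)"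
      using X test_function_continuous[OF g]
      by (intro AE_I2 tendsto_intros continuous_on_tendsto_compose[of UNIV g]) auto
    show "AE y in lborel. norm (f y * g (X i - y)) \<le> M * B * indicator (cball 0 R) y" for i
    proof (rule AE_I2)
      fix y
      have "\<bar>f y * g (X i - y)\<bar> \<le> M * B"
        unfolding abs_mult using M[of y] B[of "X i - y"] by (intro mult_mono) auto
      then show "norm (f y * g (X i - y)) \<le> M * B * indicator (cball 0 R) y"
        using R[of y] by (cases "norm y \<le> R") auto
    qed
  qed measurable
  then show ?thesis by (auto simp: continuous_on_sequentially o_def)
qed

text \<open>f is merely measurable, so every derivative must fall on the smooth factor. Dominated
  convergence yields the full Frechet derivative at once, without passing through continuity of
  partial derivatives.\<close>

lemma has_derivative_convolve:
  assumes g: "g \<in> test_functions"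
  shows "(convolve f g has_derivative
    (\<lambda>h. \<Sum>b\<in>Basis. (h \<bullet> b) * convolve f (\<lambda>x. frechet_derivative g (at x) b) x)) (at x)"
proof -
  let ?D = "\<lambda>b x. frechet_derivative g (at x) b"
  have D: "?D b \<in> test_functions" if "b \<in> Basis" for b by (rule test_function_partial[OF g that])
  note [measurable] = test_function_measurable[OF g] test_function_measurable[OF D]
  obtain B where B: "\<And>x. \<bar>g x\<bar> \<le> B" using test_function_bounded[OF g] by metis
  obtain L where L: "L > 0" "\<And>x y. \<bar>g x - g y\<bar> \<le> L * norm (x - y)" "\<And>x h. \<bar>?D h x\<bar> \<le> L * norm h"
    using test_function_Lipschitz[OF g] by metis
  have iD: "integrable lborel (\<lambda>y. f y * ?D b (x - y))" if b: "b \<in> Basis" for b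
    by (rule integrable_convolve[where B="L * norm b"]) (use L(3) test_function_measurable[OF D[OF b]] in auto)
  \<comment> \<open>f times the first order Taylor remainder of g divided by norm h. The quotient
    tends to 0 pointwise by differentiability and is bounded by 2 L, one L from the increment and
    one from the derivative.\<close>
  define q where "q h y = f y * ((g (x + h - y) - g (x - y) - ?D h (x - y)) / norm h)" for h y
  have eq: "(convolve f g (x + h) - convolve f g x - (\<Sum>b\<in>Basis. (h \<bullet> b) * convolve f (?D b) x)) / norm h
      = (LINT y|lborel. q h y)" for h
  proof -
    have i1: "integrable lborel (\<lambda>y. f y * g (x + h - y))" "integrable lborel (\<lambda>y. f y * g (x - y))"
      using integrable_convolve[of g B] B by auto
    have i2: "integrable lborel (\<lambda>y. \<Sum>b\<in>Basis. (h \<bullet> b) * (f y * ?D b (x - y)))"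
      by (intro Bochner_Integration.integrable_sum integrable_mult_right iD)
    have "(\<Sum>b\<in>Basis. (h \<bullet> b) * convolve f (?D b) x) = (LINT y|lborel. (\<Sum>b\<in>Basis. (h \<bullet> b) * (f y * ?D b (x - y))))"
      unfolding convolve_def by (subst Bochner_Integration.integral_sum) (auto intro: iD)
    then have "(convolve f g (x + h) - convolve f g x - (\<Sum>b\<in>Basis. (h \<bullet> b) * convolve f (?D b) x))
      = (LINT y|lborel. f y * g (x + h - y) - f y * g (x - y) - (\<Sum>b\<in>Basis. (h \<bullet> b) * (f y * ?D b (x - y))))"
      unfolding convolve_def using i1 i2 by simp
    also have "\<dots> = (LINT y|lborel. f y * (g (x + h - y) - g (x - y) - ?D h (x - y)))"
      by (intro Bochner_Integration.integral_cong refl)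
         (simp add: test_function_derivative_expand[OF g, of _ h] algebra_simps sum_distrib_left)
    finally show ?thesis unfolding q_def by simp
  qed
  have "(\<lambda>i. LINT y|lborel. q (X i) y) \<longlonglongrightarrow> (LINT y::'a|lborel. 0)" if X: "X \<longlonglongrightarrow> 0" "\<And>i. X i \<noteq> 0" for X
  proof (rule integral_dominated_convergence[where w="\<lambda>y. M * (2 * L) * indicator (cball 0 R) y"])
    show "integrable lborel (\<lambda>y::'a. M * (2 * L) * indicator (cball 0 R) y)"
      by (intro integrable_mult_right integrable_real_indicator emeasure_lborel_cball_finite) auto
    have [measurable]: "?D h \<in> borel_measurable borel" for h
      unfolding test_function_derivative_expand[OF g, of _ h] by measurable
    show "q (X i) \<in> borel_measurable lborel" for i
      unfolding q_def by measurable
    show "AE y in lborel. (\<lambda>i. q (X i) y) \<longlonglongrightarrow> 0"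
    proof (rule AE_I2)
      fix y
      have "((\<lambda>h. norm (g ((x - y) + h) - g (x - y) - ?D h (x - y)) / norm h) \<longlongrightarrow> 0) (at 0)"
        using test_function_has_derivative[OF g, of "x - y"] unfolding has_derivative_at by simp
      then have "(\<lambda>i. norm (g ((x - y) + X i) - g (x - y) - ?D (X i) (x - y)) / norm (X i)) \<longlonglongrightarrow> 0"
        using X unfolding tendsto_at_iff_sequentially o_def by simp
      moreover have "norm (g ((x - y) + X i) - g (x - y) - ?D (X i) (x - y)) / norm (X i)
          = norm ((g (x + X i - y) - g (x - y) - ?D (X i) (x - y)) / norm (X i))" for i
        unfolding norm_divide by (simp add: algebra_simps)
      ultimately have "(\<lambda>i. (g (x + X i - y) - g (x - y) - ?D (X i) (x - y)) / norm (X i)) \<longlonglongrightarrow> 0"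
        by (subst tendsto_norm_zero_iff[symmetric]) (simp only:)
      from tendsto_mult[OF tendsto_const[of "f y"] this] show "(\<lambda>i. q (X i) y) \<longlonglongrightarrow> 0"
        unfolding q_def by simp
    qed
    show "AE y in lborel. norm (q (X i) y) \<le> M * (2 * L) * indicator (cball 0 R) y" for i
    proof (rule AE_I2)
      fix y
      have "\<bar>g (x + X i - y) - g (x - y) - ?D (X i) (x - y)\<bar> \<le> 2 * L * norm (X i)"
        using L(2)[of "x + X i - y" "x - y"] L(3)[of "x - y" "X i"] by simp
      then have "\<bar>(g (x + X i - y) - g (x - y) - ?D (X i) (x - y)) / norm (X i)\<bar> \<le> 2 * L"
        using X(2)[of i] by (simp add: divide_simps)
      then have "\<bar>q (X i) y\<bar> \<le> M * (2 * L)"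
        unfolding q_def abs_mult[of "f y"] using M[of y] by (intro mult_mono) auto
      then show "norm (q (X i) y) \<le> M * (2 * L) * indicator (cball 0 R) y"
        using R[of y] by (cases "norm y \<le> R") (auto simp: q_def)
    qed
  qed simp_all
  then have "((\<lambda>h. LINT y|lborel. q h y) \<longlongrightarrow> 0) (at 0)"
    by (auto simp: tendsto_at_iff_sequentially o_def)
  then have "((\<lambda>h. norm ((convolve f g (x + h) - convolve f g x -
      (\<Sum>b\<in>Basis. (h \<bullet> b) * convolve f (?D b) x)) / norm h)) \<longlongrightarrow> 0) (at 0)"
    unfolding eq by (rule tendsto_norm_zero)
  moreover have "bounded_linear (\<lambda>h. \<Sum>b\<in>Basis. (h \<bullet> b) * convolve f (?D b) x)"
  proof (rule bounded_linear_sum)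
    show "bounded_linear (\<lambda>h. (h \<bullet> b) * convolve f (?D b) x)" for b :: 'a
      by (rule bounded_linear_mult_const[OF bounded_linear_inner_left])
  qed
  ultimately show ?thesis
    by (simp only: has_derivative_at real_norm_def abs_divide abs_norm_cancel simp_thms)
qed

lemma Ck_fun_convolve: "g \<in> test_functions \<Longrightarrow> Ck_fun k (convolve f g)"
proof (induction k arbitrary: g)
  case 0
  then show ?case by (simp add: continuous_convolve)
next
  case (Suc k)
  show ?case
  proof (rule Ck_fun_SucI[OF has_derivative_convolve[OF Suc.prems]])
    fix b :: 'a assume "b \<in> Basis"
    show "Ck_fun k (\<lambda>x. \<Sum>b'\<in>Basis. (b \<bullet> b') * convolve f (\<lambda>x. frechet_derivative g (at x) b') x)"
      by (intro Ck_fun_sum Ck_fun_mult Ck_fun_const Suc.IH test_function_partial[OF Suc.prems])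
  qed
qed

lemma convolve_test_function:
  assumes g: "g \<in> test_functions"
  shows "convolve f g \<in> test_functions"
proof -
  obtain S where S: "\<And>x. S < norm x \<Longrightarrow> g x = 0" using g unfolding test_functions_iff by blast
  have "convolve f g x = 0" if x: "R + S < norm x" for x
  proof -
    have "(\<lambda>y. f y * g (x - y)) = (\<lambda>y. 0)"
    proof
      fix y show "f y * g (x - y) = 0"
        using R[of y] S[of "x - y"] norm_triangle_sub[of x y] x by (cases "R < norm y") auto
    qed
    then show ?thesis unfolding convolve_def by simp
  qed
  then show ?thesis unfolding test_functions_iff using Ck_fun_convolve[OF g] by blast
qed

end

section \<open>Finite energy and power integrals of test functions\<close>

lemma test_function_finite_gag:
  fixes f :: "real^'n \<Rightarrow> real"
  assumes s: "0 < s" "s < 1" and f: "f \<in> test_functions"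
  shows "gag s f < \<infinity>"
proof -
  obtain R where "\<And>x. R < norm x \<Longrightarrow> f x = 0" using f unfolding test_functions_iff by blast
  moreover obtain L where "\<And>x y. \<bar>f x - f y\<bar> \<le> L * norm (x - y)"
    using test_function_Lipschitz[OF f] by metis
  moreover obtain B where "\<And>x. \<bar>f x\<bar> \<le> B" using test_function_bounded[OF f] by metis
  ultimately show ?thesis
    using gag_finite_Lipschitz[OF s test_function_measurable[OF f]] by blast
qed

lemma Lpow_finite_bounded_support:
  fixes f :: "real^'n \<Rightarrow> real"
  assumes [measurable]: "f \<in> borel_measurable borel"
    and B: "\<And>x. \<bar>f x\<bar> \<le> B" and R: "\<And>x. R < norm x \<Longrightarrow> f x = 0" and r: "0 \<le> r"
  shows "Lpow r f < \<infinity>"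
proof -
  have "integrable lborel (\<lambda>x. \<bar>f x\<bar> powr r)"
    by (rule integrable_bounded_support[where B="B powr r" and R=R])
       (use B R r in \<open>auto intro!: powr_mono2\<close>)
  then show ?thesis by (simp add: integrable_Lpow_iff)
qed

lemma test_function_finite_Lpow:
  fixes f :: "real^'n \<Rightarrow> real"
  assumes f: "f \<in> test_functions" and "0 \<le> r"
  shows "Lpow r f < \<infinity>"
proof -
  obtain R where "\<And>x. R < norm x \<Longrightarrow> f x = 0" using f unfolding test_functions_iff by blast
  moreover obtain B where "\<And>x. \<bar>f x\<bar> \<le> B" using test_function_bounded[OF f] by metis
  ultimately show ?thesis
    using Lpow_finite_bounded_support[OF test_function_measurable[OF f]] assms(2) by blast
qed

section \<open>The closure of the test functions\<close>

lemma crit_exp_gt_2: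
  assumes "0 < s" "2 * s < N"
  shows "2 < crit_exp N s"
  using assms by (simp add: crit_exp_def field_simps)

lemma frac_const_pos:
  assumes "0 < s" "s < 1" "0 < N"
  shows "0 < frac_const N s"
  using assms by (auto simp: frac_const_def intro!: divide_pos_pos mult_pos_pos Gamma_real_pos)

lemma finite_energy_diff_test:
  fixes u :: "real^'n \<Rightarrow> real"
  assumes s: "0 < s" "s < 1" "2 * s < real CARD('n)"
    and u: "u \<in> finite_energy s" and f: "f \<in> test_functions"
  shows "(\<lambda>x. u x - f x) \<in> finite_energy s"
proof -
  let ?r = "crit_exp (real CARD('n)) s"
  have r: "?r > 2" by (rule crit_exp_gt_2[OF s(1,3)])
  have [measurable]: "u \<in> borel_measurable borel" "f \<in> borel_measurable borel"
    using u test_function_measurable[OF f] by (auto simp: finite_energy_iff)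
  have fin: "gag s u < \<infinity>" "Lpow ?r u < \<infinity>" "gag s f < \<infinity>" "Lpow ?r f < \<infinity>"
    using u test_function_finite_gag[OF s(1,2) f] test_function_finite_Lpow[OF f, of ?r] r
    by (auto simp: finite_energy_iff)
  have "gag s (\<lambda>x. u x + - f x) \<le> 2 * gag s u + 2 * gag s f"
    using gag_add_le[of u "\<lambda>x. - f x" s] by (simp add: gag_minus)
  also have "\<dots> < \<infinity>" using fin by (simp add: ennreal_mult_less_top)
  finally have "gag s (\<lambda>x. u x - f x) < \<infinity>" by simp
  moreover have "Lpow ?r (\<lambda>x. u x + - f x) \<le> ennreal (2 powr ?r) * (Lpow ?r u + Lpow ?r (\<lambda>x. - f x))"
    using r by (intro Lpow_add_le) auto
  then have "Lpow ?r (\<lambda>x. u x - f x) < \<infinity>"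
    using fin by (simp add: Lpow_def ennreal_mult_less_top le_less_trans)
  ultimately show ?thesis by (simp add: finite_energy_iff)
qed

text \<open>Convergence of the two norms to zero is equivalent to convergence of their powers, which
  can be handled in \<open>ennreal\<close>. Positivity of \<open>frac_const\<close> is what allows
  the energy to be recovered from the seminorm.\<close>

lemma Hs_dot_iff:
  fixes u :: "real^'n \<Rightarrow> real"
  assumes s: "0 < s" "s < 1" "2 * s < real CARD('n)"
  shows "u \<in> Hs_dot s \<longleftrightarrow> u \<in> finite_energy s \<and> (\<exists>\<phi>. (\<forall>k. \<phi> k \<in> test_functions) \<and>
    (\<lambda>k. gag s (\<lambda>x. u x - \<phi> k x)) \<longlonglongrightarrow> 0 \<and>
    (\<lambda>k. Lpow (crit_exp (real CARD('n)) s) (\<lambda>x. u x - \<phi> k x)) \<longlonglongrightarrow> 0)"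
proof -
  let ?r = "crit_exp (real CARD('n)) s"
  have r: "?r > 2" by (rule crit_exp_gt_2[OF s(1,3)])
  define c where "c = frac_const (real CARD('n)) s / 2"
  have c: "c > 0" using frac_const_pos[OF s(1,2), of "real CARD('n)"] by (auto simp: c_def)
  have "(\<lambda>k. Hs_seminorm s (\<lambda>x. u x - \<phi> k x) + Lp_norm ?r (\<lambda>x. u x - \<phi> k x)) \<longlonglongrightarrow> 0 \<longleftrightarrow>
      (\<lambda>k. gag s (\<lambda>x. u x - \<phi> k x)) \<longlonglongrightarrow> 0 \<and> (\<lambda>k. Lpow ?r (\<lambda>x. u x - \<phi> k x)) \<longlonglongrightarrow> 0"
    if u: "u \<in> finite_energy s" and \<phi>: "\<And>k. \<phi> k \<in> test_functions" for \<phi> :: "nat \<Rightarrow> real^'n \<Rightarrow> real"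
  proof -
    define d where "d k = (\<lambda>x. u x - \<phi> k x)" for k
    have d: "d k \<in> finite_energy s" for k
      unfolding d_def by (rule finite_energy_diff_test[OF s u \<phi>])
    define G where "G k = gagliardo_form s (d k) (d k)" for k
    define L where "L k = (LINT x|lborel. \<bar>d k x\<bar> powr ?r)" for k
    have G0: "G k \<ge> 0" for k unfolding G_def by (rule gagliardo_form_nonneg)
    have L0: "L k \<ge> 0" for k unfolding L_def by simp
    have G: "gag s (d k) = ennreal (G k)" for k
      using d[of k] gagliardo_form_gag[of "d k" s] by (simp add: finite_energy_iff G_def)
    have L: "Lpow ?r (d k) = ennreal (L k)" for k
      using d[of k] integral_Lpow[of "d k" ?r] by (simp add: finite_energy_def L_def)
    have Hs: "Hs_seminorm s (d k) = sqrt (c * G k)" for k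
      by (simp add: Hs_seminorm_def c_def G_def)
    have Lp: "Lp_norm ?r (d k) = L k powr (1 / ?r)" for k
      by (simp add: Lp_norm_def L_def)
    have "(\<lambda>k. sqrt (c * G k) + L k powr (1 / ?r)) \<longlonglongrightarrow> 0 \<longleftrightarrow> G \<longlonglongrightarrow> 0 \<and> L \<longlonglongrightarrow> 0"
    proof
      assume lim: "(\<lambda>k. sqrt (c * G k) + L k powr (1 / ?r)) \<longlonglongrightarrow> 0"
      have "(\<lambda>k. sqrt (c * G k)) \<longlonglongrightarrow> 0"
        by (rule tendsto_sandwich[OF _ _ tendsto_const lim]) (use G0 c in auto)
      then have "(\<lambda>k. (sqrt (c * G k))\<^sup>2 / c) \<longlonglongrightarrow> 0\<^sup>2 / c"
        using c by (intro tendsto_intros) auto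
      moreover have "(\<lambda>k. L k powr (1 / ?r)) \<longlonglongrightarrow> 0"
        by (rule tendsto_sandwich[OF _ _ tendsto_const lim]) (use G0 c in auto)
      then have "(\<lambda>k. (L k powr (1 / ?r)) powr ?r) \<longlonglongrightarrow> 0 powr ?r"
        using r by (intro tendsto_powr2 tendsto_const) auto
      ultimately show "G \<longlonglongrightarrow> 0 \<and> L \<longlonglongrightarrow> 0"
        using c r G0 L0 by (simp add: powr_powr)
    next
      assume lim: "G \<longlonglongrightarrow> 0 \<and> L \<longlonglongrightarrow> 0"
      have "(\<lambda>k. sqrt (c * G k) + L k powr (1 / ?r)) \<longlonglongrightarrow> sqrt (c * 0) + 0 powr (1 / ?r)"
        using lim r L0 by (intro tendsto_intros tendsto_powr2) auto
      then show "(\<lambda>k. sqrt (c * G k) + L k powr (1 / ?r)) \<longlonglongrightarrow> 0" by simp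
    qed
    moreover have "(\<lambda>k. ennreal (G k)) \<longlonglongrightarrow> 0 \<longleftrightarrow> G \<longlonglongrightarrow> 0" "(\<lambda>k. ennreal (L k)) \<longlonglongrightarrow> 0 \<longleftrightarrow> L \<longlonglongrightarrow> 0"
      using tendsto_ennreal_iff[of G sequentially 0] tendsto_ennreal_iff[of L sequentially 0] G0 L0 by auto
    ultimately show ?thesis
      by (simp only: d_def[symmetric] G L Hs Lp)
  qed
  then show ?thesis unfolding Hs_dot_def by blast
qed

lemma lborel_distr_minus: "distr lborel borel (\<lambda>z. x - z) = (lborel :: 'a::euclidean_space measure)"
proof (rule measure_eqI)
  fix A assume "A \<in> sets (distr lborel borel (\<lambda>z. x - z))"
  then have [measurable]: "A \<in> sets borel" by simp
  have [measurable]: "(indicator A :: 'a \<Rightarrow> ennreal) \<in> borel_measurable borel"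
    by (rule borel_measurable_indicator) fact
  have "emeasure (distr lborel borel (\<lambda>z. x - z)) A = (\<integral>\<^sup>+z. indicator A z \<partial>distr lborel borel (\<lambda>z. x - z))"
    by simp
  also have "\<dots> = (\<integral>\<^sup>+z. indicator A (x - z) \<partial>lborel)"
    by (rule nn_integral_distr) auto
  also have "\<dots> = (\<integral>\<^sup>+z. indicator A z \<partial>lborel)"
    by (rule nn_integral_lborel_translate_minus) measurable
  finally show "emeasure (distr lborel borel (\<lambda>z. x - z)) A = emeasure lborel A" by simp
qed simp

text \<open>Jensen's inequality for the square under the probability weight w, read off from the
  nonnegativity of the variance.\<close>

lemma square_integral_le_weighted:
  fixes g w :: "'a \<Rightarrow> real"
  assumes [measurable]: "g \<in> borel_measurable M" and B: "\<And>x. \<bar>g x\<bar> \<le> B"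
    and w: "integrable M w" "\<And>x. 0 \<le> w x" "(\<integral>x. w x \<partial>M) = 1"
  shows "(\<integral>x. g x * w x \<partial>M)\<^sup>2 \<le> (\<integral>x. (g x)\<^sup>2 * w x \<partial>M)" "integrable M (\<lambda>x. (g x)\<^sup>2 * w x)"
proof -
  have [measurable]: "w \<in> borel_measurable M" using w(1) by simp
  have bnd: "integrable M (\<lambda>x. h x * w x)" if [measurable]: "h \<in> borel_measurable M" and "\<And>x. \<bar>h x\<bar> \<le> C" for h C
  proof (rule Bochner_Integration.integrable_bound[OF integrable_mult_right[OF w(1), of C]])
    show "AE x in M. norm (h x * w x) \<le> norm (C * w x)"
    proof (rule AE_I2)
      fix x
      have "\<bar>h x\<bar> * w x \<le> \<bar>C\<bar> * w x" using that(2)[of x] w(2)[of x] by (intro mult_right_mono) auto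
      then show "norm (h x * w x) \<le> norm (C * w x)" using w(2)[of x] by (simp add: abs_mult)
    qed
  qed simp
  have i1: "integrable M (\<lambda>x. g x * w x)" by (rule bnd[OF _ B]) simp
  show i2: "integrable M (\<lambda>x. (g x)\<^sup>2 * w x)"
    by (rule bnd[where C="B\<^sup>2"]) (use power_mono[OF B, where n=2] in auto)
  let ?m = "\<integral>x. g x * w x \<partial>M"
  have "0 \<le> (\<integral>x. (g x - ?m)\<^sup>2 * w x \<partial>M)"
    by (rule integral_nonneg_AE) (use w in auto)
  also have "\<dots> = (\<integral>x. (g x)\<^sup>2 * w x - 2 * ?m * (g x * w x) + ?m\<^sup>2 * w x \<partial>M)"
    by (intro Bochner_Integration.integral_cong refl) (simp add: power2_eq_square algebra_simps)
  also have "\<dots> = (\<integral>x. (g x)\<^sup>2 * w x \<partial>M) - 2 * ?m * ?m + ?m\<^sup>2 * 1"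
    using i1 i2 w by simp
  finally show "?m\<^sup>2 \<le> (\<integral>x. (g x)\<^sup>2 * w x \<partial>M)" by (simp add: power2_eq_square)
qed

lemma gag_translate:
  fixes u :: "real^'n \<Rightarrow> real"
  assumes [measurable]: "u \<in> borel_measurable borel"
  shows "gag s (\<lambda>x. u (x - c)) = gag s u"
proof -
  define h where "h x y = ennreal ((u x - u y)\<^sup>2 / norm (x - y) powr (real CARD('n) + 2 * s))" for x y
  have [measurable]: "(\<lambda>(x, y). h x y) \<in> borel_measurable (borel \<Otimes>\<^sub>M borel)"
    unfolding h_def by measurable
  have "gag s (\<lambda>x. u (x - c)) = (\<integral>\<^sup>+x. (\<integral>\<^sup>+y. h (x - c) (y - c) \<partial>lborel) \<partial>lborel)"
    by (subst gag_eq_iterated) (simp_all add: h_def)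
  also have "\<dots> = (\<integral>\<^sup>+x. (\<integral>\<^sup>+y. h (x - c) y \<partial>lborel) \<partial>lborel)"
  proof (rule nn_integral_cong)
    fix x show "(\<integral>\<^sup>+y. h (x - c) (y - c) \<partial>lborel) = (\<integral>\<^sup>+y. h (x - c) y \<partial>lborel)"
      using nn_integral_lborel_translate[of "h (x - c)" "- c"] by simp
  qed
  also have "\<dots> = (\<integral>\<^sup>+x. (\<integral>\<^sup>+y. h x y \<partial>lborel) \<partial>lborel)"
    using nn_integral_lborel_translate[of "\<lambda>x. (\<integral>\<^sup>+y. h x y \<partial>lborel)" "- c"] by simp
  also have "\<dots> = gag s u" unfolding gag_eq_iterated[OF assms] h_def ..
  finally show ?thesis .
qed

section \<open>Averaging against a mollifier of unit mass\<close>

context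
  fixes f :: "real^'n \<Rightarrow> real" and M R :: real and \<eta> :: "real^'n \<Rightarrow> real"
  assumes f[measurable]: "f \<in> borel_measurable borel"
    and M: "\<And>x. \<bar>f x\<bar> \<le> M" and R: "\<And>x. R < norm x \<Longrightarrow> f x = 0"
    and \<eta>: "\<eta> \<in> test_functions" and \<eta>0: "\<And>x. 0 \<le> \<eta> x" and \<eta>1: "integrable lborel \<eta>" "(LINT x|lborel. \<eta> x) = 1"
begin

lemma measurable_weight: "\<eta> \<in> borel_measurable borel"
  by (rule test_function_measurable[OF \<eta>])

text \<open>The shift is moved onto f, whose translates all have the same energy.\<close>

lemma convolve_shift: "convolve f \<eta> x = (LINT z|lborel. f (x - z) * \<eta> z)"
proof -
  note [measurable] = measurable_weight
  have "convolve f \<eta> x = (LINT z|distr lborel borel (\<lambda>z. x - z). f z * \<eta> (x - z))"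
    by (simp add: convolve_def lborel_distr_minus)
  also have "\<dots> = (LINT z|lborel. f (x - z) * \<eta> (x - (x - z)))"
    by (rule integral_distr) auto
  finally show ?thesis by simp
qed

lemma integrable_shift: "integrable lborel (\<lambda>z. f (x - z) * \<eta> z)"
proof (rule Bochner_Integration.integrable_bound[OF integrable_mult_right[OF \<eta>1(1), of M]])
  note [measurable] = measurable_weight
  show "(\<lambda>z. f (x - z) * \<eta> z) \<in> borel_measurable lborel" by measurable
  show "AE z in lborel. norm (f (x - z) * \<eta> z) \<le> norm (M * \<eta> z)"
  proof (rule AE_I2)
    fix z
    have "\<bar>f (x - z)\<bar> * \<eta> z \<le> \<bar>M\<bar> * \<eta> z" using M[of "x - z"] \<eta>0[of z] by (intro mult_right_mono) auto
    then show "norm (f (x - z) * \<eta> z) \<le> norm (M * \<eta> z)" using \<eta>0[of z] by (simp add: abs_mult)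
  qed
qed

text \<open>A weighted average stays between the bounds that f satisfies at the points reached by
  the weight. One use gives convergence at points of continuity, another a majorant for the
  mollified functions.\<close>

lemma convolve_bounds:
  assumes "\<And>z. \<eta> z \<noteq> 0 \<Longrightarrow> a \<le> f (x - z) \<and> f (x - z) \<le> b"
  shows "a \<le> convolve f \<eta> x" "convolve f \<eta> x \<le> b"
proof -
  have pt: "a * \<eta> z \<le> f (x - z) * \<eta> z \<and> f (x - z) * \<eta> z \<le> b * \<eta> z" for z
    using assms[of z] \<eta>0[of z] by (cases "\<eta> z = 0") (auto intro: mult_right_mono)
  have "(LINT z|lborel. a * \<eta> z) \<le> (LINT z|lborel. f (x - z) * \<eta> z)"
    by (rule integral_mono) (use pt integrable_shift \<eta>1 in auto)
  then show "a \<le> convolve f \<eta> x" using \<eta>1 by (simp add: convolve_shift)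
  have "(LINT z|lborel. f (x - z) * \<eta> z) \<le> (LINT z|lborel. b * \<eta> z)"
    by (rule integral_mono) (use pt integrable_shift \<eta>1 in auto)
  then show "convolve f \<eta> x \<le> b" using \<eta>1 by (simp add: convolve_shift)
qed

text \<open>A mollification is an average of translates, the energy is convex and translation
  invariant, and the weights have total mass 1.\<close>

lemma gag_convolve_le: "gag s (convolve f \<eta>) \<le> gag s f"
proof -
  note [measurable] = measurable_weight
  let ?P = "lborel \<Otimes>\<^sub>M lborel :: ((real^'n) \<times> (real^'n)) measure"
  have pt: "ennreal (gagliardo_integrand s (convolve f \<eta>) (convolve f \<eta>) p)
      \<le> (\<integral>\<^sup>+z. ennreal (\<eta> z) * ennreal (gagliardo_integrand s (\<lambda>x. f (x - z)) (\<lambda>x. f (x - z)) p) \<partial>lborel)" for p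
  proof -
    obtain x y where p: "p = (x, y)" by (cases p)
    let ?d = "norm (x - y) powr (real CARD('n) + 2 * s)"
    have "convolve f \<eta> x - convolve f \<eta> y = (LINT z|lborel. (f (x - z) - f (y - z)) * \<eta> z)"
      unfolding convolve_shift using integrable_shift by (simp add: left_diff_distrib)
    moreover have bd: "\<bar>f (x - z) - f (y - z)\<bar> \<le> 2 * M" for z
      using M[of "x - z"] M[of "y - z"] by linarith
    ultimately have "(convolve f \<eta> x - convolve f \<eta> y)\<^sup>2 \<le> (LINT z|lborel. (f (x - z) - f (y - z))\<^sup>2 * \<eta> z)"
      and int: "integrable lborel (\<lambda>z. (f (x - z) - f (y - z))\<^sup>2 * \<eta> z)"
      using square_integral_le_weighted[of "\<lambda>z. f (x - z) - f (y - z)" lborel "2 * M" \<eta>] \<eta>0 \<eta>1 by auto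
    then have "gagliardo_integrand s (convolve f \<eta>) (convolve f \<eta>) p
        \<le> (LINT z|lborel. (f (x - z) - f (y - z))\<^sup>2 * \<eta> z) / ?d"
      unfolding p gagliardo_integrand_self by (intro divide_right_mono) auto
    also have "\<dots> = (LINT z|lborel. \<eta> z * gagliardo_integrand s (\<lambda>x. f (x - z)) (\<lambda>x. f (x - z)) p)"
      by (simp add: p gagliardo_integrand_self mult.commute)
    finally have "ennreal (gagliardo_integrand s (convolve f \<eta>) (convolve f \<eta>) p)
        \<le> ennreal (LINT z|lborel. \<eta> z * gagliardo_integrand s (\<lambda>x. f (x - z)) (\<lambda>x. f (x - z)) p)"
      by (rule ennreal_leI)
    also have "\<dots> = (\<integral>\<^sup>+z. ennreal (\<eta> z * gagliardo_integrand s (\<lambda>x. f (x - z)) (\<lambda>x. f (x - z)) p) \<partial>lborel)"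
    proof (rule nn_integral_eq_integral[symmetric])
      show "integrable lborel (\<lambda>z. \<eta> z * gagliardo_integrand s (\<lambda>x. f (x - z)) (\<lambda>x. f (x - z)) p)"
        using integrable_divide_zero[of ?d lborel "\<lambda>z. (f (x - z) - f (y - z))\<^sup>2 * \<eta> z"] int
        by (simp add: p gagliardo_integrand_self mult.commute)
    qed (intro AE_I2 mult_nonneg_nonneg \<eta>0 gagliardo_integrand_nonneg)
    finally show ?thesis by (simp add: ennreal_mult' \<eta>0)
  qed
  have "gag s (convolve f \<eta>) \<le> (\<integral>\<^sup>+p. (\<integral>\<^sup>+z. ennreal (\<eta> z) *
      ennreal (gagliardo_integrand s (\<lambda>x. f (x - z)) (\<lambda>x. f (x - z)) p) \<partial>lborel) \<partial>?P)"
    unfolding gag_def by (intro nn_integral_mono pt)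
  also have "\<dots> = (\<integral>\<^sup>+z. (\<integral>\<^sup>+p. ennreal (\<eta> z) *
      ennreal (gagliardo_integrand s (\<lambda>x. f (x - z)) (\<lambda>x. f (x - z)) p) \<partial>?P) \<partial>lborel)"
  proof -
    interpret pair_sigma_finite "lborel :: (real^'n) measure" ?P
      by (intro pair_sigma_finite.intro lborel.sigma_finite_measure_axioms lborel_pair.sigma_finite_measure_axioms)
    show ?thesis
      unfolding gagliardo_integrand_def split_beta by (rule Fubini') measurable
  qed
  also have "\<dots> = (\<integral>\<^sup>+z. ennreal (\<eta> z) * gag s (\<lambda>x. f (x - z)) \<partial>lborel)"
    unfolding gag_def by (rule nn_integral_cong) (simp add: nn_integral_cmult)
  also have "\<dots> = (\<integral>\<^sup>+z. ennreal (\<eta> z) \<partial>lborel) * gag s f"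
    by (simp add: gag_translate nn_integral_multc)
  also have "(\<integral>\<^sup>+z. ennreal (\<eta> z) \<partial>lborel) = 1"
    using \<eta>1 \<eta>0 by (subst nn_integral_eq_integral) auto
  finally show ?thesis by simp
qed

end


section \<open>Radially decreasing functions\<close>

text \<open>The profile is negated so that it is increasing, the orientation in which countability
  of the discontinuities is stated. Clamping the radius at 0 makes it monotone on the whole
  line.\<close>

lemma radially_decreasing_profile:
  fixes u :: "'a::euclidean_space \<Rightarrow> real"
  assumes "radially_decreasing u"
  obtains g where "mono g" "\<And>x. u x = - g (norm x)"
proof -
  obtain e :: 'a where e: "norm e = 1" using vector_choose_size[of 1] by auto
  define g where "g t = - u (max t 0 *\<^sub>R e)" for t
  have "mono g"
    by (intro monoI) (use assms e in \<open>auto simp: g_def radially_decreasing_def\<close>)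
  moreover have "u x = - g (norm x)" for x
    using assms e by (auto simp: g_def radially_decreasing_def intro!: antisym)
  ultimately show ?thesis using that by blast
qed

lemma radially_decreasing_measurable:
  fixes u :: "'a::euclidean_space \<Rightarrow> real"
  assumes "radially_decreasing u"
  shows "u \<in> borel_measurable borel"
proof -
  obtain g where g: "mono g" "\<And>x. u x = - g (norm x)"
    using radially_decreasing_profile[OF assms] by metis
  have [measurable]: "g \<in> borel_measurable borel" using g(1) by (rule borel_measurable_mono)
  have "u = (\<lambda>x. - g (norm x))" using g(2) by auto
  then show ?thesis by simp
qed

lemma AE_norm_not_in_countable:
  assumes "countable D"
  shows "AE x in lborel. norm (x::'a::euclidean_space) \<notin> D"
proof (rule AE_I')
  have "sphere (0::'a) d \<in> null_sets lborel" for d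
    using negligible_sphere[of "0::'a" d]
    by (simp add: negligible_iff_null_sets null_sets_completion_iff)
  then show "(\<Union>d\<in>D. sphere (0::'a) d) \<in> null_sets lborel"
    by (intro null_sets_UN' assms)
qed auto

text \<open>A monotone profile has countably many jumps, and each jump radius contributes only a
  null sphere.\<close>

lemma radially_decreasing_AE_isCont:
  fixes u :: "'a::euclidean_space \<Rightarrow> real"
  assumes "radially_decreasing u"
  shows "AE x in lborel. isCont u x"
proof -
  obtain g where g: "mono g" "\<And>x. u x = - g (norm x)"
    using radially_decreasing_profile[OF assms] by metis
  have u: "u = (\<lambda>x. - g (norm x))" using g(2) by auto
  have "AE x in lborel. norm (x::'a) \<notin> {a. \<not> isCont g a}"
    by (rule AE_norm_not_in_countable[OF mono_ctble_discont[OF g(1)]])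
  then show ?thesis
  proof eventually_elim
    case (elim x)
    then show ?case unfolding u by (intro continuous_minus isCont_o2[of x norm g]) auto
  qed
qed

lemma radially_decreasing_vanishes:
  fixes u :: "real^'n \<Rightarrow> real"
  assumes rd: "radially_decreasing u" and fin: "Lpow r u < \<infinity>" and r: "r > 0" and d: "d > 0"
  obtains R where "\<And>x. R < norm x \<Longrightarrow> u x \<le> d"
proof -
  have "\<exists>y. u y \<le> d"
  proof (rule ccontr)
    assume "\<not> (\<exists>y. u y \<le> d)"
    then have gt: "d \<le> u y" for y by (meson linear not_le)
    have "(\<integral>\<^sup>+x. ennreal (d powr r) \<partial>(lborel :: (real^'n) measure)) \<le> Lpow r u"
      unfolding Lpow_def using gt d r
      by (intro nn_integral_mono ennreal_leI powr_mono2) (auto intro: order_trans[OF gt] order_trans[OF _ abs_ge_self])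
    moreover have "(\<integral>\<^sup>+x. ennreal (d powr r) \<partial>(lborel :: (real^'n) measure)) = \<infinity>"
      using d by (simp add: ennreal_mult_eq_top_iff emeasure_lborel_UNIV)
    ultimately show False using fin by simp
  qed
  then obtain y where "u y \<le> d" by blast
  then show ?thesis using that[of "norm y"] rd unfolding radially_decreasing_def
    by (meson less_imp_le order_trans)
qed

text \<open>Multiplication by a cutoff is avoided, since its energy would need a separate estimate.
  Lowering u by d n and cutting at 0 gives bounded support without raising the energy, because u
  falls below every positive level outside a ball. Mollification keeps the energy bound, so that
  \<open>gag_strong_convergence\<close> applies.\<close>

lemma radially_decreasing_Hs_dot:
  fixes u :: "real^'n \<Rightarrow> real"
  assumes s: "0 < s" "s < 1" "2 * s < real CARD('n)"
    and rd: "radially_decreasing u" and u0: "\<And>x. 0 \<le> u x" and fe: "u \<in> finite_energy s"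
  shows "u \<in> Hs_dot s"
proof -
  let ?N = "CARD('n)" and ?r = "crit_exp (real CARD('n)) s"
  have r: "?r > 2" by (rule crit_exp_gt_2[OF s(1,3)])
  have um[measurable]: "u \<in> borel_measurable borel" by (rule radially_decreasing_measurable[OF rd])
  have fin: "gag s u < \<infinity>" "Lpow ?r u < \<infinity>" using fe by (auto simp: finite_energy_iff)
  have ule: "u x \<le> u 0" for x using rd by (auto simp: radially_decreasing_def)
  define c where "c = (LINT x|lborel. bump (x::real^'n))"
  have ib: "integrable lborel (bump :: real^'n \<Rightarrow> real)"
    by (rule integrable_bounded_support[where B=1 and R=1]) (auto simp: bump_nonneg bump_le_1 bump_eq_0)
  have c: "c > 0"
  proof -
    have "c \<noteq> 0"
    proof
      assume "c = 0"
      then have "AE x in lborel. bump (x::real^'n) = 0"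
        using integral_nonneg_eq_0_iff_AE[OF ib] bump_nonneg unfolding c_def by auto
      moreover have "bump x \<noteq> 0 \<longleftrightarrow> norm x < 1" for x :: "real^'n"
        using bump_pos_iff[of x] bump_nonneg[of x] by linarith
      ultimately have "AE x in lborel. x \<notin> ball (0::real^'n) 1" by auto
      then have "ball (0::real^'n) 1 \<in> null_sets lborel"
        by (subst AE_iff_null_sets) auto
      then have "emeasure lborel (ball (0::real^'n) 1) = 0" by (rule null_setsD1)
      then show False by (simp add: emeasure_ball) (metis less_numeral_extra(3) of_nat_0_le_iff unit_ball_vol_pos)
    qed
    moreover have "c \<ge> 0" unfolding c_def by (intro integral_nonneg_AE) (auto simp: bump_nonneg)
    ultimately show ?thesis by simp
  qed
  define d where "d n = 1 / real (Suc n)" for n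
  have d: "d n > 0" "d n \<le> 1" for n by (auto simp: d_def)
  have dlim: "d \<longlonglongrightarrow> 0" unfolding d_def by (rule LIMSEQ_Suc, rule lim_1_over_n)
  \<comment> \<open>Unit mass, supported in the ball of radius d n, the same scale by which u is
    lowered.\<close>
  define \<eta> where "\<eta> n x = real (Suc n) ^ ?N / c * bump (real (Suc n) *\<^sub>R (x::real^'n))" for n x
  have \<eta>test: "\<eta> n \<in> test_functions" for n
    unfolding \<eta>_def[abs_def] using test_function_affine[OF bump_test, of "real (Suc n)" "0::real^'n"]
    by (intro test_function_cmult) auto
  have \<eta>0: "\<eta> n x \<ge> 0" for n x using c by (auto simp: \<eta>_def bump_nonneg)
  have \<eta>supp: "norm x < d n" if "\<eta> n x \<noteq> 0" for n x
  proof -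
    have "norm (real (Suc n) *\<^sub>R x) < 1"
      using that bump_eq_0[of "real (Suc n) *\<^sub>R x"] by (auto simp: \<eta>_def not_le[symmetric])
    then show ?thesis by (simp add: d_def pos_less_divide_eq mult.commute del: of_nat_Suc)
  qed
  note [measurable] = test_function_measurable[OF \<eta>test]
  have \<eta>nn: "(\<integral>\<^sup>+x. ennreal (\<eta> n x) \<partial>lborel) = 1" for n
  proof -
    have "(\<integral>\<^sup>+x. ennreal (\<eta> n x) \<partial>lborel)
        = ennreal (real (Suc n) ^ ?N / c) * (\<integral>\<^sup>+x. ennreal (bump (real (Suc n) *\<^sub>R (x::real^'n))) \<partial>lborel)"
    proof -
      have "ennreal (\<eta> n x) = ennreal (real (Suc n) ^ ?N / c) * ennreal (bump (real (Suc n) *\<^sub>R x))" for x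
        unfolding \<eta>_def using c by (intro ennreal_mult') auto
      then show ?thesis by (simp only:) (rule nn_integral_cmult, measurable)
    qed
    also have "(\<integral>\<^sup>+x. ennreal (bump (real (Suc n) *\<^sub>R (x::real^'n))) \<partial>lborel)
        = ennreal (real (Suc n) powr - real ?N) * (\<integral>\<^sup>+x. ennreal (bump (x::real^'n)) \<partial>lborel)"
      using nn_integral_lborel_scale'[of "\<lambda>x::real^'n. ennreal (bump x)" "real (Suc n)"] by simp
    also have "(\<integral>\<^sup>+x. ennreal (bump (x::real^'n)) \<partial>lborel) = ennreal c"
      unfolding c_def using ib by (subst nn_integral_eq_integral) (auto simp: bump_nonneg)
    also have "ennreal (real (Suc n) ^ ?N / c) * (ennreal (real (Suc n) powr - real ?N) * ennreal c)
        = ennreal (real (Suc n) ^ ?N / c * (real (Suc n) powr - real ?N * c))"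
      using c by (simp only: ennreal_mult'[symmetric] ennreal_mult''[symmetric] less_imp_le)
        (simp add: ennreal_mult''[symmetric])
    also have "real (Suc n) ^ ?N / c * (real (Suc n) powr - real ?N * c) = 1"
      using c by (simp add: powr_minus powr_realpow del: of_nat_Suc)
    finally show ?thesis by simp
  qed
  have \<eta>i: "integrable lborel (\<eta> n)" for n
    by (rule integrableI_nonneg) (use \<eta>0 \<eta>nn in auto)
  have \<eta>1: "(LINT x|lborel. \<eta> n x) = 1" for n
    using \<eta>nn[of n] \<eta>0 by (simp add: integral_eq_nn_integral)
  define v where "v n x = max (u x - d n) 0" for n x
  have [measurable]: "v n \<in> borel_measurable borel" for n unfolding v_def by measurable
  have "\<exists>R. \<forall>x. R < norm x \<longrightarrow> u x \<le> d n" for n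
    using radially_decreasing_vanishes[OF rd fin(2) _ d(1)[of n]] r by (metis less_trans zero_less_numeral)
  then obtain R where R: "\<And>n x. R n < norm x \<Longrightarrow> u x \<le> d n" by metis
  have vR: "R n < norm x \<Longrightarrow> v n x = 0" for n x using R[of n x] by (simp add: v_def)
  have vM: "\<bar>v n x\<bar> \<le> u 0" for n x using ule[of x] u0[of x] u0[of 0] d[of n] by (auto simp: v_def)
  have vu: "u x - d n \<le> v n x" "v n x \<le> u x" for n x using u0[of x] d[of n] by (auto simp: v_def)
  define \<phi> where "\<phi> n = convolve (v n) (\<eta> n)" for n
  have \<phi>test: "\<phi> n \<in> test_functions" for n
    unfolding \<phi>_def by (rule convolve_test_function[OF _ vM vR \<eta>test]) simp
  note [measurable] = test_function_measurable[OF \<phi>test]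
  note bounds = convolve_bounds[OF _ vM vR \<eta>test \<eta>0 \<eta>i \<eta>1]
  have gle: "gag s (\<phi> n) \<le> gag s u" for n
  proof -
    have "gag s (\<phi> n) \<le> gag s (v n)"
      unfolding \<phi>_def by (rule gag_convolve_le[OF _ vM vR \<eta>test \<eta>0 \<eta>i \<eta>1]) simp
    also have "\<dots> \<le> gag s u" by (rule gag_mono) (auto simp: v_def max_def)
    finally show ?thesis .
  qed
  have lim: "AE x in lborel. (\<lambda>n. \<phi> n x) \<longlonglongrightarrow> u x"
    using radially_decreasing_AE_isCont[OF rd]
  proof eventually_elim
    case (elim x)
    show ?case
    proof (rule LIMSEQ_I)
      fix e :: real assume e: "0 < e"
      obtain \<delta> where \<delta>: "\<delta> > 0" "\<And>y. dist y x < \<delta> \<Longrightarrow> dist (u y) (u x) < e / 3"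
        using elim e unfolding continuous_at_eps_delta by (metis divide_pos_pos zero_less_numeral)
      have "eventually (\<lambda>n. d n < min \<delta> (e / 3)) sequentially"
        using dlim \<delta>(1) e by (intro order_tendstoD) auto
      then obtain n0 where n0: "\<And>n. n \<ge> n0 \<Longrightarrow> d n < min \<delta> (e / 3)"
        unfolding eventually_sequentially by blast
      have "norm (\<phi> n x - u x) < e" if n: "n \<ge> n0" for n
      proof -
        have "u x - 2 * e / 3 \<le> v n (x - z) \<and> v n (x - z) \<le> u x + 2 * e / 3" if "\<eta> n z \<noteq> 0" for z
        proof -
          have "dist (x - z) x < \<delta>" using \<eta>supp[OF that] n0[OF n] by (simp add: dist_norm)
          then have "\<bar>u (x - z) - u x\<bar> < e / 3" using \<delta>(2) by (simp add: dist_real_def)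
          moreover have "d n < e / 3" using n0[OF n] by simp
          ultimately show ?thesis using vu[where n=n and x="x - z"] by linarith
        qed
        then have "u x - 2 * e / 3 \<le> \<phi> n x" "\<phi> n x \<le> u x + 2 * e / 3"
          unfolding \<phi>_def by (auto intro!: bounds)
        then show ?thesis using e by (simp add: abs_less_iff)
      qed
      then show "\<exists>n0. \<forall>n\<ge>n0. norm (\<phi> n x - u x) < e" by blast
    qed
  qed
  have G: "(\<lambda>n. gag s (\<lambda>x. \<phi> n x - u x)) \<longlonglongrightarrow> 0"
    by (rule gag_strong_convergence[OF um _ lim gle fin(1)]) simp
  \<comment> \<open>A majorant for u and for all its mollifications. Averaging moves a point by at
    most 1, so for norm x \<ge> 2 the norm remains at least half of norm x and monotonicity applies;
    inside radius 2 the maximum u 0 is used.\<close>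
  define W where "W x = (if norm x < 2 then u 0 else 0) + u ((1 / 2) *\<^sub>R x)" for x
  have [measurable]: "W \<in> borel_measurable borel" unfolding W_def by measurable
  have Wfin: "Lpow ?r W < \<infinity>"
  proof -
    have 1: "Lpow ?r (\<lambda>x::real^'n. if norm x < 2 then u 0 else 0) < \<infinity>"
      by (rule Lpow_finite_bounded_support[where B="u 0" and R=2]) (use u0 r in auto)
    have 2: "Lpow ?r (\<lambda>x. u ((1 / 2) *\<^sub>R x)) < \<infinity>"
      using fin by (subst Lpow_dilate) (auto simp: ennreal_mult_less_top)
    have "Lpow ?r W \<le> ennreal (2 powr ?r) * (Lpow ?r (\<lambda>x::real^'n. if norm x < 2 then u 0 else 0)
        + Lpow ?r (\<lambda>x. u ((1 / 2) *\<^sub>R x)))"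
      unfolding W_def using r by (intro Lpow_add_le) auto
    also have "\<dots> < \<infinity>" using 1 2 by (simp add: ennreal_mult_less_top)
    finally show ?thesis .
  qed
  have \<phi>W: "\<bar>u x - \<phi> n x\<bar> \<le> W x" for n x
  proof -
    have "0 \<le> v n (x - z) \<and> v n (x - z) \<le> W x" if "\<eta> n z \<noteq> 0" for z
    proof -
      have z: "norm z \<le> 1" using \<eta>supp[OF that] d(2)[of n] by simp
      have "u (x - z) \<le> W x"
      proof (cases "norm x < 2")
        case True
        then show ?thesis using ule[of "x - z"] u0[of "(1 / 2) *\<^sub>R x"] by (simp add: W_def)
      next
        case False
        have "norm x - norm z \<le> norm (x - z)" by (rule norm_triangle_ineq2)
        then have "norm ((1 / 2) *\<^sub>R x) \<le> norm (x - z)" using z False by simp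
        then show ?thesis using rd False by (simp add: W_def radially_decreasing_def)
      qed
      then show ?thesis using vu(2)[of n "x - z"] by (auto simp: v_def)
    qed
    then have "0 \<le> \<phi> n x" "\<phi> n x \<le> W x" unfolding \<phi>_def by (auto intro!: bounds)
    moreover have "u x \<le> u ((1 / 2) *\<^sub>R x)" using rd by (simp add: radially_decreasing_def)
    then have "u x \<le> W x" using u0[of 0] by (simp add: W_def)
    ultimately show ?thesis using u0[of x] by linarith
  qed
  have L: "(\<lambda>n. Lpow ?r (\<lambda>x. u x - \<phi> n x)) \<longlonglongrightarrow> 0"
  proof -
    have "(\<lambda>n. \<integral>\<^sup>+x. ennreal (\<bar>u x - \<phi> n x\<bar> powr ?r) \<partial>lborel) \<longlonglongrightarrow> (\<integral>\<^sup>+x. 0 \<partial>(lborel :: (real^'n) measure))"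
    proof (rule nn_integral_dominated_convergence[where w="\<lambda>x. ennreal (\<bar>W x\<bar> powr ?r)"])
      show "AE x in lborel. ennreal (\<bar>u x - \<phi> n x\<bar> powr ?r) \<le> ennreal (\<bar>W x\<bar> powr ?r)" for n
        using r by (intro AE_I2 ennreal_leI powr_mono2) (auto intro: order_trans[OF \<phi>W])
      show "(\<integral>\<^sup>+x. ennreal (\<bar>W x\<bar> powr ?r) \<partial>lborel) < \<infinity>" using Wfin by (simp add: Lpow_def)
      show "AE x in lborel. (\<lambda>n. ennreal (\<bar>u x - \<phi> n x\<bar> powr ?r)) \<longlonglongrightarrow> 0"
        using lim
      proof eventually_elim
        case (elim x)
        have "(\<lambda>n. \<bar>u x - \<phi> n x\<bar> powr ?r) \<longlonglongrightarrow> \<bar>u x - u x\<bar> powr ?r"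
          using r by (intro tendsto_powr2 tendsto_intros elim) auto
        then show ?case using r by (auto intro!: tendsto_ennrealI[of _ 0, simplified])
      qed
    qed auto
    then show ?thesis by (simp add: Lpow_def)
  qed
  show ?thesis
    unfolding Hs_dot_iff[OF s]
    using fe \<phi>test G L gag_diff_commute[of s u] by auto
qed

section \<open>Hardy and Sobolev inequalities for radially decreasing functions\<close>

text \<open>For fixed x the inner integral of the energy is restricted to a ball of radius
  proportional to norm x on which norm y \<ge> 2 norm x. Monotonicity bounds the increment from
  below by u x - u (2 x), and kernel times volume is of order norm x^(-2s).\<close>

lemma radially_decreasing_dyadic_difference:
  fixes u :: "real^'n \<Rightarrow> real"
  assumes s: "0 < s" and rd: "radially_decreasing u"
  defines "K \<equiv> 4 powr - (real CARD('n) + 2 * s) * unit_ball_vol (real CARD('n)) * (1 / 2) ^ CARD('n)"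
  shows "ennreal K * (\<integral>\<^sup>+x. ennreal ((u x - u (2 *\<^sub>R x))\<^sup>2 * norm x powr - (2 * s)) \<partial>lborel) \<le> gag s u"
proof -
  let ?n = "real CARD('n)"
  note [measurable] = radially_decreasing_measurable[OF rd]
  have K: "K \<ge> 0" by (simp add: K_def)
  have "ennreal (K * ((u x - u (2 *\<^sub>R x))\<^sup>2 * norm x powr - (2 * s)))
      \<le> (\<integral>\<^sup>+y. ennreal ((u x - u y)\<^sup>2 / norm (x - y) powr (?n + 2 * s)) \<partial>lborel)" if x: "x \<noteq> 0" for x :: "real^'n"
  proof -
    \<comment> \<open>Centre 5/2 x and radius norm x / 2 give norm y \<ge> 2 norm x on the ball.
      Distances to x stay below 4 norm x, the origin of the 4 in K, and the factor (1/2)^N in K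
      comes from the radius.\<close>
    define B where "B = cball ((5 / 2) *\<^sub>R x) (norm x / 2)"
    have [measurable]: "B \<in> sets borel" by (simp add: B_def)
    have [measurable]: "(indicator B :: real^'n \<Rightarrow> ennreal) \<in> borel_measurable borel"
      by (rule borel_measurable_indicator) fact
    define L where "L = (u x - u (2 *\<^sub>R x))\<^sup>2 * (4 * norm x) powr - (?n + 2 * s)"
    have pt: "ennreal L * indicator B y \<le> ennreal ((u x - u y)\<^sup>2 / norm (x - y) powr (?n + 2 * s))" for y
    proof (cases "y \<in> B")
      case True
      then have d: "norm ((5 / 2) *\<^sub>R x - y) \<le> norm x / 2" by (simp add: B_def dist_norm)
      have "norm ((5 / 2) *\<^sub>R x) - norm ((5 / 2) *\<^sub>R x - y) \<le> norm y"
        using norm_triangle_ineq2[of "(5 / 2) *\<^sub>R x" "(5 / 2) *\<^sub>R x - y"] by simp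
      then have "norm (2 *\<^sub>R x) \<le> norm y" using d by simp
      then have u2: "u y \<le> u (2 *\<^sub>R x)" using rd by (simp add: radially_decreasing_def)
      have u1: "u (2 *\<^sub>R x) \<le> u x" using rd by (simp add: radially_decreasing_def)
      have "x - y = ((5 / 2) *\<^sub>R x - y) - (3 / 2) *\<^sub>R x"
        using scaleR_add_left[of 1 "3 / 2" x] by simp
      then have "norm (x - y) \<le> norm ((5 / 2) *\<^sub>R x - y) + norm ((3 / 2) *\<^sub>R x)"
        by (metis norm_triangle_ineq4)
      moreover have "norm ((3 / 2) *\<^sub>R x) = 3 / 2 * norm x" by simp
      ultimately have xy: "norm (x - y) \<le> 4 * norm x" using d norm_ge_zero[of x] by linarith
      have xy0: "norm (x - y) > 0" using \<open>norm (2 *\<^sub>R x) \<le> norm y\<close> x by auto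
      have "L \<le> (u x - u y)\<^sup>2 * norm (x - y) powr - (?n + 2 * s)"
        unfolding L_def using u1 u2 xy xy0 s
        by (intro mult_mono power_mono powr_mono2') auto
      also have "\<dots> = (u x - u y)\<^sup>2 / norm (x - y) powr (?n + 2 * s)"
        by (simp only: powr_minus divide_inverse)
      finally show ?thesis using True by (simp add: ennreal_leI)
    qed simp
    have L0: "L \<ge> 0" by (simp add: L_def)
    have "K * ((u x - u (2 *\<^sub>R x))\<^sup>2 * norm x powr - (2 * s)) = L * (unit_ball_vol ?n * (norm x / 2) ^ CARD('n))"
    proof -
      have "norm x powr - (2 * s) = norm x powr - (?n + 2 * s) * norm x ^ CARD('n)"
        using x by (simp add: powr_add[symmetric] powr_realpow[symmetric])
      then show ?thesis
        by (simp add: K_def L_def powr_mult power_divide)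
    qed
    then have "ennreal (K * ((u x - u (2 *\<^sub>R x))\<^sup>2 * norm x powr - (2 * s))) = ennreal L * emeasure lborel B"
      unfolding B_def using L0 by (simp add: emeasure_cball ennreal_mult)
    also have "\<dots> = (\<integral>\<^sup>+y. ennreal L * indicator B y \<partial>lborel)"
      by (subst nn_integral_cmult) simp_all
    also have "\<dots> \<le> (\<integral>\<^sup>+y. ennreal ((u x - u y)\<^sup>2 / norm (x - y) powr (?n + 2 * s)) \<partial>lborel)"
      by (intro nn_integral_mono pt)
    finally show ?thesis .
  qed
  then have "(\<integral>\<^sup>+x. ennreal (K * ((u x - u (2 *\<^sub>R x))\<^sup>2 * norm x powr - (2 * s))) \<partial>lborel) \<le> gag s u"
    unfolding gag_eq_iterated[OF radially_decreasing_measurable[OF rd]]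
    by (intro nn_integral_mono_AE) (use AE_lborel_singleton[of "0::real^'n"] in \<open>auto elim!: eventually_mono\<close>)
  then show ?thesis using K by (simp add: ennreal_mult' nn_integral_cmult)
qed

definition hardy_integral :: "real \<Rightarrow> (real^'n \<Rightarrow> real) \<Rightarrow> ennreal" where
  "hardy_integral s u = (\<integral>\<^sup>+x. ennreal ((u x)\<^sup>2 * norm x powr - (2 * s)) \<partial>lborel)"

text \<open>The weight is integrable near the origin because 2s < N.\<close>

lemma hardy_integral_finite:
  fixes u :: "real^'n \<Rightarrow> real"
  assumes s: "0 < s" "2 * s < real CARD('n)" and [measurable]: "u \<in> borel_measurable borel"
    and M: "\<And>x. \<bar>u x\<bar> \<le> M" and R: "\<And>x. R < norm x \<Longrightarrow> u x = 0"
  shows "hardy_integral s u < \<infinity>"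
proof -
  define b :: "real^'n \<Rightarrow> ennreal" where "b = indicator (cball 0 R)"
  have [measurable]: "b \<in> borel_measurable borel" unfolding b_def by (rule borel_measurable_indicator) simp
  have pt: "ennreal ((u x)\<^sup>2 * norm x powr - (2 * s))
      \<le> ennreal (M\<^sup>2) * (ennreal (norm x powr - (2 * s)) * indicator {x. norm x \<le> 1} x + b x)" for x
  proof (cases "u x = 0")
    case False
    then have "norm x \<le> R" using R[of x] by (meson not_le)
    then have b1: "b x = 1" by (simp add: b_def)
    have u2: "(u x)\<^sup>2 \<le> M\<^sup>2" using power_mono[OF M[of x], of 2] by simp
    have "ennreal ((u x)\<^sup>2 * norm x powr - (2 * s)) \<le> ennreal (M\<^sup>2 * norm x powr - (2 * s))"
      using u2 by (intro ennreal_leI mult_right_mono) auto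
    also have "\<dots> = ennreal (M\<^sup>2) * ennreal (norm x powr - (2 * s))" by (simp add: ennreal_mult')
    also have "\<dots> \<le> ennreal (M\<^sup>2) * (ennreal (norm x powr - (2 * s)) * indicator {x. norm x \<le> 1} x + b x)"
    proof (rule mult_left_mono)
      show "ennreal (norm x powr - (2 * s)) \<le> ennreal (norm x powr - (2 * s)) * indicator {x. norm x \<le> 1} x + b x"
      proof (cases "norm x \<le> 1")
        case False
        then have "norm x powr - (2 * s) \<le> 1 powr - (2 * s)" using s by (intro powr_mono2') auto
        then show ?thesis using b1 False by (simp add: ennreal_le_1)
      qed simp
    qed simp
    finally show ?thesis .
  qed simp
  have "hardy_integral s u \<le> ennreal (M\<^sup>2) *
      ((\<integral>\<^sup>+x. ennreal (norm x powr - (2 * s)) * indicator {x. norm x \<le> 1} (x::real^'n) \<partial>lborel) + (\<integral>\<^sup>+x. b x \<partial>lborel))"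
    unfolding hardy_integral_def
    by (subst nn_integral_add[symmetric], simp, simp, subst nn_integral_cmult[symmetric], simp)
       (intro nn_integral_mono pt)
  also have "(\<integral>\<^sup>+x. b x \<partial>lborel) < \<infinity>"
    unfolding b_def by (cases "R \<ge> 0") (auto simp: emeasure_cball)
  then have "ennreal (M\<^sup>2) *
      ((\<integral>\<^sup>+x. ennreal (norm x powr - (2 * s)) * indicator {x. norm x \<le> 1} (x::real^'n) \<partial>lborel) + (\<integral>\<^sup>+x. b x \<partial>lborel)) < \<infinity>"
    using nn_integral_norm_powr_inside[where 'a="real^'n" and \<alpha>="2 * s"] s
    by (auto simp: ennreal_mult_less_top)
  finally show ?thesis .
qed

text \<open>
  The dilation by 2 contracts the squared weighted norm by the factor \<open>2 powr (2 * s - N)\<close>, so the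
  norm of a function is controlled by that of its dyadic difference.
\<close>

lemma hardy_inequality_of_finite:
  fixes u :: "real^'n \<Rightarrow> real"
  assumes s: "0 < s" "2 * s < real CARD('n)"
  obtains C where "C > 0" "\<And>u :: real^'n \<Rightarrow> real. radially_decreasing u \<Longrightarrow> hardy_integral s u < \<infinity> \<Longrightarrow>
    hardy_integral s u \<le> ennreal C * gag s u"
proof -
  let ?n = "real CARD('n)"
  define K where "K = 4 powr - (?n + 2 * s) * unit_ball_vol ?n * (1 / 2) ^ CARD('n)"
  have K: "K > 0" by (simp add: K_def)
  define \<theta> where "\<theta> = 2 powr (2 * s - ?n)"
  have \<theta>: "\<theta> > 0" "\<theta> < 1" using s powr_less_mono[of "2 * s - ?n" 0 "2::real"] by (auto simp: \<theta>_def)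
  \<comment> \<open>Any positive \<eta> with (1 + \<eta>) \<theta> < 1 would do; this one makes
    \<rho> the midpoint (1 + \<theta>)/2.\<close>
  define \<eta> where "\<eta> = (1 - \<theta>) / (2 * \<theta>)"
  have \<eta>: "\<eta> > 0" using \<theta> by (simp add: \<eta>_def)
  define \<rho> where "\<rho> = (1 + \<eta>) * \<theta>"
  have \<rho>: "\<rho> < 1" "\<rho> \<ge> 0" using \<theta> by (auto simp: \<rho>_def \<eta>_def field_simps)
  define C where "C = (1 + 1 / \<eta>) / (1 - \<rho>) / K"
  have C: "C > 0" using \<eta> \<rho> K by (simp add: C_def add_pos_pos)
  show ?thesis
  proof (rule that[OF C])
    fix u :: "real^'n \<Rightarrow> real"
    assume rd: "radially_decreasing u" and fin: "hardy_integral s u < \<infinity>"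
    note [measurable] = radially_decreasing_measurable[OF rd]
    define D where "D = (\<integral>\<^sup>+x. ennreal ((u x - u (2 *\<^sub>R x))\<^sup>2 * norm x powr - (2 * s)) \<partial>lborel)"
    have KD: "ennreal K * D \<le> gag s u"
      unfolding K_def D_def by (rule radially_decreasing_dyadic_difference[OF s(1) rd])
    have dil: "(\<integral>\<^sup>+x. ennreal ((u (2 *\<^sub>R x))\<^sup>2 * norm x powr - (2 * s)) \<partial>lborel) = ennreal \<theta> * hardy_integral s u"
    proof -
      have "ennreal ((u (2 *\<^sub>R x))\<^sup>2 * norm x powr - (2 * s))
          = ennreal (2 powr (2 * s)) * ennreal ((u (2 *\<^sub>R x))\<^sup>2 * norm (2 *\<^sub>R x) powr - (2 * s))" for x
        by (simp add: ennreal_mult'[symmetric] powr_mult powr_minus field_simps)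
      then have "(\<integral>\<^sup>+x. ennreal ((u (2 *\<^sub>R x))\<^sup>2 * norm x powr - (2 * s)) \<partial>lborel)
          = ennreal (2 powr (2 * s)) * (\<integral>\<^sup>+x. ennreal ((u (2 *\<^sub>R x))\<^sup>2 * norm (2 *\<^sub>R x) powr - (2 * s)) \<partial>lborel)"
        by (simp add: nn_integral_cmult)
      also have "(\<integral>\<^sup>+x. ennreal ((u (2 *\<^sub>R x))\<^sup>2 * norm (2 *\<^sub>R x) powr - (2 * s)) \<partial>lborel)
          = ennreal (2 powr - ?n) * hardy_integral s u"
        using nn_integral_lborel_scale'[of "\<lambda>x. ennreal ((u x)\<^sup>2 * norm x powr - (2 * s))" 2]
        by (simp add: hardy_integral_def)
      finally show ?thesis
        by (simp add: \<theta>_def mult.assoc[symmetric] ennreal_mult'[symmetric] powr_add[symmetric])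
    qed
    have pt: "(u x)\<^sup>2 \<le> (1 + 1 / \<eta>) * (u x - u (2 *\<^sub>R x))\<^sup>2 + (1 + \<eta>) * (u (2 *\<^sub>R x))\<^sup>2" for x
    proof -
      let ?a = "u x - u (2 *\<^sub>R x)" and ?b = "u (2 *\<^sub>R x)"
      have "0 \<le> (?a - \<eta> * ?b)\<^sup>2 / \<eta>" using \<eta> by simp
      also have "\<dots> = ?a\<^sup>2 / \<eta> + \<eta> * ?b\<^sup>2 - 2 * ?a * ?b"
        using \<eta> by (simp add: power2_eq_square field_simps)
      finally have "2 * ?a * ?b \<le> ?a\<^sup>2 / \<eta> + \<eta> * ?b\<^sup>2" by simp
      moreover have "(u x)\<^sup>2 = ?a\<^sup>2 + ?b\<^sup>2 + 2 * ?a * ?b" by (simp add: power2_eq_square algebra_simps)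
      ultimately show ?thesis by (simp add: algebra_simps)
    qed
    have "hardy_integral s u \<le> (\<integral>\<^sup>+x. ennreal (1 + 1 / \<eta>) * ennreal ((u x - u (2 *\<^sub>R x))\<^sup>2 * norm x powr - (2 * s))
        + ennreal (1 + \<eta>) * ennreal ((u (2 *\<^sub>R x))\<^sup>2 * norm x powr - (2 * s)) \<partial>lborel)"
      unfolding hardy_integral_def
    proof (rule nn_integral_mono)
      fix x
      have "(u x)\<^sup>2 * norm x powr - (2 * s) \<le> ((1 + 1 / \<eta>) * (u x - u (2 *\<^sub>R x))\<^sup>2
          + (1 + \<eta>) * (u (2 *\<^sub>R x))\<^sup>2) * norm x powr - (2 * s)"
        by (intro mult_right_mono pt) simp
      then show "ennreal ((u x)\<^sup>2 * norm x powr - (2 * s))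
          \<le> ennreal (1 + 1 / \<eta>) * ennreal ((u x - u (2 *\<^sub>R x))\<^sup>2 * norm x powr - (2 * s))
          + ennreal (1 + \<eta>) * ennreal ((u (2 *\<^sub>R x))\<^sup>2 * norm x powr - (2 * s))"
        using \<eta> by (simp add: ennreal_mult'[symmetric] ennreal_plus[symmetric] ennreal_leI algebra_simps del: ennreal_plus)
    qed
    also have "\<dots> = ennreal (1 + 1 / \<eta>) * D + ennreal (1 + \<eta>) * (ennreal \<theta> * hardy_integral s u)"
      unfolding D_def dil[symmetric] by (subst nn_integral_add) (auto simp: nn_integral_cmult)
    finally have le: "hardy_integral s u \<le> ennreal (1 + 1 / \<eta>) * D + ennreal \<rho> * hardy_integral s u"
      using \<eta> \<theta> by (simp add: \<rho>_def ennreal_mult' mult.assoc)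
    show "hardy_integral s u \<le> ennreal C * gag s u"
    proof (cases "D = \<infinity>")
      case True
      then have "gag s u = \<infinity>" using KD K by (simp add: ennreal_mult_top top_unique)
      then show ?thesis using C by (simp add: ennreal_mult_top)
    next
      case False
      then obtain d where d: "D = ennreal d" "d \<ge> 0" by (cases D) auto
      obtain h where h: "hardy_integral s u = ennreal h" "h \<ge> 0" using fin by (cases "hardy_integral s u") auto
      have "h \<le> (1 + 1 / \<eta>) * d + \<rho> * h"
        using le d h \<eta> \<rho> by (simp add: ennreal_mult'[symmetric] ennreal_plus[symmetric] del: ennreal_plus)
      \<comment> \<open>Absorbing the dilated term into the left side is a subtraction, legitimate
        because the Hardy integral is assumed finite.\<close>
      then have "(1 - \<rho>) * h \<le> (1 + 1 / \<eta>) * d" by (simp add: algebra_simps)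
      then have "h \<le> (1 + 1 / \<eta>) * d / (1 - \<rho>)" using \<rho> by (simp add: pos_le_divide_eq mult.commute)
      also have "\<dots> = C * (K * d)" using K by (simp add: C_def)
      finally have "ennreal h \<le> ennreal C * (ennreal K * ennreal d)"
        using C K d by (simp add: ennreal_mult'[symmetric] ennreal_leI)
      also have "\<dots> \<le> ennreal C * gag s u" using KD d by (intro mult_left_mono) auto
      finally show ?thesis by (simp add: h)
    qed
  qed
qed

text \<open>The finiteness assumption is removed by lowering u by d n and cutting at 0: the result
  has bounded support, hence a finite Hardy integral, and no larger energy. The constant is
  independent of n, so Fatou passes to the limit.\<close>

lemma hardy_inequality:
  assumes s: "0 < s" "2 * s < real CARD('n::finite)"
  obtains C where "C > 0" "\<And>u :: real^'n \<Rightarrow> real. radially_decreasing u \<Longrightarrow> (\<And>x. 0 \<le> u x) \<Longrightarrow>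
    Lpow (crit_exp (real CARD('n)) s) u < \<infinity> \<Longrightarrow> hardy_integral s u \<le> ennreal C * gag s u"
proof -
  let ?r = "crit_exp (real CARD('n)) s"
  obtain C where C: "C > 0" "\<And>u :: real^'n \<Rightarrow> real. radially_decreasing u \<Longrightarrow> hardy_integral s u < \<infinity> \<Longrightarrow>
    hardy_integral s u \<le> ennreal C * gag s u" using hardy_inequality_of_finite[OF s] by metis
  show ?thesis
  proof (rule that[OF C(1)])
    fix u :: "real^'n \<Rightarrow> real"
    assume rd: "radially_decreasing u" and u0: "\<And>x. 0 \<le> u x" and fin: "Lpow ?r u < \<infinity>"
    note [measurable] = radially_decreasing_measurable[OF rd]
    have ule: "u x \<le> u 0" for x using rd by (auto simp: radially_decreasing_def)
    define d where "d n = 1 / real (Suc n)" for n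
    have d: "d n > 0" for n by (auto simp: d_def)
    have dlim: "d \<longlonglongrightarrow> 0" unfolding d_def by (rule LIMSEQ_Suc, rule lim_1_over_n)
    define v where "v n x = max (u x - d n) 0" for n x
    have [measurable]: "v n \<in> borel_measurable borel" for n unfolding v_def by measurable
    have vle: "hardy_integral s (v n) \<le> ennreal C * gag s u" for n
    proof -
      obtain R where R: "\<And>x. R < norm x \<Longrightarrow> u x \<le> d n"
        using radially_decreasing_vanishes[OF rd fin _ d[of n]] crit_exp_gt_2[OF s] by (metis less_trans zero_less_numeral)
      have vR: "R < norm x \<Longrightarrow> v n x = 0" for x using R[of x] by (simp add: v_def)
      have vM: "\<bar>v n x\<bar> \<le> u 0" for x using ule[of x] u0[of x] u0[of 0] d[of n] by (auto simp: v_def)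
      have "radially_decreasing (v n)"
        unfolding radially_decreasing_def v_def
      proof (intro allI impI)
        fix x y :: "real^'n" assume "norm x \<le> norm y"
        then have "u y \<le> u x" using rd by (simp add: radially_decreasing_def)
        then show "max (u y - d n) 0 \<le> max (u x - d n) 0" by (intro max.mono) auto
      qed
      then have "hardy_integral s (v n) \<le> ennreal C * gag s (v n)"
        by (intro C(2) hardy_integral_finite[OF s _ vM vR]) auto
      also have "\<dots> \<le> ennreal C * gag s u"
        by (intro mult_left_mono gag_mono) (auto simp: v_def max_def)
      finally show ?thesis .
    qed
    have "hardy_integral s u \<le> (\<integral>\<^sup>+x. liminf (\<lambda>n. ennreal ((v n x)\<^sup>2 * norm x powr - (2 * s))) \<partial>lborel)"
      unfolding hardy_integral_def
    proof (rule nn_integral_mono)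
      fix x
      have "(\<lambda>n. (max (u x - d n) 0)\<^sup>2 * norm x powr - (2 * s)) \<longlonglongrightarrow> (max (u x - 0) 0)\<^sup>2 * norm x powr - (2 * s)"
        by (intro tendsto_intros dlim)
      then have "(\<lambda>n. ennreal ((v n x)\<^sup>2 * norm x powr - (2 * s))) \<longlonglongrightarrow> ennreal ((u x)\<^sup>2 * norm x powr - (2 * s))"
        unfolding v_def using u0[of x] by (intro tendsto_ennrealI) simp
      then have "liminf (\<lambda>n. ennreal ((v n x)\<^sup>2 * norm x powr - (2 * s))) = ennreal ((u x)\<^sup>2 * norm x powr - (2 * s))"
        by (intro lim_imp_Liminf) auto
      then show "ennreal ((u x)\<^sup>2 * norm x powr - (2 * s)) \<le> liminf (\<lambda>n. ennreal ((v n x)\<^sup>2 * norm x powr - (2 * s)))"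
        by simp
    qed
    also have "\<dots> \<le> liminf (\<lambda>n. hardy_integral s (v n))"
      unfolding hardy_integral_def by (rule nn_integral_liminf) measurable
    also have "\<dots> \<le> ennreal C * gag s u"
      using vle by (intro Liminf_le) (auto intro!: always_eventually)
    finally show "hardy_integral s u \<le> ennreal C * gag s u" .
  qed
qed

text \<open>Both u and the weight decrease in the norm, so over the ball of radius norm x the Hardy
  integral is at least the integrand at x times the volume of that ball.\<close>

lemma radially_decreasing_decay:
  fixes u :: "real^'n \<Rightarrow> real"
  assumes s: "0 < s" "2 * s < real CARD('n)"
    and rd: "radially_decreasing u" and u0: "\<And>x. 0 \<le> u x" and H: "hardy_integral s u \<le> ennreal H" "0 \<le> H" and x: "x \<noteq> 0"
  shows "u x \<le> sqrt (H / unit_ball_vol (real CARD('n))) * norm x powr - ((real CARD('n) - 2 * s) / 2)"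
proof -
  let ?n = "real CARD('n)" and ?V = "unit_ball_vol (real CARD('n))"
  have V: "?V > 0" by simp
  have [measurable]: "(indicator (cball 0 (norm x)) :: real^'n \<Rightarrow> ennreal) \<in> borel_measurable borel"
    by (rule borel_measurable_indicator) simp
  have "ennreal ((u x)\<^sup>2 * norm x powr - (2 * s) * (?V * norm x ^ CARD('n)))
      = (\<integral>\<^sup>+y. ennreal ((u x)\<^sup>2 * norm x powr - (2 * s)) * indicator (cball 0 (norm x)) (y::real^'n) \<partial>lborel)"
    by (subst nn_integral_cmult) (auto simp: emeasure_cball ennreal_mult'[symmetric])
  also have "\<dots> \<le> hardy_integral s u"
    unfolding hardy_integral_def
  proof (rule nn_integral_mono_AE, use AE_lborel_singleton[of "0::real^'n"] in eventually_elim)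
    case (elim y)
    show ?case
    proof (cases "norm y \<le> norm x")
      case True
      then have "u x \<le> u y" using rd by (simp add: radially_decreasing_def)
      then have "(u x)\<^sup>2 * norm x powr - (2 * s) \<le> (u y)\<^sup>2 * norm y powr - (2 * s)"
        using True elim u0 s by (intro mult_mono power_mono powr_mono2') auto
      then show ?thesis using True by (simp add: ennreal_leI)
    qed simp
  qed
  also have "\<dots> \<le> ennreal H" by (rule H)
  finally have "(u x)\<^sup>2 * norm x powr - (2 * s) * (?V * norm x ^ CARD('n)) \<le> H"
    using H by simp
  moreover have "norm x powr - (2 * s) * norm x ^ CARD('n) = norm x powr (?n - 2 * s)"
    using x by (simp add: powr_add[symmetric] powr_realpow[symmetric])
  moreover have "(u x)\<^sup>2 * norm x powr - (2 * s) * (?V * norm x ^ CARD('n))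
      = (u x)\<^sup>2 * (?V * (norm x powr - (2 * s) * norm x ^ CARD('n)))" by (simp only: mult_ac)
  ultimately have "(u x)\<^sup>2 * (?V * norm x powr (?n - 2 * s)) \<le> H" by (simp only:)
  then have "(u x)\<^sup>2 \<le> H / (?V * norm x powr (?n - 2 * s))"
    using x V by (subst pos_le_divide_eq) auto
  also have "\<dots> = H / ?V * norm x powr - (?n - 2 * s)"
    by (simp only: powr_minus divide_inverse inverse_mult_distrib mult.assoc)
  finally have "(u x)\<^sup>2 \<le> H / ?V * norm x powr - (?n - 2 * s)" .
  then have "sqrt ((u x)\<^sup>2) \<le> sqrt (H / ?V * norm x powr - (?n - 2 * s))" by (rule real_sqrt_le_mono)
  also have "\<dots> = sqrt (H / ?V) * norm x powr - ((?n - 2 * s) / 2)"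
  proof -
    have "sqrt (norm x powr - (?n - 2 * s)) = norm x powr - ((?n - 2 * s) / 2)"
      by (simp add: powr_half_sqrt[symmetric] powr_powr diff_divide_distrib)
    then show ?thesis by (simp only: real_sqrt_mult)
  qed
  finally show ?thesis using u0[of x] by simp
qed

text \<open>Split the power r as (r - 2) + 2 and insert the decay bound into the first factor: (N -
  2s)/2 times r - 2 is exactly 2s, which reproduces the Hardy weight.\<close>

lemma radially_decreasing_Sobolev:
  fixes u :: "real^'n \<Rightarrow> real"
  assumes s: "0 < s" "2 * s < real CARD('n)"
    and rd: "radially_decreasing u" and u0: "\<And>x. 0 \<le> u x" and H: "hardy_integral s u \<le> ennreal H" "0 \<le> H"
  shows "Lpow (crit_exp (real CARD('n)) s) u
    \<le> ennreal (sqrt (H / unit_ball_vol (real CARD('n))) powr (crit_exp (real CARD('n)) s - 2) * H)"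
proof -
  let ?n = "real CARD('n)" and ?r = "crit_exp (real CARD('n)) s"
  define K where "K = sqrt (H / unit_ball_vol ?n)"
  have r: "?r > 2" by (rule crit_exp_gt_2[OF s])
  have ex: "(?n - 2 * s) / 2 * (?r - 2) = 2 * s" using s by (simp add: crit_exp_def field_simps)
  note [measurable] = radially_decreasing_measurable[OF rd]
  have "Lpow ?r u \<le> (\<integral>\<^sup>+x. ennreal (K powr (?r - 2)) * ennreal ((u x)\<^sup>2 * norm x powr - (2 * s)) \<partial>lborel)"
    unfolding Lpow_def
  proof (rule nn_integral_mono_AE, use AE_lborel_singleton[of "0::real^'n"] in eventually_elim)
    case (elim x)
    have "u x powr (?r - 2) \<le> (K * norm x powr - ((?n - 2 * s) / 2)) powr (?r - 2)"
      unfolding K_def using r u0 radially_decreasing_decay[OF s rd u0 H elim] by (intro powr_mono2) auto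
    also have "\<dots> = K powr (?r - 2) * norm x powr - ((?n - 2 * s) / 2 * (?r - 2))"
      by (simp add: powr_mult powr_powr)
    finally have "u x powr (?r - 2) * (u x)\<^sup>2 \<le> K powr (?r - 2) * norm x powr - (2 * s) * (u x)\<^sup>2"
      unfolding ex by (rule mult_right_mono) simp
    moreover have "u x powr (?r - 2) * (u x)\<^sup>2 = u x powr ?r"
    proof (cases "u x = 0")
      case False
      then have "u x > 0" using u0[of x] by simp
      then have "(u x)\<^sup>2 = u x powr 2" by simp
      then show ?thesis by (simp only: powr_add[symmetric]) simp
    qed simp
    ultimately show ?case
      using u0[of x] by (simp add: ennreal_mult'[symmetric] ennreal_leI mult_ac)
  qed
  also have "\<dots> = ennreal (K powr (?r - 2)) * hardy_integral s u"
    unfolding hardy_integral_def by (simp add: nn_integral_cmult)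
  also have "\<dots> \<le> ennreal (K powr (?r - 2)) * ennreal H" by (intro mult_left_mono H) simp
  finally show ?thesis by (simp add: K_def ennreal_mult'[symmetric])
qed

section \<open>Compactness of radially decreasing functions\<close>

text \<open>Helly selection takes bounded, increasing, right continuous functions and returns one of
  the same kind. The range from - M to 0 encodes 0 \<le> u \<le> M after negation.\<close>

definition rd_profile :: "real \<Rightarrow> ('a::real_normed_vector \<Rightarrow> real) \<Rightarrow> bool" where
  "rd_profile M u \<longleftrightarrow> (\<exists>g. mono g \<and> (\<forall>t. continuous (at_right t) g) \<and> (\<forall>t. - M \<le> g t \<and> g t \<le> 0) \<and>
     u = (\<lambda>x. - g (norm x)))"

lemma rd_profileD:
  assumes "rd_profile M u"
  shows "radially_decreasing u" "0 \<le> u x" "u x \<le> M"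
proof -
  obtain g where g: "mono g" "\<And>t. - M \<le> g t \<and> g t \<le> 0" "u = (\<lambda>x. - g (norm x))"
    using assms unfolding rd_profile_def by blast
  show "radially_decreasing u" using g(1) unfolding g(3) radially_decreasing_def by (auto dest: monoD)
  show "0 \<le> u x" "u x \<le> M" using g(2)[of "norm x"] unfolding g(3) by auto
qed

lemma rd_profile_continuous:
  fixes u :: "'a::euclidean_space \<Rightarrow> real"
  assumes rd: "radially_decreasing u" and c: "continuous_on UNIV u" and b: "\<And>x. 0 \<le> u x \<and> u x \<le> M"
  shows "rd_profile M u"
proof -
  obtain e :: 'a where e: "norm e = 1" using vector_choose_size[of 1] by auto
  define g where "g t = - u (max t 0 *\<^sub>R e)" for t
  have "mono g" by (intro monoI) (use rd e in \<open>auto simp: g_def radially_decreasing_def\<close>)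
  moreover have "u = (\<lambda>x. - g (norm x))"
  proof
    fix x show "u x = - g (norm x)"
      using rd e by (auto simp: g_def radially_decreasing_def intro!: antisym)
  qed
  moreover have "continuous_on UNIV g"
    unfolding g_def by (intro continuous_intros continuous_on_compose2[OF c]) auto
  then have "continuous (at_right t) g" for t
    by (metis UNIV_I continuous_at_imp_continuous_within continuous_on_eq_continuous_at open_UNIV)
  moreover have "- M \<le> g t \<and> g t \<le> 0" for t using b by (auto simp: g_def)
  ultimately show ?thesis unfolding rd_profile_def by blast
qed

lemma rd_profile_dilate:
  assumes "rd_profile M u" and c: "c > 0"
  shows "rd_profile M (\<lambda>x. u (c *\<^sub>R x))"
proof -
  obtain g where g: "mono g" "\<And>t. continuous (at_right t) g" "\<And>t. - M \<le> g t \<and> g t \<le> 0" "u = (\<lambda>x. - g (norm x))"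
    using assms unfolding rd_profile_def by blast
  have "mono (\<lambda>t. g (c * t))" using g(1) c by (auto simp: mono_def)
  moreover have "continuous (at_right t) (\<lambda>t. g (c * t))" for t
  proof -
    have "filterlim (\<lambda>t. c * t) (at_right (c * t)) (at_right t)"
      unfolding filterlim_at
    proof
      show "\<forall>\<^sub>F x in at_right t. c * x \<in> {c * t<..} \<and> c * x \<noteq> c * t"
        using c by (auto simp: eventually_at_right_field intro!: exI[of _ "t + 1"])
      show "((*) c \<longlongrightarrow> c * t) (at_right t)" by (intro tendsto_intros)
    qed
    then show ?thesis
      using g(2)[of "c * t"] unfolding continuous_within by (rule filterlim_compose[rotated])
  qed
  moreover have "(\<lambda>x. u (c *\<^sub>R x)) = (\<lambda>x. - g (c * norm x))" using c by (simp add: g(4))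
  ultimately show ?thesis using g(3) unfolding rd_profile_def
    by (intro exI[of _ "\<lambda>t. g (c * t)"]) auto
qed

text \<open>Compactness lives in the strict inequality for r: the decay bound raised to the critical
  power is of order norm x^(-N), just not integrable at infinity. At the critical power itself only
  Fatou and the uniform Sobolev bound are available, enough for finite energy of the limit.\<close>

lemma rd_profile_compactness:
  fixes w :: "nat \<Rightarrow> real^'n \<Rightarrow> real"
  assumes s: "0 < s" "s < 1" "2 * s < real CARD('n)"
    and w: "\<And>j. rd_profile M (w j)" and fe: "\<And>j. w j \<in> finite_energy s"
    and G: "\<And>j. gag s (w j) \<le> ennreal G"
  obtains k and u :: "real^'n \<Rightarrow> real" where "strict_mono (k :: nat \<Rightarrow> nat)" "rd_profile M u" "u \<in> finite_energy s"
    "gag s u \<le> liminf (\<lambda>j. gag s (w (k j)))"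
    "\<And>r. crit_exp (real CARD('n)) s < r \<Longrightarrow> (\<lambda>j. Lpow r (w (k j))) \<longlonglongrightarrow> Lpow r u"
proof -
  let ?n = "real CARD('n)" and ?c = "crit_exp (real CARD('n)) s"
  have c2: "?c > 2" by (rule crit_exp_gt_2[OF s(1,3)])
  have "\<exists>g. mono g \<and> (\<forall>t. continuous (at_right t) g) \<and> (\<forall>t. - M \<le> g t \<and> g t \<le> 0) \<and>
     w j = (\<lambda>x. - g (norm x))" for j using w[of j] unfolding rd_profile_def .
  then obtain g where g: "\<And>j. mono (g j)" "\<And>j t. continuous (at_right t) (g j)"
    "\<And>j t. - M \<le> g j t \<and> g j t \<le> 0" "\<And>j. w j = (\<lambda>x. - g j (norm x))" by metis
  have "\<bar>g j t\<bar> \<le> M" for j t using g(3)[of j t] by auto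
  from Helly_selection[of g M, OF g(2,1) this] obtain k F where k: "strict_mono (k :: nat \<Rightarrow> nat)"
    and F: "\<And>t. continuous (at_right t) F" "mono F" "\<And>t. \<bar>F t\<bar> \<le> M"
      "\<And>t. isCont F t \<Longrightarrow> (\<lambda>j. g (k j) t) \<longlonglongrightarrow> F t" by auto
  define u where "u x = - F (norm x)" for x :: "real^'n"
  have F0: "F t \<le> 0" for t
  proof -
    \<comment> \<open>Convergence is known only at continuity points of F, so the sign is taken at
      such a point to the right of t and carried back by monotonicity.\<close>
    obtain y where "t < y" "isCont F y"
      using open_minus_countable[OF mono_ctble_discont[OF F(2)], of "{t<..}"] by auto
    then have "F y \<le> 0"
      by (intro LIMSEQ_le_const2[OF F(4)]) (use g(3) in auto)
    then show ?thesis using monoD[OF F(2), of t y] \<open>t < y\<close> by simp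
  qed
  have ru: "rd_profile M u"
  proof -
    have "- M \<le> F t \<and> F t \<le> 0" for t using F(3)[of t] F0[of t] by auto
    moreover have "u = (\<lambda>x. - F (norm x))" by (auto simp: u_def)
    ultimately show ?thesis using F(1,2) unfolding rd_profile_def by blast
  qed
  note um[measurable] = radially_decreasing_measurable[OF rd_profileD(1)[OF ru]]
  note wm[measurable] = radially_decreasing_measurable[OF rd_profileD(1)[OF w]]
  have lim: "AE x in lborel. (\<lambda>j. w (k j) x) \<longlonglongrightarrow> u x"
    using AE_norm_not_in_countable[OF mono_ctble_discont[OF F(2)]]
  proof eventually_elim
    case (elim x)
    then show ?case unfolding g(4) u_def by (intro tendsto_minus F(4)) auto
  qed
  have gu: "gag s u \<le> liminf (\<lambda>j. gag s (w (k j)))" by (rule gag_fatou[OF um _ lim]) simp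
  also have "\<dots> \<le> ennreal G" using G by (intro Liminf_le) (auto intro!: always_eventually)
  finally have gfin: "gag s u < \<infinity>" by (simp add: le_less_trans)
  obtain C where C: "C > 0" "\<And>u :: real^'n \<Rightarrow> real. radially_decreasing u \<Longrightarrow> (\<And>x. 0 \<le> u x) \<Longrightarrow>
    Lpow ?c u < \<infinity> \<Longrightarrow> hardy_integral s u \<le> ennreal C * gag s u" using hardy_inequality[OF s(1,3)] by metis
  define H where "H = C * max G 0"
  have H0: "H \<ge> 0" using C by (simp add: H_def)
  have hw: "hardy_integral s (w j) \<le> ennreal H" for j
  proof -
    have "hardy_integral s (w j) \<le> ennreal C * gag s (w j)"
      using rd_profileD[OF w] fe[of j] by (intro C(2)) (auto simp: finite_energy_iff)
    also have "\<dots> \<le> ennreal C * ennreal (max G 0)"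
      using G[of j] by (intro mult_left_mono) (auto intro: order_trans ennreal_leI)
    finally show ?thesis using C by (simp add: H_def ennreal_mult'[symmetric])
  qed
  define K where "K = sqrt (H / unit_ball_vol ?n)"
  have K0: "K \<ge> 0" using H0 by (simp add: K_def)
  have "Lpow ?c u \<le> liminf (\<lambda>j. Lpow ?c (w (k j)))" using c2 by (intro Lpow_fatou[OF um _ lim]) auto
  also have "\<dots> \<le> ennreal (K powr (?c - 2) * H)"
    unfolding K_def using radially_decreasing_Sobolev[OF s(1,3) rd_profileD(1,2)[OF w] hw H0]
    by (intro Liminf_le) (auto intro!: always_eventually)
  finally have "Lpow ?c u < \<infinity>" by (simp add: le_less_trans)
  then have ue: "u \<in> finite_energy s" using gfin by (simp add: finite_energy_iff)
  have "(\<lambda>j. Lpow r (w (k j))) \<longlonglongrightarrow> Lpow r u" if r: "?c < r" for r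
    unfolding Lpow_def
  proof (rule nn_integral_dominated_convergence)
    let ?W = "\<lambda>x::real^'n. ennreal (M powr r) * indicator (cball 0 1) x
      + ennreal (K powr r) * (ennreal (norm x powr - ((?n - 2 * s) / 2 * r)) * indicator {x. 1 \<le> norm x} x)"
    have [measurable]: "(indicator (cball 0 1) :: real^'n \<Rightarrow> ennreal) \<in> borel_measurable borel"
      by (rule borel_measurable_indicator) simp
    show "?W \<in> borel_measurable lborel" by measurable
    show "AE x in lborel. ennreal (\<bar>w (k j) x\<bar> powr r) \<le> ?W x" for j
    proof (rule AE_I2)
      fix x :: "real^'n"
      have w0: "0 \<le> w (k j) x" "w (k j) x \<le> M" by (rule rd_profileD[OF w])+
      show "ennreal (\<bar>w (k j) x\<bar> powr r) \<le> ?W x"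
      proof (cases "norm x \<le> 1")
        case True
        have "\<bar>w (k j) x\<bar> powr r \<le> M powr r" using w0 r c2 by (intro powr_mono2) auto
        then show ?thesis using True by (intro add_increasing2) (auto intro: ennreal_leI)
      next
        case False
        then have x: "x \<noteq> 0" by auto
        have "\<bar>w (k j) x\<bar> powr r \<le> (K * norm x powr - ((?n - 2 * s) / 2)) powr r"
          unfolding K_def using w0 r c2 radially_decreasing_decay[OF s(1,3) rd_profileD(1,2)[OF w] hw H0 x]
          by (intro powr_mono2) auto
        also have "\<dots> = K powr r * norm x powr - ((?n - 2 * s) / 2 * r)"
          by (simp add: powr_mult powr_powr)
        finally show ?thesis using False
          by (intro add_increasing) (auto simp: ennreal_mult'[symmetric] intro: ennreal_leI)
      qed
    qed
    have "(?n - 2 * s) / 2 * r > ?n" using r s by (simp add: crit_exp_def field_simps)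
    then show "(\<integral>\<^sup>+x. ?W x \<partial>lborel) < \<infinity>"
      using nn_integral_norm_powr_outside[where 'a="real^'n" and \<alpha>="(?n - 2 * s) / 2 * r"]
      by (subst nn_integral_add)
         (auto simp: nn_integral_cmult emeasure_cball ennreal_mult_less_top)
    show "AE x in lborel. (\<lambda>j. ennreal (\<bar>w (k j) x\<bar> powr r)) \<longlonglongrightarrow> ennreal (\<bar>u x\<bar> powr r)"
      using lim
    proof eventually_elim
      case (elim x)
      then show ?case using r c2 by (intro tendsto_ennrealI tendsto_powr2 tendsto_intros) auto
    qed
  qed auto
  then show ?thesis by (intro that[of k u] k ru ue gu)
qed

section \<open>Polarization\<close>

text \<open>Each mirror pair receives its larger value on the side a . x \<le> b, which contains the
  origin when b \<ge> 0.\<close>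

definition polarize :: "'a::euclidean_space \<Rightarrow> real \<Rightarrow> ('a \<Rightarrow> real) \<Rightarrow> 'a \<Rightarrow> real" where
  "polarize a b w x = (if a \<bullet> x \<le> b then max (w x) (w (hreflect a b x)) else min (w x) (w (hreflect a b x)))"

lemma lborel_distr_hreflect:
  assumes "norm a = 1"
  shows "distr lborel borel (hreflect a b) = (lborel :: 'a::euclidean_space measure)"
proof (rule measure_eqI)
  fix A assume "A \<in> sets (distr lborel borel (hreflect a b))"
  then have [measurable]: "A \<in> sets borel" by simp
  have [measurable]: "(indicator A :: 'a \<Rightarrow> ennreal) \<in> borel_measurable borel"
    by (rule borel_measurable_indicator) fact
  have "emeasure (distr lborel borel (hreflect a b)) A = (\<integral>\<^sup>+z. indicator A z \<partial>distr lborel borel (hreflect a b))"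
    by simp
  also have "\<dots> = (\<integral>\<^sup>+z. indicator A (hreflect a b z) \<partial>lborel)"
    by (rule nn_integral_distr) auto
  also have "\<dots> = (\<integral>\<^sup>+z. indicator A z \<partial>lborel)"
    by (rule nn_integral_lborel_hreflect[OF assms]) measurable
  finally show "emeasure (distr lborel borel (hreflect a b)) A = emeasure lborel A" by simp
qed simp

context
  fixes a :: "'a::euclidean_space" and b :: real
  assumes a: "norm a = 1"
begin

lemma hreflect_fixed: "a \<bullet> x = b \<Longrightarrow> hreflect a b x = x"
  by (simp add: hreflect_def)

lemma polarize_cases:
  "polarize a b w x = w x \<and> polarize a b w (hreflect a b x) = w (hreflect a b x) \<or>
   polarize a b w x = w (hreflect a b x) \<and> polarize a b w (hreflect a b x) = w x"
proof -
  have side: "a \<bullet> hreflect a b x = 2 * b - a \<bullet> x" using hreflect_side[OF a, of b x] by simp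
  consider "a \<bullet> x < b" | "a \<bullet> x > b" | "a \<bullet> x = b" by linarith
  then show ?thesis
  proof cases
    case 3
    then show ?thesis by (simp add: polarize_def hreflect_fixed)
  qed (auto simp: polarize_def side hreflect_involution[OF a] max_def min_def)
qed

lemma polarize_lower:
  "a \<bullet> x \<le> b \<Longrightarrow> polarize a b w x = max (w x) (w (hreflect a b x)) \<and>
    polarize a b w (hreflect a b x) = min (w x) (w (hreflect a b x))"
  and polarize_upper:
  "b \<le> a \<bullet> x \<Longrightarrow> polarize a b w x = min (w x) (w (hreflect a b x)) \<and>
    polarize a b w (hreflect a b x) = max (w x) (w (hreflect a b x))"
  using hreflect_side[OF a, of b x]
  by (cases "a \<bullet> x = b"; simp add: polarize_def hreflect_involution[OF a] hreflect_fixed min.commute max.commute)+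

lemma measurable_polarize [measurable]:
  assumes [measurable]: "w \<in> borel_measurable borel"
  shows "polarize a b w \<in> borel_measurable borel"
  unfolding polarize_def by measurable

text \<open>Polarization permutes the two values on each mirror pair, so the sum of F over a pair is
  unchanged, and integrating pair sums counts each integral twice.\<close>

lemma nn_integral_polarize:
  fixes F :: "real \<Rightarrow> ennreal"
  assumes [measurable]: "w \<in> borel_measurable borel" "F \<in> borel_measurable borel"
  shows "(\<integral>\<^sup>+x. F (polarize a b w x) \<partial>lborel) = (\<integral>\<^sup>+x. F (w x) \<partial>lborel)"
proof -
  have refl: "(\<integral>\<^sup>+x. F (v (hreflect a b x)) \<partial>lborel) = (\<integral>\<^sup>+x. F (v x) \<partial>lborel)"
    if [measurable]: "v \<in> borel_measurable borel" for v
    by (rule nn_integral_lborel_hreflect[OF a, of "\<lambda>x. F (v x)"]) measurable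
  have two: "(\<integral>\<^sup>+x. F (v x) + F (v (hreflect a b x)) \<partial>lborel) = 2 * (\<integral>\<^sup>+x. F (v x) \<partial>lborel)"
    if [measurable]: "v \<in> borel_measurable borel" for v
    by (subst nn_integral_add) (auto simp: refl mult_2)
  have "F (polarize a b w x) + F (polarize a b w (hreflect a b x)) = F (w x) + F (w (hreflect a b x))" for x
    using polarize_cases[of w x] by (auto simp: add.commute)
  then have "2 * (\<integral>\<^sup>+x. F (polarize a b w x) \<partial>lborel) = 2 * (\<integral>\<^sup>+x. F (w x) \<partial>lborel)"
    by (subst (1 2) two[symmetric]) auto
  then show ?thesis by (simp add: ennreal_mult_cancel_left)
qed

text \<open>On one side of the hyperplane, maximum and minimum are nonexpansive. For points on
  opposite sides crossed increments occur, but then the mirror image of y is no farther from x than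
  y is.\<close>

lemma polarize_Lipschitz:
  assumes L: "\<And>x y. \<bar>w x - w y\<bar> \<le> L * norm (x - y)" and L0: "0 \<le> L"
  shows "\<bar>polarize a b w x - polarize a b w y\<bar> \<le> L * norm (x - y)"
proof -
  let ?r = "hreflect a b"
  have 1: "\<bar>w x - w y\<bar> \<le> L * norm (x - y)" by (rule L)
  have 2: "\<bar>w (?r x) - w (?r y)\<bar> \<le> L * norm (x - y)"
    using L[of "?r x" "?r y"] by (simp add: hreflect_dist[OF a])
  have cross: "\<bar>w x - w (?r y)\<bar> \<le> L * norm (x - y) \<and> \<bar>w (?r x) - w y\<bar> \<le> L * norm (x - y)"
    if "(a \<bullet> x - b) * (a \<bullet> y - b) \<le> 0"
  proof -
    have "(norm (x - ?r y))\<^sup>2 \<le> (norm (x - y))\<^sup>2" using hreflect_cross[OF a, of x b y] that by linarith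
    then have le: "norm (x - ?r y) \<le> norm (x - y)" by (rule power2_le_imp_le) simp
    moreover have "norm (?r x - y) = norm (x - ?r y)"
      using hreflect_dist[OF a, of b x "?r y"] by (simp add: hreflect_involution[OF a])
    ultimately show ?thesis
      using L[of x "?r y"] L[of "?r x" y] mult_left_mono[OF le L0] by auto
  qed
  consider "a \<bullet> x \<le> b" "a \<bullet> y \<le> b" | "a \<bullet> x > b" "a \<bullet> y > b"
    | "a \<bullet> x \<le> b" "a \<bullet> y > b" | "a \<bullet> x > b" "a \<bullet> y \<le> b" by linarith
  then show ?thesis
  proof cases
    case 3
    then have "(a \<bullet> x - b) * (a \<bullet> y - b) \<le> 0" by (intro mult_nonpos_nonneg) auto
    then show ?thesis using 1 2 cross 3 by (auto simp: polarize_def max_def min_def)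
  next
    case 4
    then have "(a \<bullet> x - b) * (a \<bullet> y - b) \<le> 0" by (intro mult_nonneg_nonpos) auto
    then show ?thesis using 1 2 cross 4 by (auto simp: polarize_def max_def min_def)
  qed (use 1 2 in \<open>auto simp: polarize_def max_def min_def abs_le_iff\<close>)
qed

text \<open>With the origin on the lower side, a lower point is no longer than its mirror image, so
  a point outside the support ball cannot receive a value from inside it; an upper point receives
  the smaller value, which is 0.\<close>

lemma polarize_support:
  assumes R: "\<And>x. R < norm x \<Longrightarrow> w x = 0" and w0: "\<And>x. 0 \<le> w x" and b: "0 \<le> b" and x: "R < norm x"
  shows "polarize a b w x = 0"
proof (cases "a \<bullet> x \<le> b")
  case True
  have "b * (a \<bullet> x - b) \<le> 0" using True b by (intro mult_nonneg_nonpos) auto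
  then have "(norm x)\<^sup>2 \<le> (norm (hreflect a b x))\<^sup>2"
    using norm_hreflect[OF a, of b x] by (simp add: mult.assoc)
  then have "norm x \<le> norm (hreflect a b x)" by (rule power2_le_imp_le) simp
  then show ?thesis using True R[of x] R[of "hreflect a b x"] x by (simp add: polarize_def)
next
  case False
  then show ?thesis using R[OF x] w0[of "hreflect a b x"] by (simp add: polarize_def)
qed

lemma polarize_range:
  "(\<And>x. w x \<in> {l..u}) \<Longrightarrow> polarize a b w x \<in> {l..u}"
  using polarize_cases[of w x] by auto

end

text \<open>k is the kernel between points on the same side and k' the kernel across. Sorting both
  pairs in the same direction matters only if they were ordered oppositely, and then lowers the sum
  by 2 (k - k') (p - p') (c' - c).\<close>

lemma two_point_inequality:
  fixes p p' c c' k k' :: real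
  assumes "k' \<le> k"
  shows "(max p p' - max c c')\<^sup>2 * k + (min p p' - min c c')\<^sup>2 * k
      + (max p p' - min c c')\<^sup>2 * k' + (min p p' - max c c')\<^sup>2 * k'
    \<le> (p - c)\<^sup>2 * k + (p' - c')\<^sup>2 * k + (p - c')\<^sup>2 * k' + (p' - c)\<^sup>2 * k'"
proof -
  have *: "(p - c')\<^sup>2 * k + (p' - c)\<^sup>2 * k + (p - c)\<^sup>2 * k' + (p' - c')\<^sup>2 * k'
      \<le> (p - c)\<^sup>2 * k + (p' - c')\<^sup>2 * k + (p - c')\<^sup>2 * k' + (p' - c)\<^sup>2 * k'"
    if "0 \<le> (p - p') * (c' - c)"
  proof -
    have "0 \<le> 2 * (k - k') * ((p - p') * (c' - c))" using assms that by simp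
    then show ?thesis by (simp add: power2_eq_square algebra_simps)
  qed
  consider "p' \<le> p" "c' \<le> c" | "p \<le> p'" "c \<le> c'" | "p' \<le> p" "c \<le> c'" | "p \<le> p'" "c' \<le> c" by linarith
  then show ?thesis
  proof cases
    case 3
    then have "0 \<le> (p - p') * (c' - c)" by simp
    from *[OF this] 3 show ?thesis by (simp add: max_absorb1 max_absorb2 min_absorb1 min_absorb2)
  next
    case 4
    then have "0 \<le> (p - p') * (c' - c)" by (simp add: mult_nonpos_nonpos)
    from *[OF this] 4 show ?thesis
      by (simp add: max_absorb1 max_absorb2 min_absorb1 min_absorb2)
  qed (simp_all add: max_absorb1 max_absorb2 min_absorb1 min_absorb2)
qed

text \<open>The comparison fails for the integrand itself but holds pointwise for \<open>S\<close>,
  its sum over the four combinations of x, y and their mirror images; the double integral of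
  \<open>S\<close> is four times the energy.\<close>

lemma gag_polarize_le:
  fixes w :: "real^'n \<Rightarrow> real"
  assumes a: "norm a = 1" and s: "0 < s" and [measurable]: "w \<in> borel_measurable borel"
  shows "gag s (polarize a b w) \<le> gag s w"
proof -
  let ?r = "hreflect a b" and ?\<alpha> = "real CARD('n) + 2 * s"
  define k where "k x y = 1 / norm (x - y) powr ?\<alpha>" for x y :: "real^'n"
  define K where "K v x y = (v x - v y)\<^sup>2 * k x y" for v :: "real^'n \<Rightarrow> real" and x y
  have [measurable]: "(\<lambda>(x, y). ennreal (K v x y)) \<in> borel_measurable (borel \<Otimes>\<^sub>M borel)"
    if [measurable]: "v \<in> borel_measurable borel" for v
    unfolding K_def k_def by measurable
  have k0: "k x y \<ge> 0" for x y by (simp add: k_def)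
  have K0: "K v x y \<ge> 0" for v x y by (simp add: K_def k0)
  have kr: "k (?r x) (?r y) = k x y" "k (?r x) y = k x (?r y)" for x y
    using hreflect_dist[OF a, of b x y] hreflect_dist[OF a, of b x "?r y"]
    by (simp_all add: k_def hreflect_involution[OF a])
  define S where "S v x y = K v x y + K v (?r x) (?r y) + K v x (?r y) + K v (?r x) y" for v x y
  have S_sym: "S v x (?r y) = S v x y" for v x y
    by (simp add: S_def hreflect_involution[OF a])
  have Seq: "S v x y = (v x - v y)\<^sup>2 * k x y + (v (?r x) - v (?r y))\<^sup>2 * k x y
      + (v x - v (?r y))\<^sup>2 * k x (?r y) + (v (?r x) - v y)\<^sup>2 * k x (?r y)" for v x y
    by (simp add: S_def K_def kr hreflect_involution[OF a])
  have le1: "S (polarize a b w) x y \<le> S w x y" if xy: "0 \<le> (a \<bullet> x - b) * (a \<bullet> y - b)" for x y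
  proof -
    \<comment> \<open>At distance zero, division gives the kernel the value 0, which breaks its
      monotonicity in the distance; the two coincident cases are therefore settled directly.\<close>
    consider "x = y" | "?r x = y" | "x \<noteq> y" "?r x \<noteq> y" by blast
    then show ?thesis
    proof cases
      case 1
      then show ?thesis using polarize_cases[OF a, of b w x] by (auto simp: Seq power2_commute)
    next
      case 2
      then have "?r y = x" using hreflect_involution[OF a, of b x] by simp
      then show ?thesis using 2 polarize_cases[OF a, of b w x] by (auto simp: Seq power2_commute)
    next
      case 3
      have "(norm (x - y))\<^sup>2 \<le> (norm (x - ?r y))\<^sup>2" using hreflect_cross[OF a, of x b y] xy by linarith
      then have "norm (x - y) \<le> norm (x - ?r y)" by (rule power2_le_imp_le) simp
      then have kk: "k x (?r y) \<le> k x y"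
        unfolding k_def using 3 s by (intro divide_left_mono powr_mono2 mult_pos_pos) auto
      consider "a \<bullet> x \<le> b" "a \<bullet> y \<le> b" | "b \<le> a \<bullet> x" "b \<le> a \<bullet> y"
        using xy by (auto simp: zero_le_mult_iff)
      then show ?thesis
      proof cases
        case 1
        show ?thesis
          unfolding Seq using polarize_lower[OF a 1(1), of w] polarize_lower[OF a 1(2), of w]
            two_point_inequality[OF kk, of "w x" "w (?r x)" "w y" "w (?r y)"] by simp
      next
        case 2
        show ?thesis
          unfolding Seq using polarize_upper[OF a 2(1), of w] polarize_upper[OF a 2(2), of w]
            two_point_inequality[OF kk, of "w x" "w (?r x)" "w y" "w (?r y)"] by simp
      qed
    qed
  qed
  \<comment> \<open>\<open>S\<close> is unchanged when y is reflected, so a pair on opposite sides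
    reduces to a pair on the same side.\<close>
  have le: "S (polarize a b w) x y \<le> S w x y" for x y
  proof (cases "0 \<le> (a \<bullet> x - b) * (a \<bullet> y - b)")
    case False
    then have "0 \<le> (a \<bullet> x - b) * (a \<bullet> ?r y - b)"
      by (simp only: hreflect_side[OF a] mult_minus_right neg_0_le_iff_le not_le less_imp_le)
    from le1[OF this] show ?thesis by (simp only: S_sym)
  qed (rule le1)
  have int: "(\<integral>\<^sup>+x. (\<integral>\<^sup>+y. ennreal (S v x y) \<partial>lborel) \<partial>lborel) = 4 * gag s v"
    if [measurable]: "v \<in> borel_measurable borel" for v
  proof -
    define h where "h x y = ennreal (K v x y)" for x y
    have hm[measurable]: "(\<lambda>(x, y). h x y) \<in> borel_measurable (borel \<Otimes>\<^sub>M borel)"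
      unfolding h_def by measurable
    have g: "gag s v = (\<integral>\<^sup>+x. (\<integral>\<^sup>+y. h x y \<partial>lborel) \<partial>lborel)"
      unfolding gag_eq_iterated[OF that] h_def K_def k_def by simp
    have ry: "(\<integral>\<^sup>+y. h x (?r y) \<partial>lborel) = (\<integral>\<^sup>+y. h x y \<partial>lborel)" for x
      by (rule nn_integral_lborel_hreflect[OF a, of "h x"]) measurable
    have rx: "(\<integral>\<^sup>+x. (\<integral>\<^sup>+y. h (?r x) y \<partial>lborel) \<partial>lborel) = (\<integral>\<^sup>+x. (\<integral>\<^sup>+y. h x y \<partial>lborel) \<partial>lborel)"
      by (rule nn_integral_lborel_hreflect[OF a, of "\<lambda>x. (\<integral>\<^sup>+y. h x y \<partial>lborel)"]) measurable
    have "ennreal (S v x y) = h x y + h (?r x) (?r y) + h x (?r y) + h (?r x) y" for x y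
      unfolding S_def h_def using K0 by simp
    then have "(\<integral>\<^sup>+x. (\<integral>\<^sup>+y. ennreal (S v x y) \<partial>lborel) \<partial>lborel)
        = (\<integral>\<^sup>+x. (\<integral>\<^sup>+y. h x y + h (?r x) (?r y) + h x (?r y) + h (?r x) y \<partial>lborel) \<partial>lborel)" by simp
    also have "\<dots> = (\<integral>\<^sup>+x. (\<integral>\<^sup>+y. h x y \<partial>lborel) + (\<integral>\<^sup>+y. h (?r x) y \<partial>lborel)
        + (\<integral>\<^sup>+y. h x y \<partial>lborel) + (\<integral>\<^sup>+y. h (?r x) y \<partial>lborel) \<partial>lborel)"
      by (simp add: nn_integral_add ry)
    also have "\<dots> = gag s v + gag s v + gag s v + gag s v"
      by (simp add: nn_integral_add rx g)
    also have "\<dots> = (1 + 1 + 1 + 1) * gag s v" by (simp only: distrib_right mult_1)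
    finally show ?thesis by simp
  qed
  have "4 * gag s (polarize a b w) \<le> 4 * gag s w"
    unfolding int[OF measurable_polarize[OF a assms(3)], symmetric] int[OF assms(3), symmetric]
    by (intro nn_integral_mono ennreal_leI le)
  then show ?thesis by (subst (asm) ennreal_mult_le_mult_iff) auto
qed

section \<open>Radial rearrangement\<close>

lemma continuous_AE_zero:
  fixes f :: "'a::euclidean_space \<Rightarrow> real"
  assumes c: "continuous_on UNIV f" and z: "AE x in lborel. f x = 0"
  shows "f x = 0"
proof (rule ccontr)
  assume "f x \<noteq> 0"
  have "open {x. f x \<noteq> 0}"
    using c by (intro open_Collect_neq) auto
  then obtain e where e: "e > 0" "ball x e \<subseteq> {x. f x \<noteq> 0}"
    using openE[of "{x. f x \<noteq> 0}" x] \<open>f x \<noteq> 0\<close> by auto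
  have "AE y in lborel. y \<notin> ball x e" using z by eventually_elim (use e(2) in auto)
  then have "ball x e \<in> null_sets lborel" by (subst AE_iff_null_sets) auto
  then have "emeasure lborel (ball x e) = 0" by (rule null_setsD1)
  then show False using e(1)
    by (simp add: emeasure_ball) (metis less_numeral_extra(3) of_nat_0_le_iff unit_ball_vol_pos)
qed

definition second_moment :: "('a::euclidean_space \<Rightarrow> real) \<Rightarrow> real" where
  "second_moment w = (LINT x|lborel. w x * (norm x)\<^sup>2)"

text \<open>For x on the lower side, polarization lowers the moment of a mirror pair by 4 b (b - a .
  x) times the positive part of w (r x) - w x, where r x is the mirror image. If the total moment
  does not drop, this vanishes almost everywhere, and everywhere by continuity.\<close>

lemma second_moment_polarize:
  fixes w :: "'a::euclidean_space \<Rightarrow> real"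
  assumes a: "norm a = 1" and b: "0 < b"
    and c: "continuous_on UNIV w" "continuous_on UNIV (polarize a b w)"
    and M: "\<And>x. 0 \<le> w x \<and> w x \<le> M" and R: "\<And>x. R < norm x \<Longrightarrow> w x = 0"
    and le: "second_moment w \<le> second_moment (polarize a b w)" and x: "a \<bullet> x < b"
  shows "w (hreflect a b x) \<le> w x"
proof -
  let ?r = "hreflect a b" and ?p = "polarize a b w"
  define D where "D x = w x * (norm x)\<^sup>2 + w (?r x) * (norm (?r x))\<^sup>2 - ?p x * (norm x)\<^sup>2 - ?p (?r x) * (norm (?r x))\<^sup>2" for x
  have Dlow: "D x = max (w (?r x) - w x) 0 * (4 * b * (b - a \<bullet> x))" if "a \<bullet> x \<le> b" for x
  proof (cases "w (?r x) \<le> w x")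
    case True
    then show ?thesis using polarize_lower[OF a that, of w] by (simp add: D_def)
  next
    case False
    then have "D x = (w (?r x) - w x) * ((norm (?r x))\<^sup>2 - (norm x)\<^sup>2)"
      using polarize_lower[OF a that, of w] by (simp add: D_def algebra_simps)
    also have "(norm (?r x))\<^sup>2 - (norm x)\<^sup>2 = 4 * b * (b - a \<bullet> x)"
      using norm_hreflect[OF a, of b x] by (simp add: algebra_simps)
    finally show ?thesis using False by simp
  qed
  have Dr: "D (?r x) = D x" for x by (simp add: D_def hreflect_involution[OF a])
  have D0: "0 \<le> D x" for x
  proof (cases "a \<bullet> x \<le> b")
    case True
    then show ?thesis using b by (simp add: Dlow)
  next
    case False
    then have "a \<bullet> ?r x \<le> b" using hreflect_side[OF a, of b x] by simp
    then show ?thesis using b Dlow[of "?r x"] Dr[of x] by simp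
  qed
  have cont: "continuous_on UNIV D"
    unfolding D_def
    by (intro continuous_intros c continuous_on_compose2[OF c(1) continuous_hreflect]
        continuous_on_compose2[OF c(2) continuous_hreflect] continuous_hreflect) auto
  have int: "integrable lborel (\<lambda>x. v x * (norm x)\<^sup>2)"
    if v: "continuous_on UNIV v" "\<And>x. 0 \<le> v x \<and> v x \<le> M" "\<And>x. R < norm x \<Longrightarrow> v x = 0" for v
  proof (rule integrable_bounded_support[where R=R and B="M * R\<^sup>2"])
    have [measurable]: "v \<in> borel_measurable borel" using v(1) by (rule borel_measurable_continuous_onI)
    show "(\<lambda>x. v x * (norm x)\<^sup>2) \<in> borel_measurable borel" by measurable
    fix x
    show "\<bar>v x * (norm x)\<^sup>2\<bar> \<le> M * R\<^sup>2"
    proof (cases "norm x \<le> R")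
      case True
      then have "(norm x)\<^sup>2 \<le> R\<^sup>2" by (intro power_mono) auto
      then have "v x * (norm x)\<^sup>2 \<le> M * R\<^sup>2" using v(2)[of x] by (intro mult_mono) auto
      then show ?thesis using v(2)[of x] by (simp add: abs_mult)
    next
      case False
      then show ?thesis using v(3)[of x] order_trans[OF conjunct1[OF v(2)] conjunct2[OF v(2)]] by simp
    qed
  qed (use v(3) in auto)
  have pM: "0 \<le> ?p x \<and> ?p x \<le> M" for x using polarize_range[OF a, of w 0 M b x] M by auto
  have pR: "R < norm x \<Longrightarrow> ?p x = 0" for x
    using polarize_support[OF a, of R w b x] R M b by auto
  have refl: "integrable lborel (\<lambda>x. f (?r x))" "(LINT x|lborel. f (?r x)) = (LINT x|lborel. f x)"
    if "integrable lborel f" for f :: "'a \<Rightarrow> real"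
  proof -
    have "integrable (distr lborel borel ?r) f" using that by (simp add: lborel_distr_hreflect[OF a])
    then show "integrable lborel (\<lambda>x. f (?r x))" by (rule integrable_distr[rotated]) simp
    have "(LINT x|distr lborel borel ?r. f x) = (LINT x|lborel. f (?r x))"
      using that by (intro integral_distr) auto
    then show "(LINT x|lborel. f (?r x)) = (LINT x|lborel. f x)" by (simp add: lborel_distr_hreflect[OF a])
  qed
  note iw = int[OF c(1) M R] and ip = int[OF c(2) pM pR]
  have iD: "integrable lborel D"
    unfolding D_def using iw ip refl(1)[OF iw] refl(1)[OF ip] by simp
  have "(LINT x|lborel. D x) = 2 * second_moment w - 2 * second_moment ?p"
    unfolding D_def second_moment_def
    using iw ip refl[OF iw] refl[OF ip] by simp
  then have "(LINT x|lborel. D x) \<le> 0" using le by simp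
  moreover have "0 \<le> (LINT x|lborel. D x)" using D0 by (intro integral_nonneg_AE) auto
  ultimately have "(LINT x|lborel. D x) = 0" by simp
  then have "AE x in lborel. D x = 0"
    using integral_nonneg_eq_0_iff_AE[OF iD] D0 by auto
  then have "D x = 0" by (rule continuous_AE_zero[OF cont])
  then show ?thesis using Dlow[of x] x b by (auto simp: max_def split: if_splits)
qed

text \<open>
  The rearrangement is a minimiser of the second moment among the equimeasurable competitors of no
  larger energy: a reflection that moves mass towards the origin would strictly decrease the moment,
  so the minimiser is invariant under all polarizations with the origin on the lower side.
\<close>

lemma radial_rearrangement:
  fixes w :: "real^'n \<Rightarrow> real"
  assumes s: "0 < s" and L: "\<And>x y. \<bar>w x - w y\<bar> \<le> L * norm (x - y)"
    and M: "\<And>x. 0 \<le> w x \<and> w x \<le> M" and R: "\<And>x. R < norm x \<Longrightarrow> w x = 0"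
  obtains W :: "real^'n \<Rightarrow> real" where "radially_decreasing W" "continuous_on UNIV W" "\<And>x. 0 \<le> W x \<and> W x \<le> M"
    "\<And>x. R < norm x \<Longrightarrow> W x = 0" "gag s W \<le> gag s w" "\<And>r. 0 < r \<Longrightarrow> Lpow r W = Lpow r w"
proof -
  define L' where "L' = max L 0"
  have L'0: "0 \<le> L'" by (simp add: L'_def)
  define S :: "(real^'n \<Rightarrow> real) set" where
    "S = {v. (\<forall>x y. \<bar>v x - v y\<bar> \<le> L' * norm (x - y)) \<and> (\<forall>x. 0 \<le> v x \<and> v x \<le> M) \<and>
      (\<forall>x. R < norm x \<longrightarrow> v x = 0) \<and> gag s v \<le> gag s w \<and> (\<forall>r>0. Lpow r v = Lpow r w)}"
  have Lip_cont: "continuous_on UNIV v" if "\<And>x y. \<bar>v x - v y\<bar> \<le> L' * norm (x - y)" for v :: "real^'n \<Rightarrow> real"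
  proof -
    have "L'-lipschitz_on UNIV v"
      using that L'0 by (intro lipschitz_onI) (auto simp: dist_norm)
    then show ?thesis by (rule lipschitz_on_continuous_on)
  qed
  have "\<bar>w x - w y\<bar> \<le> L' * norm (x - y)" for x y
    by (rule order_trans[OF L]) (auto simp: L'_def intro: mult_right_mono)
  then have wS: "w \<in> S" using M R unfolding S_def by auto
  have S_cont: "continuous_on UNIV v" if "v \<in> S" for v using that Lip_cont unfolding S_def by auto
  have S_meas: "v \<in> borel_measurable borel" if "v \<in> S" for v
    by (rule borel_measurable_continuous_onI[OF S_cont[OF that]])
  have J0: "0 \<le> second_moment v" if "v \<in> S" for v
    unfolding second_moment_def using that by (intro integral_nonneg_AE) (auto simp: S_def)
  define m where "m = (INF v\<in>S. second_moment v)"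
  have bdd: "bdd_below (second_moment ` S)" using J0 by (auto intro!: bdd_belowI[of _ 0])
  have "\<exists>v\<in>S. second_moment v < m + 1 / real (Suc n)" for n
    using wS cInf_lessD[of "second_moment ` S" "m + 1 / real (Suc n)"] by (auto simp: m_def)
  then obtain v where v: "\<And>n. v n \<in> S" "\<And>n. second_moment (v n) < m + 1 / real (Suc n)" by metis
  have vm: "m \<le> second_moment (v n)" for n unfolding m_def by (intro cINF_lower bdd v)
  have vlim: "(\<lambda>n. second_moment (v n)) \<longlonglongrightarrow> m"
  proof (rule tendsto_sandwich[OF _ _ tendsto_const])
    have "(\<lambda>n. m + 1 / real (Suc n)) \<longlonglongrightarrow> m + 0"
      by (intro tendsto_intros LIMSEQ_Suc[OF lim_1_over_n])
    then show "(\<lambda>n. m + 1 / real (Suc n)) \<longlonglongrightarrow> m" by simp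
  qed (use vm v(2) in \<open>auto intro!: always_eventually less_imp_le\<close>)
  obtain g k where k: "strict_mono (k :: nat \<Rightarrow> nat)"
    and unif: "\<And>e. 0 < e \<Longrightarrow> \<exists>N. \<forall>n x. n \<ge> N \<and> x \<in> cball 0 R \<longrightarrow> norm (v (k n) x - g x) < e"
  proof (rule Arzela_Ascoli[of "cball (0::real^'n) R" v M])
    show "\<exists>d>0. \<forall>n y. y \<in> cball 0 R \<and> norm (x - y) < d \<longrightarrow> norm (v n x - v n y) < e" if "0 < e" for x :: "real^'n" and e
    proof (intro exI[of _ "e / (L' + 1)"] conjI allI impI)
      show "e / (L' + 1) > 0" using that L'0 by simp
      fix n y assume "y \<in> cball 0 R \<and> norm (x - y) < e / (L' + 1)"
      then have "(L' + 1) * norm (x - y) < e" using L'0 by (simp add: pos_less_divide_eq mult.commute)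
      moreover have "\<bar>v n x - v n y\<bar> \<le> L' * norm (x - y)" using v(1)[of n] by (simp add: S_def)
      ultimately show "norm (v n x - v n y) < e" by (simp add: algebra_simps) (smt (verit) norm_ge_zero)
    qed
    show "norm (v n x) \<le> M" for n x using v(1)[of n] by (simp add: S_def)
  qed auto
  \<comment> \<open>Uniform convergence is obtained on the support ball only; outside it all members
    of the class vanish, so extension by 0 gives the pointwise limit everywhere.\<close>
  define W where "W x = (if norm x \<le> R then g x else 0)" for x
  have lim: "(\<lambda>n. v (k n) x) \<longlonglongrightarrow> W x" for x
  proof (cases "norm x \<le> R")
    case True
    show ?thesis
    proof (rule LIMSEQ_I)
      fix e :: real assume "0 < e"
      from unif[OF this] show "\<exists>no. \<forall>n\<ge>no. norm (v (k n) x - W x) < e" using True by (auto simp: W_def)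
    qed
  next
    case False
    then have "v (k n) x = 0" for n using v(1)[of "k n"] by (simp add: S_def)
    then show ?thesis using False by (simp add: W_def)
  qed
  have WL: "\<bar>W x - W y\<bar> \<le> L' * norm (x - y)" for x y
    by (rule LIMSEQ_le_const2[OF tendsto_rabs[OF tendsto_diff[OF lim lim]]])
       (use v(1) in \<open>auto simp: S_def\<close>)
  have WM: "0 \<le> W x \<and> W x \<le> M" for x
    using LIMSEQ_le_const[OF lim] LIMSEQ_le_const2[OF lim] v(1) by (auto simp: S_def)
  have WR: "R < norm x \<Longrightarrow> W x = 0" for x by (simp add: W_def)
  have Wc: "continuous_on UNIV W" by (rule Lip_cont[OF WL])
  note [measurable] = borel_measurable_continuous_onI[OF Wc] S_meas[OF v(1)]
  have "gag s W \<le> liminf (\<lambda>n. gag s (v (k n)))" by (rule gag_fatou) (use lim in auto)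
  also have "\<dots> \<le> gag s w"
    using v(1) by (intro Liminf_le) (auto simp: S_def intro!: always_eventually)
  finally have Wg: "gag s W \<le> gag s w" .
  have Mn: "0 \<le> M" using WM[of 0] by simp
  have WP: "Lpow r W = Lpow r w" if r: "0 < r" for r
  proof -
    have "(\<lambda>n. \<integral>\<^sup>+x. ennreal (\<bar>v (k n) x\<bar> powr r) \<partial>lborel) \<longlonglongrightarrow> (\<integral>\<^sup>+x. ennreal (\<bar>W x\<bar> powr r) \<partial>lborel)"
    proof (rule nn_integral_dominated_convergence)
      have [measurable]: "(indicator (cball 0 R) :: real^'n \<Rightarrow> ennreal) \<in> borel_measurable borel"
        by (rule borel_measurable_indicator) simp
      show "(\<lambda>x::real^'n. ennreal (M powr r) * indicator (cball 0 R) x) \<in> borel_measurable lborel" by measurable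
      show "(\<integral>\<^sup>+x. ennreal (M powr r) * indicator (cball (0::real^'n) R) x \<partial>lborel) < \<infinity>"
        by (cases "0 \<le> R") (auto simp: nn_integral_cmult emeasure_cball ennreal_mult_less_top)
      show "AE x in lborel. ennreal (\<bar>v (k n) x\<bar> powr r) \<le> ennreal (M powr r) * indicator (cball 0 R) x" for n
      proof (rule AE_I2)
        fix x
        show "ennreal (\<bar>v (k n) x\<bar> powr r) \<le> ennreal (M powr r) * indicator (cball 0 R) x"
          using v(1)[of "k n"] r
          by (cases "norm x \<le> R") (auto simp: S_def intro!: ennreal_leI powr_mono2)
      qed
      show "AE x in lborel. (\<lambda>n. ennreal (\<bar>v (k n) x\<bar> powr r)) \<longlonglongrightarrow> ennreal (\<bar>W x\<bar> powr r)"
        using r by (intro AE_I2 tendsto_ennrealI tendsto_powr2 tendsto_intros lim) auto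
    qed auto
    moreover have "Lpow r (v (k n)) = Lpow r w" for n using v(1)[of "k n"] r by (simp add: S_def)
    then have "(\<integral>\<^sup>+x. ennreal (\<bar>v (k n) x\<bar> powr r) \<partial>lborel) = Lpow r w" for n
      by (simp only: Lpow_def)
    ultimately show ?thesis by (simp add: Lpow_def LIMSEQ_const_iff)
  qed
  have WS: "W \<in> S" using WL WM WR Wg WP by (simp add: S_def)
  have "(\<lambda>n. second_moment (v (k n))) \<longlonglongrightarrow> second_moment W"
    unfolding second_moment_def
  proof (rule integral_dominated_convergence[where w="\<lambda>x. M * R\<^sup>2 * indicator (cball 0 R) x"])
    show "integrable lborel (\<lambda>x::real^'n. M * R\<^sup>2 * indicator (cball 0 R) x)"
      by (intro integrable_mult_right integrable_real_indicator emeasure_lborel_cball_finite) auto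
    show "AE x in lborel. (\<lambda>n. v (k n) x * (norm x)\<^sup>2) \<longlonglongrightarrow> W x * (norm x)\<^sup>2"
      by (intro AE_I2 tendsto_intros lim)
    show "AE x in lborel. norm (v (k n) x * (norm x)\<^sup>2) \<le> M * R\<^sup>2 * indicator (cball 0 R) x" for n
    proof (rule AE_I2)
      fix x
      show "norm (v (k n) x * (norm x)\<^sup>2) \<le> M * R\<^sup>2 * indicator (cball 0 R) x"
      proof (cases "norm x \<le> R")
        case True
        then have "(norm x)\<^sup>2 \<le> R\<^sup>2" by (intro power_mono) auto
        then have "v (k n) x * (norm x)\<^sup>2 \<le> M * R\<^sup>2" using v(1)[of "k n"] Mn by (intro mult_mono) (auto simp: S_def)
        then show ?thesis using True v(1)[of "k n"] by (simp add: S_def abs_mult)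
      next
        case False
        then show ?thesis using v(1)[of "k n"] by (simp add: S_def)
      qed
    qed
  qed auto
  then have Wmin: "second_moment W = m"
    using LIMSEQ_unique[OF LIMSEQ_subseq_LIMSEQ[OF vlim k]] by (simp add: o_def)
  have refl: "W (hreflect a b x) \<le> W x" if a: "norm a = 1" and b: "0 < b" and x: "a \<bullet> x < b" for a b x
  proof (rule second_moment_polarize[OF a b Wc _ WM WR _ x])
    have pS: "polarize a b W \<in> S"
      unfolding S_def
    proof (intro CollectI conjI allI impI)
      show "\<bar>polarize a b W x - polarize a b W y\<bar> \<le> L' * norm (x - y)" for x y
        by (rule polarize_Lipschitz[OF a WL L'0])
      show "0 \<le> polarize a b W x" "polarize a b W x \<le> M" for x
        using polarize_range[OF a, of W 0 M b x] WM by auto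
      show "polarize a b W x = 0" if "R < norm x" for x
        using polarize_support[OF a, of R W b x] WR WM b that by auto
      show "gag s (polarize a b W) \<le> gag s w"
        using gag_polarize_le[OF a s, of W b] Wg by (auto intro: order_trans)
      show "Lpow r (polarize a b W) = Lpow r w" if "0 < r" for r
        using nn_integral_polarize[OF a, of W "\<lambda>t. ennreal (\<bar>t\<bar> powr r)" b] WP[OF that]
        by (simp add: Lpow_def)
    qed
    show "continuous_on UNIV (polarize a b W)" by (rule S_cont[OF pS])
    show "second_moment W \<le> second_moment (polarize a b W)"
      unfolding Wmin m_def by (intro cINF_lower bdd pS)
  qed
  have lt: "W y \<le> W x" if xy: "norm x < norm y" for x y
  proof -
    \<comment> \<open>The hyperplane is the perpendicular bisector of x and y, so the reflection
      exchanges them. Since x is nearer to the origin, b > 0 and x lies on the lower side.\<close>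
    define d where "d = norm (y - x)"
    have d: "d > 0" using xy by (auto simp: d_def)
    define a where "a = (1 / d) *\<^sub>R (y - x)"
    define b where "b = a \<bullet> (x + y) / 2"
    have a: "norm a = 1" using d by (simp add: a_def d_def)
    have "(y - x) \<bullet> (x + y) = (norm y)\<^sup>2 - (norm x)\<^sup>2"
      by (simp add: power2_norm_eq_inner algebra_simps inner_commute)
    moreover have "(norm x)\<^sup>2 < (norm y)\<^sup>2" using xy by (intro power_strict_mono) auto
    ultimately have b: "0 < b" using d by (simp add: b_def a_def)
    have "(y - x) \<bullet> (y - x) = d\<^sup>2" by (simp add: d_def power2_norm_eq_inner)
    then have "a \<bullet> (y - x) = d" using d by (simp add: a_def power2_eq_square)
    then have ax: "a \<bullet> x - b = - (d / 2)" by (simp add: b_def inner_diff_right inner_add_right field_simps)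
    have "hreflect a b x = y" using d by (simp add: hreflect_def ax) (simp add: a_def)
    then show ?thesis using refl[OF a b, of x] ax d by simp
  qed
  have "radially_decreasing W"
    unfolding radially_decreasing_def
  proof (intro allI impI)
    fix x y :: "real^'n" assume xy: "norm x \<le> norm y"
    show "W y \<le> W x"
    proof (cases "y = 0")
      case True
      then show ?thesis using xy by simp
    next
      case False
      \<comment> \<open>For equal norms the bisector passes through the origin, outside the range b
        > 0; y is approached by slightly longer vectors instead.\<close>
      have "(\<lambda>n. (1 + 1 / real (Suc n)) *\<^sub>R y) \<longlonglongrightarrow> (1 + 0) *\<^sub>R y"
        by (intro tendsto_intros LIMSEQ_Suc[OF lim_1_over_n])
      then have "(\<lambda>n. W ((1 + 1 / real (Suc n)) *\<^sub>R y)) \<longlonglongrightarrow> W y"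
        using Wc by (intro continuous_on_tendsto_compose[of UNIV W]) auto
      moreover have "W ((1 + 1 / real (Suc n)) *\<^sub>R y) \<le> W x" for n
      proof (rule lt)
        have "1 * norm y < (1 + 1 / real (Suc n)) * norm y" using False by (intro mult_strict_right_mono) auto
        then show "norm x < norm ((1 + 1 / real (Suc n)) *\<^sub>R y)" using xy by simp
      qed
      ultimately show ?thesis by (intro LIMSEQ_le_const2) auto
    qed
  qed
  then show ?thesis by (rule that[OF _ Wc WM WR Wg WP])
qed

section \<open>Existence of a minimiser\<close>

definition energy_nn :: "real \<Rightarrow> real \<Rightarrow> (real^'n \<Rightarrow> real) \<Rightarrow> ennreal" where
  "energy_nn s q v = ennreal (1 / 2) * gag s v + ennreal (1 / (q + 1)) * Lpow (q + 1) v"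

lemma ennreal_lincomb:
  assumes "0 \<le> a" "0 \<le> b" "0 \<le> x" "0 \<le> y"
  shows "ennreal (a * x + b * y) = ennreal a * ennreal x + ennreal b * ennreal y"
  using assms by (simp only: ennreal_mult[symmetric] ennreal_plus[symmetric] mult_nonneg_nonneg)

lemma Lpow_eq_0_iff:
  fixes u :: "real^'n \<Rightarrow> real"
  assumes [measurable]: "u \<in> borel_measurable borel"
  shows "Lpow r u = 0 \<longleftrightarrow> (AE x in lborel. u x = 0)"
  unfolding Lpow_def by (subst nn_integral_0_iff_AE) (auto simp: ennreal_eq_0_iff)

lemma Lpow_bounded_mono:
  fixes u :: "real^'n \<Rightarrow> real"
  assumes [measurable]: "u \<in> borel_measurable borel" and M: "\<And>x. \<bar>u x\<bar> \<le> M" and r: "0 < c" "c \<le> r"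
  shows "Lpow r u \<le> ennreal (M powr (r - c)) * Lpow c u"
proof -
  have "Lpow r u \<le> (\<integral>\<^sup>+x. ennreal (M powr (r - c)) * ennreal (\<bar>u x\<bar> powr c) \<partial>lborel)"
    unfolding Lpow_def
  proof (rule nn_integral_mono)
    fix x
    have "\<bar>u x\<bar> powr r = \<bar>u x\<bar> powr (r - c) * \<bar>u x\<bar> powr c" by (simp add: powr_add[symmetric])
    also have "\<dots> \<le> M powr (r - c) * \<bar>u x\<bar> powr c"
      using r M by (intro mult_right_mono powr_mono2) auto
    finally show "ennreal (\<bar>u x\<bar> powr r) \<le> ennreal (M powr (r - c)) * ennreal (\<bar>u x\<bar> powr c)"
      by (simp add: ennreal_mult'[symmetric] ennreal_leI)
  qed
  then show ?thesis by (simp add: Lpow_def nn_integral_cmult)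
qed

lemma Hs_dot_finite_energy: "u \<in> Hs_dot s \<Longrightarrow> u \<in> finite_energy s"
  by (simp add: Hs_dot_def)

lemma finite_energy_measurable: "u \<in> finite_energy s \<Longrightarrow> u \<in> borel_measurable borel"
  by (simp add: finite_energy_iff)

text \<open>The \<open>itself\<close> parameter fixes the dimension type, which the real parameters
  alone do not determine.\<close>

locale fractional_problem =
  fixes s p q :: real and dim_type :: "'n::finite itself"
  assumes s: "0 < s" "s < 1" "2 * s < real CARD('n)"
    and p: "crit_exp (real CARD('n)) s - 1 < p" and pq: "p < q"
begin

lemma crit: "2 < (crit_exp (real CARD('n)) s)" "(crit_exp (real CARD('n)) s) < p + 1" "(crit_exp (real CARD('n)) s) < q + 1"
  using crit_exp_gt_2[OF s(1,3)] p pq by auto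

lemma test_function_Hs_dot:
  fixes f :: "real^'n \<Rightarrow> real"
  assumes f: "f \<in> test_functions"
  shows "f \<in> Hs_dot s" "f \<in> Lp_space (q + 1)"
proof -
  have [measurable]: "f \<in> borel_measurable borel" by (rule test_function_measurable[OF f])
  have "f \<in> finite_energy s"
    using test_function_finite_gag[OF s(1,2) f] test_function_finite_Lpow[OF f, of "crit_exp (real CARD('n)) s"] crit
    by (simp add: finite_energy_iff)
  moreover have "gag s (\<lambda>x. f x - f x) = 0" "Lpow (crit_exp (real CARD('n)) s) (\<lambda>x. f x - f x) = 0"
    by (simp_all add: gag_def Lpow_def gagliardo_integrand_def split_beta)
  ultimately show "f \<in> Hs_dot s"
    using f by (auto simp: Hs_dot_iff[OF s] intro!: exI[of _ "\<lambda>_. f"])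
  show "f \<in> Lp_space (q + 1)"
    using test_function_finite_Lpow[OF f, of "q + 1"] crit by (simp add: Lp_space_iff)
qed

lemma energy_eq:
  fixes v :: "real^'n \<Rightarrow> real"
  assumes "v \<in> finite_energy s" "v \<in> Lp_space (q + 1)"
  shows "ennreal (energy s q v) = energy_nn s q v" "0 \<le> energy s q v"
proof -
  have q1: "q + 1 > 0" using crit by simp
  show "0 \<le> energy s q v"
    using q1 by (auto simp: energy_def gagliardo_form_nonneg intro!: add_nonneg_nonneg mult_nonneg_nonneg)
  have "gag s v = ennreal (gagliardo_form s v v)"
    using assms by (simp add: gagliardo_form_gag finite_energy_iff)
  moreover have "Lpow (q + 1) v = ennreal (LINT x|lborel. \<bar>v x\<bar> powr (q + 1))"
    using assms by (simp add: integral_Lpow)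
  ultimately show "ennreal (energy s q v) = energy_nn s q v"
    unfolding energy_nn_def energy_def using q1
    by (simp only:) (rule ennreal_lincomb, auto simp: gagliardo_form_nonneg)
qed

lemma admissible_iff:
  fixes v :: "real^'n \<Rightarrow> real"
  shows "v \<in> admissible s p q \<longleftrightarrow> v \<in> Hs_dot s \<and> v \<in> Lp_space (q + 1) \<and> Lpow (p + 1) v = 1"
proof (cases "v \<in> Hs_dot s")
  case True
  have [measurable]: "v \<in> borel_measurable borel"
    by (rule finite_energy_measurable[OF Hs_dot_finite_energy[OF True]])
  have "(LINT x|lborel. \<bar>v x\<bar> powr (p + 1)) = 1 \<longleftrightarrow> Lpow (p + 1) v = 1"
  proof (cases "integrable lborel (\<lambda>x. \<bar>v x\<bar> powr (p + 1))")
    case True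
    then have "ennreal (LINT x|lborel. \<bar>v x\<bar> powr (p + 1)) = Lpow (p + 1) v"
      by (intro integral_Lpow) (simp add: Lp_space_def)
    then show ?thesis by (metis ennreal_1 ennreal_eq_1)
  next
    \<comment> \<open>A divergent Bochner integral has the value 0, so it cannot meet the
      constraint.\<close>
    case False
    then show ?thesis
      using integrable_Lpow_iff[of v "p + 1"] by (auto simp: not_integrable_integral_eq)
  qed
  then show ?thesis by (simp add: admissible_def True)
qed (simp add: admissible_def)

lemma rd_profile_admissible:
  fixes u :: "real^'n \<Rightarrow> real"
  assumes u: "rd_profile M u" "u \<in> finite_energy s"
  shows "u \<in> Hs_dot s" "u \<in> Lp_space (q + 1)"
proof -
  show "u \<in> Hs_dot s" using u rd_profileD[OF u(1)] by (intro radially_decreasing_Hs_dot[OF s]) auto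
  have "Lpow (q + 1) u \<le> ennreal (M powr (q + 1 - (crit_exp (real CARD('n)) s))) * Lpow (crit_exp (real CARD('n)) s) u"
    using u(2) rd_profileD[OF u(1)] crit
    by (intro Lpow_bounded_mono) (auto simp: finite_energy_iff)
  also have "\<dots> < \<infinity>" using u(2) by (simp add: finite_energy_iff ennreal_mult_less_top)
  finally show "u \<in> Lp_space (q + 1)" using u(2) by (simp add: Lp_space_iff finite_energy_iff)
qed

text \<open>Dilation by c with c^N = a restores the constraint. All power integrals grow by c^(-N) =
  1/a and the Gagliardo energy only by c^(2s - N), which is no larger since c \<le> 1.\<close>

lemma rd_profile_normalise:
  fixes W :: "real^'n \<Rightarrow> real"
  assumes W: "rd_profile M W" "W \<in> finite_energy s" and a: "Lpow (p + 1) W = ennreal a" "0 < a" "a \<le> 1"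
  obtains U :: "real^'n \<Rightarrow> real" where "rd_profile M U" "U \<in> admissible s p q"
    "energy_nn s q U \<le> ennreal (1 / a) * energy_nn s q W"
proof -
  let ?n = "real CARD('n)"
  have [measurable]: "W \<in> borel_measurable borel" by (rule finite_energy_measurable[OF W(2)])
  define c where "c = a powr (1 / ?n)"
  have c: "0 < c" using a by (simp add: c_def)
  have c1: "c \<le> 1" unfolding c_def using a powr_mono2[of "1 / ?n" a 1] by simp
  have cn: "c powr - ?n = 1 / a" using a by (simp add: c_def powr_powr powr_minus_divide)
  define U where "U x = W (c *\<^sub>R x)" for x
  have UL: "Lpow r U = ennreal (1 / a) * Lpow r W" for r
    unfolding U_def using Lpow_dilate[of W c r] c by (simp add: cn)
  have Ug: "gag s U = ennreal (c powr - (?n - 2 * s)) * gag s W"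
    unfolding U_def using gag_dilate[of W c s] c by simp
  have "c powr - (?n - 2 * s) \<le> c powr - ?n" using s c c1 by (intro powr_mono') auto
  then have Ug': "gag s U \<le> ennreal (1 / a) * gag s W"
    unfolding Ug cn by (intro mult_right_mono ennreal_leI) auto
  have pU: "rd_profile M U" unfolding U_def by (rule rd_profile_dilate[OF W(1) c])
  have [measurable]: "U \<in> borel_measurable borel" unfolding U_def by measurable
  have fU: "U \<in> finite_energy s"
    using W(2) by (simp add: finite_energy_iff UL Ug ennreal_mult_less_top)
  have "Lpow (p + 1) U = 1" using a by (simp add: UL ennreal_mult'[symmetric])
  then have "U \<in> admissible s p q"
    using rd_profile_admissible[OF pU fU] by (simp add: admissible_iff)
  moreover have "energy_nn s q U \<le> ennreal (1 / a) * energy_nn s q W"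
  proof -
    have "energy_nn s q U \<le> ennreal (1 / 2) * (ennreal (1 / a) * gag s W)
        + ennreal (1 / (q + 1)) * (ennreal (1 / a) * Lpow (q + 1) W)"
      unfolding energy_nn_def UL by (intro add_mono mult_left_mono Ug' order_refl) auto
    also have "\<dots> = ennreal (1 / a) * energy_nn s q W"
      unfolding energy_nn_def by (simp only: distrib_left mult.left_commute)
    finally show ?thesis .
  qed
  ultimately show ?thesis using that pU by blast
qed

text \<open>
  Above the level \<open>M\<close> the power \<open>q + 1\<close> outweighs the power \<open>p + 1\<close>, so truncation followed by
  renormalisation does not increase the energy.
\<close>

lemma truncation_energy:
  fixes v :: "real^'n \<Rightarrow> real"
  assumes v: "v \<in> admissible s p q" and E: "energy s q v \<le> E" and M: "0 < M" "(q + 1) * E \<le> M powr (q - p)"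
  obtains a where "0 < a" "a \<le> 1" "Lpow (p + 1) (\<lambda>x. min \<bar>v x\<bar> M) = ennreal a"
    "ennreal (1 / 2) * gag s v + ennreal (1 / (q + 1)) * Lpow (q + 1) (\<lambda>x. min \<bar>v x\<bar> M)
      \<le> ennreal a * ennreal (energy s q v)"
proof -
  have vH: "v \<in> Hs_dot s" and vL: "v \<in> Lp_space (q + 1)" and v1: "Lpow (p + 1) v = 1"
    using v by (auto simp: admissible_iff)
  have fv: "v \<in> finite_energy s" by (rule Hs_dot_finite_energy[OF vH])
  have [measurable]: "v \<in> borel_measurable borel" by (rule finite_energy_measurable[OF fv])
  have q1: "q + 1 > 0" "p + 1 > 0" using crit by simp_all
  let ?m = "\<lambda>x. min \<bar>v x\<bar> M"
  have mle: "Lpow r ?m \<le> Lpow r v" if "r \<ge> 0" for r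
    using M that by (intro Lpow_mono) auto
  have "Lpow (p + 1) ?m \<le> 1" using mle[of "p + 1"] v1 q1 by simp
  then obtain a where a: "Lpow (p + 1) ?m = ennreal a" "0 \<le> a" "a \<le> 1"
    by (cases "Lpow (p + 1) ?m") (auto simp: top_unique)
  have a0: "a \<noteq> 0"
  proof
    assume "a = 0"
    then have "AE x in lborel. ?m x = 0" using a(1) Lpow_eq_0_iff[of ?m "p + 1"] by simp
    then have "AE x in lborel. v x = 0"
      by eventually_elim (use M in \<open>auto simp: min_def split: if_splits\<close>)
    then have "Lpow (p + 1) v = 0" by (simp add: Lpow_eq_0_iff)
    then show False using v1 by simp
  qed
  obtain B where B: "Lpow (q + 1) v = ennreal B" "0 \<le> B"
    using vL by (cases "Lpow (q + 1) v") (auto simp: Lp_space_iff)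
  have "Lpow (q + 1) ?m \<le> ennreal B" using mle[of "q + 1"] B q1 by simp
  then obtain Bm where Bm: "Lpow (q + 1) ?m = ennreal Bm" "0 \<le> Bm"
    by (cases "Lpow (q + 1) ?m") (auto simp: top_unique)
  obtain G where G: "gag s v = ennreal G" "0 \<le> G"
    using fv by (cases "gag s v") (auto simp: finite_energy_iff)
  let ?P = "M powr (q - p)"
  \<comment> \<open>Where |v| > M this reads M^(q-p) (|v|^(p+1) - M^(p+1)) \<le> |v|^(q+1) -
    M^(q+1), rearranged without subtraction for integration in \<open>ennreal\<close>.\<close>
  have pt: "\<bar>?m x\<bar> powr (q + 1) + ?P * \<bar>v x\<bar> powr (p + 1) \<le> \<bar>v x\<bar> powr (q + 1) + ?P * \<bar>?m x\<bar> powr (p + 1)" for x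
  proof (cases "\<bar>v x\<bar> \<le> M")
    case False
    then have t: "M < \<bar>v x\<bar>" by simp
    have "M powr (q + 1) = ?P * M powr (p + 1)" by (simp add: powr_add[symmetric])
    moreover have "?P * \<bar>v x\<bar> powr (p + 1) \<le> \<bar>v x\<bar> powr (q - p) * \<bar>v x\<bar> powr (p + 1)"
      using t M pq by (intro mult_right_mono powr_mono2) auto
    moreover have "\<bar>v x\<bar> powr (q - p) * \<bar>v x\<bar> powr (p + 1) = \<bar>v x\<bar> powr (q + 1)" by (simp add: powr_add[symmetric])
    ultimately show ?thesis using t M by simp
  qed (use M in simp)
  have "Lpow (q + 1) ?m + ennreal ?P * Lpow (p + 1) v
      = (\<integral>\<^sup>+x. ennreal (\<bar>?m x\<bar> powr (q + 1)) + ennreal ?P * ennreal (\<bar>v x\<bar> powr (p + 1)) \<partial>lborel)"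
    unfolding Lpow_def by (simp add: nn_integral_add nn_integral_cmult)
  also have "\<dots> \<le> (\<integral>\<^sup>+x. ennreal (\<bar>v x\<bar> powr (q + 1)) + ennreal ?P * ennreal (\<bar>?m x\<bar> powr (p + 1)) \<partial>lborel)"
    using pt by (intro nn_integral_mono)
      (simp add: ennreal_mult'[symmetric] ennreal_plus[symmetric] ennreal_leI del: ennreal_plus)
  also have "\<dots> = Lpow (q + 1) v + ennreal ?P * Lpow (p + 1) ?m"
    unfolding Lpow_def by (simp add: nn_integral_add nn_integral_cmult)
  finally have "ennreal (Bm + ?P) \<le> ennreal (B + ?P * a)"
    using a B Bm v1 by (simp add: ennreal_mult' ennreal_plus)
  then have BB: "Bm + ?P \<le> B + ?P * a" using B a by (subst (asm) ennreal_le_iff) auto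
  define e where "e = energy s q v"
  have en: "ennreal e = energy_nn s q v" and e0: "0 \<le> e" unfolding e_def by (rule energy_eq[OF fv vL])+
  have "ennreal e = ennreal (1 / 2 * G + 1 / (q + 1) * B)"
    unfolding en energy_nn_def G B using G B q1 by (intro ennreal_lincomb[symmetric]) auto
  then have e: "e = 1 / 2 * G + 1 / (q + 1) * B"
    using e0 G B q1 by (subst (asm) ennreal_inj) auto
  \<comment> \<open>Losing constraint mass 1 - a removes at least M^(q-p) (1 - a) from the integral
    of |v|^(q+1). Since M^(q-p) is at least q + 1 times the energy e, at least e (1 - a) is saved,
    even with the Gagliardo term left untruncated.\<close>
  have "?P * (1 - a) \<le> B - Bm" using BB by (simp add: algebra_simps)
  moreover have "(q + 1) * e * (1 - a) \<le> ?P * (1 - a)"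
    using M(2) E a q1 by (intro mult_right_mono) (auto simp: e_def intro: order_trans[OF mult_left_mono])
  ultimately have "(q + 1) * (e * (1 - a)) \<le> B - Bm" by (simp add: mult.assoc)
  then have "e * (1 - a) \<le> (B - Bm) / (q + 1)" using q1 by (simp add: pos_le_divide_eq mult.commute)
  then have "1 / 2 * G + 1 / (q + 1) * Bm \<le> a * e"
    by (simp add: e diff_divide_distrib algebra_simps)
  then have "ennreal (1 / 2 * G + 1 / (q + 1) * Bm) \<le> ennreal (a * e)" by (rule ennreal_leI)
  also have "ennreal (1 / 2 * G + 1 / (q + 1) * Bm) = ennreal (1 / 2) * gag s v + ennreal (1 / (q + 1)) * Lpow (q + 1) ?m"
    unfolding G Bm using G Bm q1 by (intro ennreal_lincomb) auto
  finally show ?thesis using that[of a] a a0 by (simp add: e_def ennreal_mult')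
qed

text \<open>A geometric rate makes the errors summable, which yields convergence almost everywhere
  along the whole sequence together with a common integrable majorant.\<close>

lemma Hs_dot_fast_approximation:
  fixes v :: "real^'n \<Rightarrow> real"
  assumes v: "v \<in> Hs_dot s"
  obtains \<phi> where "\<And>k. \<phi> k \<in> test_functions" "\<And>k. gag s (\<lambda>x. v x - \<phi> k x) \<le> ennreal ((1 / 2) ^ k)"
    "\<And>k. Lpow (crit_exp (real CARD('n)) s) (\<lambda>x. v x - \<phi> k x) \<le> ennreal ((1 / 2) ^ k)"
proof -
  obtain \<psi> where \<psi>: "\<And>k. \<psi> k \<in> test_functions"
    "(\<lambda>k. gag s (\<lambda>x. v x - \<psi> k x)) \<longlonglongrightarrow> 0" "(\<lambda>k. Lpow (crit_exp (real CARD('n)) s) (\<lambda>x. v x - \<psi> k x)) \<longlonglongrightarrow> 0"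
    using v unfolding Hs_dot_iff[OF s] by blast
  have "\<exists>j. gag s (\<lambda>x. v x - \<psi> j x) \<le> ennreal ((1 / 2) ^ k) \<and> Lpow (crit_exp (real CARD('n)) s) (\<lambda>x. v x - \<psi> j x) \<le> ennreal ((1 / 2) ^ k)" for k
  proof -
    have pos: "0 < ennreal ((1 / 2) ^ k)" by simp
    have "eventually (\<lambda>j. gag s (\<lambda>x. v x - \<psi> j x) < ennreal ((1 / 2) ^ k)
        \<and> Lpow (crit_exp (real CARD('n)) s) (\<lambda>x. v x - \<psi> j x) < ennreal ((1 / 2) ^ k)) sequentially"
      by (intro eventually_conj order_tendstoD(2)[OF \<psi>(2) pos] order_tendstoD(2)[OF \<psi>(3) pos])
    then show ?thesis by (auto simp: eventually_sequentially intro: less_imp_le)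
  qed
  then obtain j where "\<And>k. gag s (\<lambda>x. v x - \<psi> (j k) x) \<le> ennreal ((1 / 2) ^ k)
      \<and> Lpow (crit_exp (real CARD('n)) s) (\<lambda>x. v x - \<psi> (j k) x) \<le> ennreal ((1 / 2) ^ k)" by metis
  then show ?thesis using that[of "\<lambda>k. \<psi> (j k)"] \<psi>(1) by blast
qed

text \<open>Truncating absolute values destroys smoothness but keeps Lipschitz continuity and
  bounded support, which is what the rearrangement asks for. The free t keeps the energy bound sharp
  in the limit.\<close>

lemma truncated_approximation:
  fixes v :: "real^'n \<Rightarrow> real"
  assumes v: "v \<in> Hs_dot s" and M: "0 < M"
  obtains w where
    "\<And>k. \<exists>L R. (\<forall>x y. \<bar>w k x - w k y\<bar> \<le> L * norm (x - y)) \<and> (\<forall>x::real^'n. R < norm x \<longrightarrow> w k x = 0)"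
    "\<And>k x. 0 \<le> w k x \<and> w k x \<le> M"
    "\<And>k t. 0 < t \<Longrightarrow> gag s (w k) \<le> ennreal (1 + t) * gag s v + ennreal ((1 + 1 / t) * (1 / 2) ^ k)"
    "\<And>r. (crit_exp (real CARD('n)) s) \<le> r \<Longrightarrow> (\<lambda>k. Lpow r (w k)) \<longlonglongrightarrow> Lpow r (\<lambda>x. min \<bar>v x\<bar> M)"
proof -
  obtain \<phi> where \<phi>: "\<And>k. \<phi> k \<in> test_functions" "\<And>k. gag s (\<lambda>x. v x - \<phi> k x) \<le> ennreal ((1 / 2) ^ k)"
    "\<And>k. Lpow (crit_exp (real CARD('n)) s) (\<lambda>x. v x - \<phi> k x) \<le> ennreal ((1 / 2) ^ k)"
    using Hs_dot_fast_approximation[OF v] by metis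
  have fv: "v \<in> finite_energy s" by (rule Hs_dot_finite_energy[OF v])
  note [measurable] = finite_energy_measurable[OF fv] test_function_measurable[OF \<phi>(1)]
  define w where "w k x = min \<bar>\<phi> k x\<bar> M" for k x
  have 1: "\<exists>L R. (\<forall>x y. \<bar>w k x - w k y\<bar> \<le> L * norm (x - y)) \<and> (\<forall>x. R < norm x \<longrightarrow> w k x = 0)" for k
  proof -
    obtain R where "\<And>x. R < norm x \<Longrightarrow> \<phi> k x = 0" using \<phi>(1)[of k] unfolding test_functions_iff by blast
    moreover obtain L where "\<And>x y. \<bar>\<phi> k x - \<phi> k y\<bar> \<le> L * norm (x - y)"
      using test_function_Lipschitz[OF \<phi>(1)[of k]] by metis
    moreover have "\<bar>w k x - w k y\<bar> \<le> \<bar>\<phi> k x - \<phi> k y\<bar>" for x y by (auto simp: w_def min_def)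
    ultimately have "\<bar>w k x - w k y\<bar> \<le> L * norm (x - y)" "R < norm x \<Longrightarrow> w k x = 0" for x y
      using M by (blast intro: order_trans, simp add: w_def)
    then show ?thesis by blast
  qed
  have 2: "0 \<le> w k x \<and> w k x \<le> M" for k x using M by (auto simp: w_def)
  have 3: "gag s (w k) \<le> ennreal (1 + t) * gag s v + ennreal ((1 + 1 / t) * (1 / 2) ^ k)" if t: "0 < t" for k t
  proof -
    have "gag s (w k) \<le> gag s (\<phi> k)" by (rule gag_mono) (auto simp: w_def min_def)
    also have "\<phi> k = (\<lambda>x. v x + (\<phi> k x - v x))" by simp
    also have "gag s \<dots> \<le> ennreal (1 + t) * gag s v + ennreal (1 + 1 / t) * gag s (\<lambda>x. \<phi> k x - v x)"
      by (rule gag_add_le_weighted) (use t in auto)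
    also have "\<dots> \<le> ennreal (1 + t) * gag s v + ennreal (1 + 1 / t) * ennreal ((1 / 2) ^ k)"
      by (intro add_mono mult_left_mono order_refl) (simp_all add: gag_diff_commute[of s "\<phi> k"] \<phi>(2))
    finally show ?thesis using t by (simp add: ennreal_mult'')
  qed
  \<comment> \<open>The sum of the critical powers of all errors has finite integral. Its finiteness
    almost everywhere gives the pointwise limit, and together with the critical power of |v| it
    dominates, up to a constant, that of every \<phi> k; the bound M handles higher powers.\<close>
  define S where "S x = (\<Sum>k. ennreal (\<bar>v x - \<phi> k x\<bar> powr (crit_exp (real CARD('n)) s)))" for x
  have Sm[measurable]: "S \<in> borel_measurable borel" unfolding S_def by measurable
  have Sint: "(\<integral>\<^sup>+x. S x \<partial>lborel) < \<infinity>"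
  proof -
    have "(\<integral>\<^sup>+x. S x \<partial>lborel) = (\<Sum>k. Lpow (crit_exp (real CARD('n)) s) (\<lambda>x. v x - \<phi> k x))"
      unfolding S_def Lpow_def by (rule nn_integral_suminf) measurable
    also have "\<dots> \<le> (\<Sum>k. ennreal ((1 / 2) ^ k))" by (intro suminf_le \<phi>(3)) auto
    also have "\<dots> < \<infinity>" by (subst suminf_ennreal2) (auto simp: less_top)
    finally show ?thesis .
  qed
  have "AE x in lborel. S x \<noteq> \<infinity>" using Sint by (intro nn_integral_noteq_infinite) auto
  then have lim: "AE x in lborel. (\<lambda>k. w k x) \<longlonglongrightarrow> min \<bar>v x\<bar> M"
  proof eventually_elim
    case (elim x)
    then have "summable (\<lambda>k. \<bar>v x - \<phi> k x\<bar> powr (crit_exp (real CARD('n)) s))"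
      by (intro summable_suminf_not_top) (auto simp: S_def)
    then have "(\<lambda>k. \<bar>v x - \<phi> k x\<bar> powr (crit_exp (real CARD('n)) s)) \<longlonglongrightarrow> 0" by (rule summable_LIMSEQ_zero)
    then have "(\<lambda>k. (\<bar>v x - \<phi> k x\<bar> powr (crit_exp (real CARD('n)) s)) powr (1 / (crit_exp (real CARD('n)) s))) \<longlonglongrightarrow> 0 powr (1 / (crit_exp (real CARD('n)) s))"
      using crit by (intro tendsto_powr2 tendsto_const) auto
    then have "(\<lambda>k. \<bar>v x - \<phi> k x\<bar>) \<longlonglongrightarrow> 0" using crit by (simp add: powr_powr)
    then have "(\<lambda>k. v x - (v x - \<phi> k x)) \<longlonglongrightarrow> v x - 0"
      by (intro tendsto_diff tendsto_const) (simp add: tendsto_rabs_zero_iff)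
    then have "(\<lambda>k. \<phi> k x) \<longlonglongrightarrow> v x" by simp
    then show ?case unfolding w_def by (intro tendsto_intros)
  qed
  have 4: "(\<lambda>k. Lpow r (w k)) \<longlonglongrightarrow> Lpow r (\<lambda>x. min \<bar>v x\<bar> M)" if r: "(crit_exp (real CARD('n)) s) \<le> r" for r
    unfolding Lpow_def
  proof (rule nn_integral_dominated_convergence)
    let ?C = "M powr (r - (crit_exp (real CARD('n)) s)) * 2 powr (crit_exp (real CARD('n)) s)"
    show "(\<lambda>x. ennreal ?C * (ennreal (\<bar>v x\<bar> powr (crit_exp (real CARD('n)) s)) + S x)) \<in> borel_measurable lborel" by measurable
    have "(\<integral>\<^sup>+x. ennreal ?C * (ennreal (\<bar>v x\<bar> powr (crit_exp (real CARD('n)) s)) + S x) \<partial>lborel)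
        = ennreal ?C * (Lpow (crit_exp (real CARD('n)) s) v + (\<integral>\<^sup>+x. S x \<partial>lborel))"
      unfolding Lpow_def by (subst nn_integral_cmult, simp, subst nn_integral_add) auto
    then show "(\<integral>\<^sup>+x. ennreal ?C * (ennreal (\<bar>v x\<bar> powr (crit_exp (real CARD('n)) s)) + S x) \<partial>lborel) < \<infinity>"
      using Sint fv by (auto simp: finite_energy_iff ennreal_mult_less_top)
    show "AE x in lborel. ennreal (\<bar>w k x\<bar> powr r) \<le> ennreal ?C * (ennreal (\<bar>v x\<bar> powr (crit_exp (real CARD('n)) s)) + S x)" for k
    proof (rule AE_I2)
      fix x
      have "\<bar>w k x\<bar> powr r = \<bar>w k x\<bar> powr (r - (crit_exp (real CARD('n)) s)) * \<bar>w k x\<bar> powr (crit_exp (real CARD('n)) s)" by (simp add: powr_add[symmetric])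
      also have "\<dots> \<le> M powr (r - (crit_exp (real CARD('n)) s)) * \<bar>\<phi> k x\<bar> powr (crit_exp (real CARD('n)) s)"
        using 2[of k x] r crit M by (intro mult_mono powr_mono2) (auto simp: w_def)
      also have "\<bar>\<phi> k x\<bar> = \<bar>v x + - (v x - \<phi> k x)\<bar>" by simp
      also have "\<dots> powr (crit_exp (real CARD('n)) s) \<le> 2 powr (crit_exp (real CARD('n)) s) * (\<bar>v x\<bar> powr (crit_exp (real CARD('n)) s) + \<bar>- (v x - \<phi> k x)\<bar> powr (crit_exp (real CARD('n)) s))"
        using crit by (intro abs_add_powr_le) simp
      finally have "\<bar>w k x\<bar> powr r \<le> ?C * (\<bar>v x\<bar> powr (crit_exp (real CARD('n)) s) + \<bar>v x - \<phi> k x\<bar> powr (crit_exp (real CARD('n)) s))"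
        by (simp add: mult_left_mono mult.assoc abs_minus_commute)
      then have "ennreal (\<bar>w k x\<bar> powr r) \<le> ennreal (?C * (\<bar>v x\<bar> powr (crit_exp (real CARD('n)) s) + \<bar>v x - \<phi> k x\<bar> powr (crit_exp (real CARD('n)) s)))"
        by (rule ennreal_leI)
      also have "\<dots> = ennreal ?C * (ennreal (\<bar>v x\<bar> powr (crit_exp (real CARD('n)) s)) + ennreal (\<bar>v x - \<phi> k x\<bar> powr (crit_exp (real CARD('n)) s)))"
        by (simp add: ennreal_mult')
      also have "ennreal (\<bar>v x - \<phi> k x\<bar> powr (crit_exp (real CARD('n)) s)) \<le> S x"
      proof -
        have "(\<Sum>j\<in>{k}. ennreal (\<bar>v x - \<phi> j x\<bar> powr (crit_exp (real CARD('n)) s))) \<le> S x"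
          unfolding S_def by (rule sum_le_suminf) auto
        then show ?thesis by simp
      qed
      finally show "ennreal (\<bar>w k x\<bar> powr r) \<le> ennreal ?C * (ennreal (\<bar>v x\<bar> powr (crit_exp (real CARD('n)) s)) + S x)"
        by (simp add: add_left_mono mult_left_mono)
    qed
    show "AE x in lborel. (\<lambda>k. ennreal (\<bar>w k x\<bar> powr r)) \<longlonglongrightarrow> ennreal (\<bar>min \<bar>v x\<bar> M\<bar> powr r)"
      using lim
    proof eventually_elim
      case (elim x)
      then show ?case using r crit by (intro tendsto_ennrealI tendsto_powr2 tendsto_intros) auto
    qed
  qed (auto simp: w_def)
  show ?thesis by (rule that[OF 1 2 3 4])
qed

text \<open>The rearrangement applies to the Lipschitz approximants only, so the competitor arises
  as a Helly limit of their rearrangements, whose power integrals above the critical exponent are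
  those of the truncated v. Truncation gains a factor a, which the normalisation spends
  again.\<close>

lemma rearranged_competitor:
  fixes v :: "real^'n \<Rightarrow> real"
  assumes v: "v \<in> admissible s p q" and E: "energy s q v \<le> E" and M: "0 < M" "(q + 1) * E \<le> M powr (q - p)"
  obtains U :: "real^'n \<Rightarrow> real" where "rd_profile M U" "U \<in> admissible s p q" "energy s q U \<le> energy s q v"
proof -
  have vH: "v \<in> Hs_dot s" using v by (simp add: admissible_iff)
  have vL: "v \<in> Lp_space (q + 1)" using v by (simp add: admissible_iff)
  have fv: "v \<in> finite_energy s" by (rule Hs_dot_finite_energy[OF vH])
  obtain G where G: "gag s v = ennreal G" "0 \<le> G"
    using fv by (cases "gag s v") (auto simp: finite_energy_iff)
  obtain w where w: "\<And>k. \<exists>L R. (\<forall>x y. \<bar>w k x - w k y\<bar> \<le> L * norm (x - y)) \<and> (\<forall>x::real^'n. R < norm x \<longrightarrow> w k x = 0)"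
    "\<And>k x. 0 \<le> w k x \<and> w k x \<le> M"
    "\<And>k t. 0 < t \<Longrightarrow> gag s (w k) \<le> ennreal (1 + t) * gag s v + ennreal ((1 + 1 / t) * (1 / 2) ^ k)"
    "\<And>r. (crit_exp (real CARD('n)) s) \<le> r \<Longrightarrow> (\<lambda>k. Lpow r (w k)) \<longlonglongrightarrow> Lpow r (\<lambda>x. min \<bar>v x\<bar> M)"
    using truncated_approximation[OF vH M(1)] by metis
  have "\<exists>W :: real^'n \<Rightarrow> real. rd_profile M W \<and> W \<in> finite_energy s \<and> gag s W \<le> gag s (w k) \<and> (\<forall>r>0. Lpow r W = Lpow r (w k))" for k
  proof -
    obtain L R where LR: "\<And>x y. \<bar>w k x - w k y\<bar> \<le> L * norm (x - y)" "\<And>x. R < norm x \<Longrightarrow> w k x = 0"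
      using w(1)[of k] by blast
    obtain W :: "real^'n \<Rightarrow> real" where W: "radially_decreasing W" "continuous_on UNIV W" "\<And>x. 0 \<le> W x \<and> W x \<le> M"
      "\<And>x. R < norm x \<Longrightarrow> W x = 0" "gag s W \<le> gag s (w k)" "\<And>r. 0 < r \<Longrightarrow> Lpow r W = Lpow r (w k)"
      using radial_rearrangement[OF s(1) LR(1) w(2) LR(2)] by metis
    have "gag s (w k) < \<infinity>"
      by (rule le_less_trans[OF w(3)[of 1]]) (auto simp: G ennreal_mult_less_top)
    then have "gag s W < \<infinity>" using W(5) by (rule le_less_trans[rotated])
    moreover have "Lpow (crit_exp (real CARD('n)) s) W < \<infinity>"
      by (rule Lpow_finite_bounded_support[where B=M and R=R]) (use W crit in \<open>auto intro: borel_measurable_continuous_onI\<close>)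
    ultimately have "W \<in> finite_energy s"
      using borel_measurable_continuous_onI[OF W(2)] by (simp add: finite_energy_iff)
    then show ?thesis using W rd_profile_continuous[OF W(1-3)] by blast
  qed
  then obtain W :: "nat \<Rightarrow> real^'n \<Rightarrow> real" where W: "\<And>k. rd_profile M (W k)" "\<And>k. W k \<in> finite_energy s"
    "\<And>k. gag s (W k) \<le> gag s (w k)" "\<And>k r. 0 < r \<Longrightarrow> Lpow r (W k) = Lpow r (w k)" by metis
  have Wb: "gag s (W k) \<le> ennreal (2 * G + 2)" for k
  proof -
    have "gag s (W k) \<le> ennreal 2 * ennreal G + ennreal (2 * (1 / 2) ^ k)"
      using order_trans[OF W(3) w(3)[of 1 k]] by (simp add: G)
    also have "\<dots> = ennreal (2 * G + 2 * (1 / 2) ^ k)" using G by (simp add: ennreal_mult' ennreal_plus)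
    also have "\<dots> \<le> ennreal (2 * G + 2)" by (intro ennreal_leI) (simp add: power_le_one)
    finally show ?thesis .
  qed
  obtain k and u :: "real^'n \<Rightarrow> real" where k: "strict_mono (k :: nat \<Rightarrow> nat)" and u: "rd_profile M u" "u \<in> finite_energy s"
    "gag s u \<le> liminf (\<lambda>j. gag s (W (k j)))" and Lu: "\<And>r. (crit_exp (real CARD('n)) s) < r \<Longrightarrow> (\<lambda>j. Lpow r (W (k j))) \<longlonglongrightarrow> Lpow r u"
    by (rule rd_profile_compactness[OF s W(1,2) Wb]) (rule that)
  have L: "Lpow r u = Lpow r (\<lambda>x. min \<bar>v x\<bar> M)" if r: "(crit_exp (real CARD('n)) s) < r" for r
  proof (rule LIMSEQ_unique[OF Lu[OF r]])
    have "(\<lambda>j. Lpow r (w (k j))) \<longlonglongrightarrow> Lpow r (\<lambda>x. min \<bar>v x\<bar> M)"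
    proof -
      have "(\<lambda>k. Lpow r (w k)) \<longlonglongrightarrow> Lpow r (\<lambda>x. min \<bar>v x\<bar> M)" using r by (intro w(4)) simp
      from LIMSEQ_subseq_LIMSEQ[OF this k] show ?thesis by (simp only: o_def)
    qed
    then show "(\<lambda>j. Lpow r (W (k j))) \<longlonglongrightarrow> Lpow r (\<lambda>x. min \<bar>v x\<bar> M)"
      using W(4) r crit by simp
  qed
  \<comment> \<open>For fixed t the error term (1 + 1/t) (1/2)^(k j) disappears along the
    subsequence; only afterwards is t sent to 0.\<close>
  have gt: "gag s u \<le> ennreal ((1 + t) * G)" if t: "0 < t" for t
  proof -
    have "(\<lambda>j. ennreal ((1 + t) * G + (1 + 1 / t) * (1 / 2) ^ k j)) \<longlonglongrightarrow> ennreal ((1 + t) * G + (1 + 1 / t) * 0)"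
    proof (intro tendsto_ennrealI tendsto_intros)
      have "(\<lambda>j. (1 / 2 :: real) ^ j) \<longlonglongrightarrow> 0" by (rule LIMSEQ_power_zero) simp
      from LIMSEQ_subseq_LIMSEQ[OF this k] show "(\<lambda>j. (1 / 2 :: real) ^ k j) \<longlonglongrightarrow> 0" by (simp add: o_def)
    qed
    then have "liminf (\<lambda>j. ennreal ((1 + t) * G + (1 + 1 / t) * (1 / 2) ^ k j)) = ennreal ((1 + t) * G)"
      using lim_imp_Liminf[of sequentially "\<lambda>j. ennreal ((1 + t) * G + (1 + 1 / t) * (1 / 2) ^ k j)"] by simp
    moreover have "gag s (W (k j)) \<le> ennreal ((1 + t) * G + (1 + 1 / t) * (1 / 2) ^ k j)" for j
    proof -
      have "gag s (W (k j)) \<le> ennreal (1 + t) * ennreal G + ennreal ((1 + 1 / t) * (1 / 2) ^ k j)"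
        using order_trans[OF W(3) w(3)[OF t]] by (simp add: G)
      also have "\<dots> = ennreal ((1 + t) * G + (1 + 1 / t) * (1 / 2) ^ k j)"
        using t G by (subst ennreal_plus) (auto simp: ennreal_mult)
      finally show ?thesis .
    qed
    then have "liminf (\<lambda>j. gag s (W (k j))) \<le> liminf (\<lambda>j. ennreal ((1 + t) * G + (1 + 1 / t) * (1 / 2) ^ k j))"
      by (intro Liminf_mono always_eventually allI)
    ultimately show ?thesis using u(3) by simp
  qed
  obtain Gu where Gu: "gag s u = ennreal Gu" "0 \<le> Gu"
    using u(2) by (cases "gag s u") (auto simp: finite_energy_iff)
  have "Gu \<le> G"
  proof (rule field_le_epsilon)
    fix e :: real assume e: "0 < e"
    \<comment> \<open>The denominator G + 1 keeps t G below e and the choice of t legitimate when G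
      = 0.\<close>
    have "Gu \<le> (1 + e / (G + 1)) * G" using gt[of "e / (G + 1)"] Gu G e by simp
    also have "\<dots> = G + e * (G / (G + 1))" by (simp add: algebra_simps)
    also have "e * (G / (G + 1)) \<le> e * 1" using e G by (intro mult_left_mono) auto
    finally show "Gu \<le> G + e" by simp
  qed
  then have gu: "gag s u \<le> gag s v" using Gu G by (simp add: ennreal_leI)
  obtain a where a: "0 < a" "a \<le> 1" "Lpow (p + 1) (\<lambda>x. min \<bar>v x\<bar> M) = ennreal a"
    "ennreal (1 / 2) * gag s v + ennreal (1 / (q + 1)) * Lpow (q + 1) (\<lambda>x. min \<bar>v x\<bar> M)
      \<le> ennreal a * ennreal (energy s q v)" using truncation_energy[OF v E M] by metis
  have "Lpow (p + 1) u = ennreal a" using L[of "p + 1"] a crit by simp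
  from rd_profile_normalise[OF u(1,2) this a(1,2)] obtain U :: "real^'n \<Rightarrow> real" where
    U: "rd_profile M U" "U \<in> admissible s p q" "energy_nn s q U \<le> ennreal (1 / a) * energy_nn s q u" by metis
  have "energy_nn s q u \<le> ennreal a * ennreal (energy s q v)"
    unfolding energy_nn_def L[OF crit(3)] using gu
    by (intro order_trans[OF _ a(4)] add_mono mult_left_mono) auto
  then have "ennreal (1 / a) * energy_nn s q u \<le> ennreal (1 / a) * (ennreal a * ennreal (energy s q v))"
    by (rule mult_left_mono) simp
  also have "\<dots> = ennreal (energy s q v)"
    using a energy_eq(2)[OF fv vL] by (simp add: ennreal_mult'[symmetric])
  finally have "energy_nn s q U \<le> ennreal (energy s q v)" using U(3) by (rule order_trans[rotated])
  moreover have "ennreal (energy s q U) = energy_nn s q U"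
    using U(2) by (intro energy_eq) (auto simp: admissible_iff Hs_dot_finite_energy)
  ultimately have "energy s q U \<le> energy s q v"
    using energy_eq(2)[OF fv vL] by (metis ennreal_le_iff)
  then show ?thesis using that U by blast
qed

lemma admissible_nonempty: "(admissible s p q :: (real^'n \<Rightarrow> real) set) \<noteq> {}"
proof -
  let ?b = "bump :: real^'n \<Rightarrow> real"
  have p1: "p + 1 > 0" using crit by simp
  obtain B where B: "Lpow (p + 1) ?b = ennreal B" "0 \<le> B"
    using test_function_finite_Lpow[of ?b "p + 1"] bump_test p1 by (cases "Lpow (p + 1) ?b") auto
  have "B \<noteq> 0"
  proof
    assume "B = 0"
    then have z: "AE x in lborel. ?b x = 0" using B(1) Lpow_eq_0_iff[of ?b "p + 1"] by simp
    have "?b 0 = 0" by (rule continuous_AE_zero[OF test_function_continuous[OF bump_test] z])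
    then show False using bump_pos_iff[of "0::real^'n"] by simp
  qed
  then have B0: "B > 0" using B(2) by simp
  define c where "c = B powr - (1 / (p + 1))"
  have "Lpow (p + 1) (\<lambda>x. c * ?b x) = ennreal (\<bar>c\<bar> powr (p + 1)) * ennreal B"
    by (simp add: Lpow_cmult B)
  also have "\<bar>c\<bar> powr (p + 1) = B powr - 1" using p1 by (simp add: c_def powr_powr)
  also have "B powr - 1 = 1 / B" using B0 by (simp add: powr_minus_divide)
  also have "ennreal (1 / B) * ennreal B = 1" using B0 by (simp add: ennreal_mult'[symmetric])
  finally have "(\<lambda>x. c * ?b x) \<in> admissible s p q"
    using test_function_Hs_dot[OF test_function_cmult[OF bump_test]] by (simp add: admissible_iff)
  then show ?thesis by blast
qed

lemma minimiser_exists: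
  obtains u :: "real^'n \<Rightarrow> real" and M where "rd_profile M u" "u \<in> admissible s p q"
    "\<And>v :: real^'n \<Rightarrow> real. v \<in> admissible s p q \<Longrightarrow> energy s q u \<le> energy s q v"
proof -
  let ?A = "admissible s p q :: (real^'n \<Rightarrow> real) set"
  have fe: "v \<in> finite_energy s" and Lq: "v \<in> Lp_space (q + 1)" if "v \<in> ?A" for v
    using that by (auto simp: admissible_iff Hs_dot_finite_energy)
  have q1: "q + 1 > 0" using crit by simp
  have e0: "0 \<le> energy s q v" if "v \<in> ?A" for v using energy_eq(2)[OF fe[OF that] Lq[OF that]] .
  define K where "K = (INF v\<in>?A. energy s q v)"
  have bdd: "bdd_below (energy s q ` ?A)" using e0 by (auto intro!: bdd_belowI[of _ 0])
  have K0: "0 \<le> K" unfolding K_def using e0 by (intro cINF_greatest admissible_nonempty)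
  have "\<exists>v\<in>?A. energy s q v < K + 1 / real (Suc n)" for n
    using admissible_nonempty cInf_lessD[of "energy s q ` ?A" "K + 1 / real (Suc n)"] by (auto simp: K_def)
  then obtain v where v: "\<And>n. v n \<in> ?A" "\<And>n. energy s q (v n) < K + 1 / real (Suc n)" by metis
  have v1: "energy s q (v n) \<le> K + 1" for n
  proof -
    have "1 / real (Suc n) \<le> 1" by simp
    then show ?thesis using v(2)[of n] by linarith
  qed
  \<comment> \<open>All chosen near-minimisers have energy at most K + 1, and this M meets the
    truncation condition for that bound with equality, so one level serves the whole
    sequence.\<close>
  define M where "M = ((q + 1) * (K + 1)) powr (1 / (q - p))"
  have M: "0 < M" "(q + 1) * (K + 1) \<le> M powr (q - p)"
    using q1 K0 pq by (auto simp: M_def powr_powr)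
  have "\<exists>U. rd_profile M U \<and> U \<in> ?A \<and> energy s q U \<le> energy s q (v n)" for n
    using rearranged_competitor[OF v(1) v1 M] by metis
  then obtain U where U: "\<And>n. rd_profile M (U n)" "\<And>n. U n \<in> ?A" "\<And>n. energy s q (U n) \<le> energy s q (v n)" by metis
  have Ulim: "(\<lambda>n. energy s q (U n)) \<longlonglongrightarrow> K"
  proof (rule tendsto_sandwich[OF _ _ tendsto_const])
    have "(\<lambda>n. K + 1 / real (Suc n)) \<longlonglongrightarrow> K + 0"
      by (intro tendsto_intros LIMSEQ_Suc[OF lim_1_over_n])
    then show "(\<lambda>n. K + 1 / real (Suc n)) \<longlonglongrightarrow> K" by simp
    show "\<forall>\<^sub>F n in sequentially. K \<le> energy s q (U n)"
      unfolding K_def by (intro always_eventually allI cINF_lower bdd U)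
    show "\<forall>\<^sub>F n in sequentially. energy s q (U n) \<le> K + 1 / real (Suc n)"
      using U(3) v(2) by (intro always_eventually allI) (meson less_imp_le order_trans)
  qed
  define b where "b n = (LINT x|lborel. \<bar>U n x\<bar> powr (q + 1))" for n
  have b: "Lpow (q + 1) (U n) = ennreal (b n)" "0 \<le> b n" for n
    using integral_Lpow[OF Lq[OF U(2)]] by (auto simp: b_def)
  define g where "g n = gagliardo_form s (U n) (U n)" for n
  have g: "gag s (U n) = ennreal (g n)" "0 \<le> g n" for n
    using fe[OF U(2)[of n]] by (auto simp: g_def gagliardo_form_gag gagliardo_form_nonneg finite_energy_iff)
  have en: "energy s q (U n) = 1 / 2 * g n + 1 / (q + 1) * b n" for n by (simp add: energy_def g_def b_def)
  have gK: "gag s (U n) \<le> ennreal (2 * (K + 1))" for n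
  proof -
    have "0 \<le> 1 / (q + 1) * b n" using q1 b by simp
    then have "1 / 2 * g n \<le> energy s q (U n)" unfolding en by simp
    also have "\<dots> \<le> K + 1" using U(3) v1 by (rule order_trans)
    finally have "g n \<le> 2 * (K + 1)" by simp
    then show ?thesis using g by (simp add: ennreal_leI)
  qed
  obtain k and u :: "real^'n \<Rightarrow> real" where k: "strict_mono (k :: nat \<Rightarrow> nat)" and u: "rd_profile M u" "u \<in> finite_energy s"
    "gag s u \<le> liminf (\<lambda>j. gag s (U (k j)))" and Lu: "\<And>r. (crit_exp (real CARD('n)) s) < r \<Longrightarrow> (\<lambda>j. Lpow r (U (k j))) \<longlonglongrightarrow> Lpow r u"
    by (rule rd_profile_compactness[OF s U(1) fe[OF U(2)] gK]) (rule that)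
  have "(\<lambda>j. Lpow (p + 1) (U (k j))) = (\<lambda>j. 1)" using U(2) by (auto simp: admissible_iff)
  then have "Lpow (p + 1) u = 1" using Lu[OF crit(2)] by (simp add: LIMSEQ_const_iff)
  then have uA: "u \<in> ?A" using rd_profile_admissible[OF u(1,2)] by (simp add: admissible_iff)
  define B where "B = (LINT x|lborel. \<bar>u x\<bar> powr (q + 1))"
  have B: "Lpow (q + 1) u = ennreal B" "0 \<le> B" using integral_Lpow[OF Lq[OF uA]] by (auto simp: B_def)
  have "(\<lambda>j. ennreal (b (k j))) \<longlonglongrightarrow> ennreal B" using Lu[OF crit(3)] by (simp add: b B)
  then have blim: "(\<lambda>j. b (k j)) \<longlonglongrightarrow> B" using b B by (subst (asm) tendsto_ennreal_iff) auto
  have "(\<lambda>j. energy s q (U (k j))) \<longlonglongrightarrow> K" using LIMSEQ_subseq_LIMSEQ[OF Ulim k] by (simp add: o_def)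
  \<comment> \<open>The energy and its L^(q+1) part converge, hence so does the Gagliardo part. The
    limit inferior becomes an explicit number, and lower semicontinuity bounds the energy of u by
    K.\<close>
  then have "(\<lambda>j. 2 * (energy s q (U (k j)) - 1 / (q + 1) * b (k j))) \<longlonglongrightarrow> 2 * (K - 1 / (q + 1) * B)"
    by (intro tendsto_intros blim)
  then have glim: "(\<lambda>j. g (k j)) \<longlonglongrightarrow> 2 * (K - 1 / (q + 1) * B)" by (simp add: en)
  then have "(\<lambda>j. ennreal (g (k j))) \<longlonglongrightarrow> ennreal (2 * (K - 1 / (q + 1) * B))" by (rule tendsto_ennrealI)
  then have "liminf (\<lambda>j. gag s (U (k j))) = ennreal (2 * (K - 1 / (q + 1) * B))"
    unfolding g by (intro lim_imp_Liminf) auto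
  then have "ennreal (gagliardo_form s u u) \<le> ennreal (2 * (K - 1 / (q + 1) * B))"
    using u by (simp add: gagliardo_form_gag finite_energy_iff)
  moreover have "0 \<le> 2 * (K - 1 / (q + 1) * B)"
    by (rule LIMSEQ_le_const[OF glim]) (use g in auto)
  ultimately have "gagliardo_form s u u \<le> 2 * (K - 1 / (q + 1) * B)" by (simp add: ennreal_le_iff)
  then have "energy s q u \<le> K" by (simp add: energy_def B_def)
  then have min: "energy s q u \<le> energy s q v" if "v \<in> ?A" for v
    using cINF_lower[OF bdd that] by (simp add: K_def)
  show ?thesis by (rule that[OF u(1) uA min])
qed

end

section \<open>The Gagliardo form\<close>

lemma gagliardo_form_commute: "gagliardo_form s u v = gagliardo_form s v u"
proof -
  have "gagliardo_integrand s u v = gagliardo_integrand s v u"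
    by (auto simp: gagliardo_integrand_def mult.commute)
  then show ?thesis by (simp add: gagliardo_form_def)
qed

lemma abs_mult_le_weighted:
  fixes a b :: real
  assumes "0 < t"
  shows "\<bar>a * b\<bar> \<le> t * a\<^sup>2 + b\<^sup>2 / t"
proof -
  have "0 \<le> (t * \<bar>a\<bar> - \<bar>b\<bar>)\<^sup>2 / t" using assms by simp
  also have "\<dots> = t * a\<^sup>2 + b\<^sup>2 / t - 2 * \<bar>a * b\<bar>"
    using assms by (simp add: power2_eq_square abs_mult field_simps)
  finally show ?thesis using abs_ge_zero[of "a * b"] by linarith
qed

lemma gagliardo_integrand_le:
  assumes "0 < t"
  shows "\<bar>gagliardo_integrand s u v z\<bar> \<le> t * gagliardo_integrand s u u z + gagliardo_integrand s v v z / t"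
proof -
  obtain x y where z: "z = (x, y)" by (cases z)
  let ?d = "norm (x - y) powr (real CARD('a) + 2 * s)"
  have "\<bar>(u x - u y) * (v x - v y)\<bar> / ?d \<le> (t * (u x - u y)\<^sup>2 + (v x - v y)\<^sup>2 / t) / ?d"
    by (intro divide_right_mono abs_mult_le_weighted assms) simp
  then show ?thesis
    by (simp add: z gagliardo_integrand_def power2_eq_square abs_divide add_divide_distrib mult.commute)
qed

lemma integrable_gagliardo:
  fixes u v :: "real^'n \<Rightarrow> real"
  assumes u[measurable]: "u \<in> borel_measurable borel" and v[measurable]: "v \<in> borel_measurable borel"
    and fin: "gag s u < \<infinity>" "gag s v < \<infinity>"
  shows "integrable (lborel \<Otimes>\<^sub>M lborel) (gagliardo_integrand s u v)"
proof (rule Bochner_Integration.integrable_bound)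
  show "integrable (lborel \<Otimes>\<^sub>M lborel) (\<lambda>z. gagliardo_integrand s u u z + gagliardo_integrand s v v z)"
    using fin integrable_gag_iff[OF u] integrable_gag_iff[OF v] by (intro Bochner_Integration.integrable_add) auto
  show "AE z in lborel \<Otimes>\<^sub>M lborel. norm (gagliardo_integrand s u v z)
      \<le> norm (gagliardo_integrand s u u z + gagliardo_integrand s v v z)"
    using gagliardo_integrand_le[of 1 s u v] gagliardo_integrand_nonneg[of s u] gagliardo_integrand_nonneg[of s v]
    by (intro AE_I2) (simp add: add_nonneg_nonneg)
qed measurable

lemma gagliardo_form_add_right:
  fixes u v w :: "real^'n \<Rightarrow> real"
  assumes "u \<in> borel_measurable borel" "v \<in> borel_measurable borel" "w \<in> borel_measurable borel"
    and "gag s u < \<infinity>" "gag s v < \<infinity>" "gag s w < \<infinity>"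
  shows "gagliardo_form s u (\<lambda>x. v x + c * w x) = gagliardo_form s u v + c * gagliardo_form s u w"
proof -
  have "gagliardo_integrand s u (\<lambda>x. v x + c * w x)
      = (\<lambda>z. gagliardo_integrand s u v z + c * gagliardo_integrand s u w z)"
    by (rule ext) (auto simp: gagliardo_integrand_def add_divide_distrib[symmetric] algebra_simps)
  then show ?thesis
    unfolding gagliardo_form_def
    using integrable_gagliardo[OF assms(1,2,4,5)] integrable_gagliardo[OF assms(1,3,4,6)] by simp
qed

lemma gag_add_cmult_finite:
  fixes u v :: "real^'n \<Rightarrow> real"
  assumes [measurable]: "u \<in> borel_measurable borel" "v \<in> borel_measurable borel"
    and fin: "gag s u < \<infinity>" "gag s v < \<infinity>"
  shows "gag s (\<lambda>x. u x + c * v x) < \<infinity>"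
proof -
  have "gag s (\<lambda>x. u x + c * v x) \<le> 2 * gag s u + 2 * gag s (\<lambda>x. c * v x)"
    by (rule gag_add_le) measurable
  also have "\<dots> < \<infinity>" using fin by (simp add: gag_cmult ennreal_mult_less_top)
  finally show ?thesis .
qed

lemma gagliardo_form_expand:
  fixes u v :: "real^'n \<Rightarrow> real"
  assumes u: "u \<in> borel_measurable borel" and v: "v \<in> borel_measurable borel"
    and fu: "gag s u < \<infinity>" and fv: "gag s v < \<infinity>"
  shows "gagliardo_form s (\<lambda>x. u x + c * v x) (\<lambda>x. u x + c * v x)
    = gagliardo_form s u u + 2 * c * gagliardo_form s u v + c\<^sup>2 * gagliardo_form s v v"
proof -
  let ?w = "\<lambda>x. u x + c * v x"
  have w: "?w \<in> borel_measurable borel" using u v by simp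
  have fw: "gag s ?w < \<infinity>" by (rule gag_add_cmult_finite[OF u v fu fv])
  have 1: "gagliardo_form s u ?w = gagliardo_form s u u + c * gagliardo_form s u v"
    by (rule gagliardo_form_add_right[OF u u v fu fu fv])
  have 2: "gagliardo_form s v ?w = gagliardo_form s v u + c * gagliardo_form s v v"
    by (rule gagliardo_form_add_right[OF v u v fv fu fv])
  have "gagliardo_form s ?w ?w = gagliardo_form s ?w u + c * gagliardo_form s ?w v"
    by (rule gagliardo_form_add_right[OF w u v fw fu fv])
  also have "gagliardo_form s ?w u = gagliardo_form s u u + c * gagliardo_form s u v"
    using 1 gagliardo_form_commute[of s ?w u] by (rule trans[rotated])
  also have "gagliardo_form s ?w v = gagliardo_form s u v + c * gagliardo_form s v v"
    using 2 gagliardo_form_commute[of s ?w v] gagliardo_form_commute[of s v u] by (simp only:)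
  finally show ?thesis by (simp add: power2_eq_square algebra_simps)
qed

text \<open>A weighted form of Cauchy-Schwarz: with t tied to the energy of v, the bound vanishes as
  that energy tends to zero.\<close>

lemma gagliardo_form_bound:
  fixes u v :: "real^'n \<Rightarrow> real"
  assumes u: "u \<in> borel_measurable borel" and v: "v \<in> borel_measurable borel"
    and fu: "gag s u < \<infinity>" and fv: "gag s v < \<infinity>" and t: "0 < t"
  shows "\<bar>gagliardo_form s u v\<bar> \<le> t * gagliardo_form s u u + gagliardo_form s v v / t"
proof -
  note i = integrable_gagliardo[OF u v fu fv] integrable_gagliardo[OF u u fu fu] integrable_gagliardo[OF v v fv fv]
  have "\<bar>gagliardo_form s u v\<bar> \<le> (LINT z|(lborel \<Otimes>\<^sub>M lborel). \<bar>gagliardo_integrand s u v z\<bar>)"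
    unfolding gagliardo_form_def by (rule integral_abs_bound)
  also have "\<dots> \<le> (LINT z|(lborel \<Otimes>\<^sub>M lborel). t * gagliardo_integrand s u u z + gagliardo_integrand s v v z / t)"
    using i by (intro integral_mono gagliardo_integrand_le t) auto
  also have "\<dots> = t * gagliardo_form s u u + gagliardo_form s v v / t"
    unfolding gagliardo_form_def using i by simp
  finally show ?thesis .
qed

text \<open>The change of variables is needed for the quadratic form only, where it is known in
  \<open>ennreal\<close>; expanding the form of u + v transfers the scaling to the mixed
  term.\<close>

lemma gagliardo_form_dilate:
  fixes u v :: "real^'n \<Rightarrow> real"
  assumes u: "u \<in> borel_measurable borel" and v: "v \<in> borel_measurable borel"
    and fu: "gag s u < \<infinity>" and fv: "gag s v < \<infinity>" and c: "0 < c"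
  shows "gagliardo_form s (\<lambda>x. u (c *\<^sub>R x)) (\<lambda>x. v (c *\<^sub>R x))
    = c powr - (real CARD('n) - 2 * s) * gagliardo_form s u v"
proof -
  let ?k = "c powr - (real CARD('n) - 2 * s)"
  have diag: "gagliardo_form s (\<lambda>x. w (c *\<^sub>R x)) (\<lambda>x. w (c *\<^sub>R x)) = ?k * gagliardo_form s w w"
    if [measurable]: "w \<in> borel_measurable borel" and fw: "gag s w < \<infinity>" for w :: "real^'n \<Rightarrow> real"
  proof -
    have "gag s (\<lambda>x. w (c *\<^sub>R x)) = ennreal ?k * gag s w" by (rule gag_dilate[OF that(1) c])
    moreover have "gag s (\<lambda>x. w (c *\<^sub>R x)) < \<infinity>" using calculation fw by (simp add: ennreal_mult_less_top)
    ultimately have "ennreal (gagliardo_form s (\<lambda>x. w (c *\<^sub>R x)) (\<lambda>x. w (c *\<^sub>R x))) = ennreal (?k * gagliardo_form s w w)"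
      using fw by (simp add: gagliardo_form_gag ennreal_mult')
    then show ?thesis by (simp add: gagliardo_form_nonneg)
  qed
  let ?u = "\<lambda>x. u (c *\<^sub>R x)" and ?v = "\<lambda>x. v (c *\<^sub>R x)"
  have m: "?u \<in> borel_measurable borel" "?v \<in> borel_measurable borel" using u v by simp_all
  have f: "gag s ?u < \<infinity>" "gag s ?v < \<infinity>"
    using fu fv gag_dilate[OF u c, of s] gag_dilate[OF v c, of s] by (simp_all add: ennreal_mult_less_top)
  have "gagliardo_form s (\<lambda>x. ?u x + 1 * ?v x) (\<lambda>x. ?u x + 1 * ?v x)
      = ?k * gagliardo_form s (\<lambda>x. u x + 1 * v x) (\<lambda>x. u x + 1 * v x)"
    by (rule diag[of "\<lambda>x. u x + 1 * v x"]) (use u v gag_add_cmult_finite[OF u v fu fv, of 1] in auto)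
  then show ?thesis
    unfolding gagliardo_form_expand[OF m f] gagliardo_form_expand[OF u v fu fv] diag[OF u fu] diag[OF v fv]
    by (simp add: algebra_simps)
qed

lemma integral_lborel_dilate:
  fixes f :: "'a::euclidean_space \<Rightarrow> real"
  assumes [measurable]: "f \<in> borel_measurable borel" and c: "0 < c"
  shows "(LINT x|lborel. f (c *\<^sub>R x)) = c powr - real DIM('a) * (LINT x|lborel. f x)"
proof -
  have "(LINT x|lborel. f x) = (LINT x|density (distr lborel borel (\<lambda>x. 0 + c *\<^sub>R x))
      (\<lambda>_. ennreal (\<bar>c\<bar> ^ DIM('a))). f x)"
    using lborel_affine[of c "0::'a"] c by simp
  also have "\<dots> = (LINT x|distr lborel borel (\<lambda>x. 0 + c *\<^sub>R x). \<bar>c\<bar> ^ DIM('a) *\<^sub>R f x)"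
    by (rule integral_density) (use c in auto)
  also have "\<dots> = (LINT x|lborel. \<bar>c\<bar> ^ DIM('a) *\<^sub>R f (0 + c *\<^sub>R x))"
    by (rule integral_distr) auto
  also have "\<dots> = c ^ DIM('a) * (LINT x|lborel. f (c *\<^sub>R x))" using c by simp
  finally show ?thesis using c by (simp add: powr_minus powr_realpow)
qed

section \<open>The Euler--Lagrange equation\<close>

lemma DERIV_abs_powr:
  assumes r: "1 < r"
  shows "((\<lambda>z. \<bar>z\<bar> powr r) has_real_derivative r * \<bar>z\<bar> powr (r - 1) * sgn z) (at z)"
proof -
  consider "z > 0" | "z < 0" | "z = 0" by linarith
  then show ?thesis
  proof cases
    case 1
    have "((\<lambda>z. z powr r) has_real_derivative r * \<bar>z\<bar> powr (r - 1) * sgn z) (at z)"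
      using 1 has_real_derivative_powr[of z r] by simp
    moreover have "eventually (\<lambda>z. z powr r = \<bar>z\<bar> powr r) (nhds z)"
      using eventually_nhds_in_open[of "{0<..}" z] 1 by (auto elim!: eventually_mono)
    ultimately show ?thesis by (subst DERIV_cong_ev[OF refl _ refl, symmetric])
  next
    case 2
    have "((\<lambda>z. (- z) powr r) has_real_derivative r * \<bar>z\<bar> powr (r - 1) * sgn z) (at z)"
      using DERIV_chain2[OF has_real_derivative_powr[of "- z" r] DERIV_minus[OF DERIV_ident]] 2 by simp
    moreover have "eventually (\<lambda>z. (- z) powr r = \<bar>z\<bar> powr r) (nhds z)"
      using eventually_nhds_in_open[of "{..<0}" z] 2 by (auto elim!: eventually_mono)
    ultimately show ?thesis by (subst DERIV_cong_ev[OF refl _ refl, symmetric])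
  next
    case 3
    have "((\<lambda>h::real. \<bar>h\<bar> powr (r - 1)) \<longlongrightarrow> \<bar>0\<bar> powr (r - 1)) (at 0)"
      using r by (intro tendsto_powr2 tendsto_intros) auto
    then have "((\<lambda>h::real. \<bar>h\<bar> powr (r - 1)) \<longlongrightarrow> 0) (at 0)" using r by simp
    moreover have "norm ((\<bar>h\<bar> powr r - \<bar>0\<bar> powr r) / (h - 0)) = \<bar>h\<bar> powr (r - 1)" if "h \<noteq> 0" for h :: real
      using that r by (simp add: powr_diff)
    ultimately have "((\<lambda>h::real. norm ((\<bar>h\<bar> powr r - \<bar>0\<bar> powr r) / (h - 0))) \<longlongrightarrow> 0) (at 0)"
      by (subst tendsto_cong[where g="\<lambda>h. \<bar>h\<bar> powr (r - 1)"]) (auto simp: eventually_at_filter)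
    then have "((\<lambda>h::real. (\<bar>h\<bar> powr r - \<bar>0\<bar> powr r) / (h - 0)) \<longlongrightarrow> 0) (at 0)"
      by (simp only: tendsto_norm_zero_iff)
    then show ?thesis using 3 by (simp add: has_field_derivative_iff)
  qed
qed

lemma abs_powr_Lipschitz:
  fixes x y C :: real
  assumes r: "1 < r" and xy: "\<bar>x\<bar> \<le> C" "\<bar>y\<bar> \<le> C"
  shows "\<bar>\<bar>x\<bar> powr r - \<bar>y\<bar> powr r\<bar> \<le> r * C powr (r - 1) * \<bar>x - y\<bar>"
proof -
  have "norm (\<bar>x\<bar> powr r - \<bar>y\<bar> powr r) \<le> r * C powr (r - 1) * norm (x - y)"
  proof (rule field_differentiable_bound[where S="{- C..C}" and f="\<lambda>z. \<bar>z\<bar> powr r"])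
    show "((\<lambda>z. \<bar>z\<bar> powr r) has_field_derivative r * \<bar>z\<bar> powr (r - 1) * sgn z) (at z within {- C..C})" for z
      by (rule has_field_derivative_at_within[OF DERIV_abs_powr[OF r]])
    show "norm (r * \<bar>z\<bar> powr (r - 1) * sgn z) \<le> r * C powr (r - 1)" if "z \<in> {- C..C}" for z
    proof -
      have "\<bar>z\<bar> powr (r - 1) * \<bar>sgn z\<bar> \<le> C powr (r - 1) * 1"
        using that r by (intro mult_mono powr_mono2) (auto simp: abs_sgn_eq)
      then show ?thesis using r by (simp add: abs_mult mult.assoc)
    qed
  qed (use xy in auto)
  then show ?thesis by simp
qed

text \<open>Boundedness of u and \<phi> makes |u + t \<phi>|^r Lipschitz in t for |t| < 1, with a
  constant proportional to |\<phi>|, which is an integrable majorant for the difference quotients.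
  The absolute value stays because u + t \<phi> may change sign.\<close>

lemma DERIV_integral_abs_powr:
  fixes u \<phi> :: "real^'n \<Rightarrow> real"
  assumes [measurable]: "u \<in> borel_measurable borel" and u: "\<And>x. 0 \<le> u x \<and> u x \<le> M"
    and fin: "Lpow r u < \<infinity>" and r: "1 < r" and \<phi>: "\<phi> \<in> test_functions"
  shows "((\<lambda>t. LINT x|lborel. \<bar>u x + t * \<phi> x\<bar> powr r) has_real_derivative
    r * (LINT x|lborel. u x powr (r - 1) * \<phi> x)) (at 0)"
proof -
  note [measurable] = test_function_measurable[OF \<phi>]
  obtain B where B: "B > 0" "\<And>x. \<bar>\<phi> x\<bar> \<le> B" using test_function_bounded[OF \<phi>] by metis
  obtain R where R: "\<And>x. R < norm x \<Longrightarrow> \<phi> x = 0" using \<phi> unfolding test_functions_iff by blast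
  have i\<phi>: "integrable lborel \<phi>" by (rule integrable_bounded_support[OF _ B(2) R]) simp
  have it: "integrable lborel (\<lambda>x. \<bar>u x + t * \<phi> x\<bar> powr r)" for t
  proof -
    have "Lpow r (\<lambda>x. u x + t * \<phi> x) \<le> ennreal (2 powr r) * (Lpow r u + Lpow r (\<lambda>x. t * \<phi> x))"
      using r by (intro Lpow_add_le) auto
    also have "\<dots> < \<infinity>"
      using fin test_function_finite_Lpow[OF \<phi>, of r] r by (simp add: Lpow_cmult ennreal_mult_less_top)
    finally show ?thesis by (subst integrable_Lpow_iff) auto
  qed
  let ?q = "\<lambda>t x. (\<bar>u x + t * \<phi> x\<bar> powr r - \<bar>u x\<bar> powr r) / t"
  have "(\<lambda>i. LINT x|lborel. ?q (X i) x) \<longlonglongrightarrow> (LINT x|lborel. r * u x powr (r - 1) * \<phi> x)"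
    if X: "\<And>i. X i \<in> {- 1<..<1} - {0}" "X \<longlonglongrightarrow> 0" for X
  proof (rule integral_dominated_convergence[where w="\<lambda>x. r * (M + B) powr (r - 1) * \<bar>\<phi> x\<bar>"])
    show "integrable lborel (\<lambda>x. r * (M + B) powr (r - 1) * \<bar>\<phi> x\<bar>)" using i\<phi> by simp
    show "AE x in lborel. (\<lambda>i. ?q (X i) x) \<longlonglongrightarrow> r * u x powr (r - 1) * \<phi> x"
    proof (rule AE_I2)
      fix x
      have "((\<lambda>t. \<bar>u x + t * \<phi> x\<bar> powr r) has_real_derivative r * \<bar>u x + 0 * \<phi> x\<bar> powr (r - 1) * sgn (u x + 0 * \<phi> x) * \<phi> x) (at 0)"
        by (rule DERIV_chain2[OF DERIV_abs_powr[OF r]]) (auto intro!: derivative_eq_intros)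
      also have "r * \<bar>u x + 0 * \<phi> x\<bar> powr (r - 1) * sgn (u x + 0 * \<phi> x) * \<phi> x = r * u x powr (r - 1) * \<phi> x"
        using u[of x] by (cases "u x = 0") auto
      finally have "((\<lambda>t. ?q t x) \<longlongrightarrow> r * u x powr (r - 1) * \<phi> x) (at 0)"
        by (simp add: has_field_derivative_iff)
      then show "(\<lambda>i. ?q (X i) x) \<longlonglongrightarrow> r * u x powr (r - 1) * \<phi> x"
        using X unfolding tendsto_at_iff_sequentially o_def by auto
    qed
    show "AE x in lborel. norm (?q (X i) x) \<le> r * (M + B) powr (r - 1) * \<bar>\<phi> x\<bar>" for i
    proof (rule AE_I2)
      fix x
      have X1: "\<bar>X i\<bar> \<le> 1" "X i \<noteq> 0" using X(1)[of i] by auto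
      have "\<bar>X i * \<phi> x\<bar> \<le> 1 * B" unfolding abs_mult using X1 B by (intro mult_mono) auto
      then have "\<bar>u x + X i * \<phi> x\<bar> \<le> M + B" "\<bar>u x\<bar> \<le> M + B" using u[of x] B(1) by linarith+
      then have "\<bar>\<bar>u x + X i * \<phi> x\<bar> powr r - \<bar>u x\<bar> powr r\<bar> \<le> r * (M + B) powr (r - 1) * \<bar>(u x + X i * \<phi> x) - u x\<bar>"
        by (rule abs_powr_Lipschitz[OF r])
      also have "\<dots> = \<bar>X i\<bar> * (r * (M + B) powr (r - 1) * \<bar>\<phi> x\<bar>)" by (simp add: abs_mult)
      finally show "norm (?q (X i) x) \<le> r * (M + B) powr (r - 1) * \<bar>\<phi> x\<bar>"
        using X1 by (simp add: abs_divide pos_divide_le_eq mult.commute)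
    qed
  qed auto
  moreover have "(LINT x|lborel. ?q t x) = ((LINT x|lborel. \<bar>u x + t * \<phi> x\<bar> powr r) - (LINT x|lborel. \<bar>u x + 0 * \<phi> x\<bar> powr r)) / (t - 0)" for t
    using it[of t] it[of 0] by simp
  moreover have "(LINT x|lborel. r * u x powr (r - 1) * \<phi> x) = r * (LINT x|lborel. u x powr (r - 1) * \<phi> x)"
    by (simp add: mult.assoc)
  ultimately have "((\<lambda>t. LINT x|lborel. \<bar>u x + t * \<phi> x\<bar> powr r) has_real_derivative
    r * (LINT x|lborel. u x powr (r - 1) * \<phi> x)) (at 0 within {- 1<..<1})"
    unfolding has_field_derivative_iff tendsto_at_iff_sequentially o_def by (simp only:) blast
  then show ?thesis by (simp add: at_within_open[of "0::real" "{- 1<..<1}"])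
qed

context fractional_problem
begin

lemma Hs_dot_add_test:
  fixes u \<phi> :: "real^'n \<Rightarrow> real"
  assumes u: "u \<in> Hs_dot s" and \<phi>: "\<phi> \<in> test_functions"
  shows "(\<lambda>x. u x + t * \<phi> x) \<in> Hs_dot s"
proof -
  have t: "(\<lambda>x. t * \<phi> x) \<in> test_functions" and t': "(\<lambda>x. - t * \<phi> x) \<in> test_functions"
    by (rule test_function_cmult[OF \<phi>])+
  obtain \<psi> where \<psi>: "\<And>k. \<psi> k \<in> test_functions"
    "(\<lambda>k. gag s (\<lambda>x. u x - \<psi> k x)) \<longlonglongrightarrow> 0" "(\<lambda>k. Lpow (crit_exp (real CARD('n)) s) (\<lambda>x. u x - \<psi> k x)) \<longlonglongrightarrow> 0"
    using u unfolding Hs_dot_iff[OF s] by blast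
  have "(\<lambda>x. u x + t * \<phi> x) \<in> finite_energy s"
    using finite_energy_diff_test[OF s Hs_dot_finite_energy[OF u] t'] by simp
  moreover have "(\<lambda>x. \<psi> k x + t * \<phi> x) \<in> test_functions" for k
    by (rule test_function_add[OF \<psi>(1) t])
  moreover have "(\<lambda>x. u x + t * \<phi> x - (\<psi> k x + t * \<phi> x)) = (\<lambda>x. u x - \<psi> k x)" for k by auto
  ultimately show ?thesis
    unfolding Hs_dot_iff[OF s] using \<psi>(2,3) by (intro conjI exI[of _ "\<lambda>k x. \<psi> k x + t * \<phi> x"]) auto
qed

lemma Hs_dot_cmult:
  fixes u :: "real^'n \<Rightarrow> real"
  assumes u: "u \<in> Hs_dot s"
  shows "(\<lambda>x. c * u x) \<in> Hs_dot s"
proof -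
  have fe: "u \<in> finite_energy s" by (rule Hs_dot_finite_energy[OF u])
  obtain \<psi> where \<psi>: "\<And>k. \<psi> k \<in> test_functions"
    "(\<lambda>k. gag s (\<lambda>x. u x - \<psi> k x)) \<longlonglongrightarrow> 0" "(\<lambda>k. Lpow (crit_exp (real CARD('n)) s) (\<lambda>x. u x - \<psi> k x)) \<longlonglongrightarrow> 0"
    using u unfolding Hs_dot_iff[OF s] by blast
  note [measurable] = finite_energy_measurable[OF fe] test_function_measurable[OF \<psi>(1)]
  have "(\<lambda>x. c * u x) \<in> finite_energy s"
    using fe by (simp add: finite_energy_iff gag_cmult Lpow_cmult ennreal_mult_less_top)
  moreover have eq: "(\<lambda>x. c * u x - c * \<psi> k x) = (\<lambda>x. c * (u x - \<psi> k x))" for k by (auto simp: algebra_simps)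
  have "(\<lambda>k. ennreal (c\<^sup>2) * gag s (\<lambda>x. u x - \<psi> k x)) \<longlonglongrightarrow> ennreal (c\<^sup>2) * 0"
    by (intro ennreal_tendsto_cmult \<psi>) simp
  then have "(\<lambda>k. gag s (\<lambda>x. c * u x - c * \<psi> k x)) \<longlonglongrightarrow> 0" by (simp add: eq gag_cmult)
  moreover have "(\<lambda>k. ennreal (\<bar>c\<bar> powr crit_exp (real CARD('n)) s) * Lpow (crit_exp (real CARD('n)) s) (\<lambda>x. u x - \<psi> k x))
      \<longlonglongrightarrow> ennreal (\<bar>c\<bar> powr crit_exp (real CARD('n)) s) * 0"
    by (intro ennreal_tendsto_cmult \<psi>) simp
  then have "(\<lambda>k. Lpow (crit_exp (real CARD('n)) s) (\<lambda>x. c * u x - c * \<psi> k x)) \<longlonglongrightarrow> 0" by (simp add: eq Lpow_cmult)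
  ultimately show ?thesis
    unfolding Hs_dot_iff[OF s] using test_function_cmult[OF \<psi>(1)]
    by (intro conjI exI[of _ "\<lambda>k x. c * \<psi> k x"]) auto
qed

text \<open>The variation u + t \<phi> is brought back to the constraint by a scalar factor, so the
  energy becomes a function of t with a local minimum at 0. In the multiplier the weights 1/2 and
  1/(q + 1) of the energy are gone, cancelled by the degrees of homogeneity 2 and q + 1.\<close>

lemma euler_lagrange:
  fixes u \<phi> :: "real^'n \<Rightarrow> real"
  assumes u: "rd_profile M u" "u \<in> admissible s p q"
    and min: "\<And>v :: real^'n \<Rightarrow> real. v \<in> admissible s p q \<Longrightarrow> energy s q u \<le> energy s q v"
    and \<phi>: "\<phi> \<in> test_functions"
  shows "gagliardo_form s u \<phi> + (LINT x|lborel. u x powr q * \<phi> x)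
    = (gagliardo_form s u u + (LINT x|lborel. \<bar>u x\<bar> powr (q + 1))) * (LINT x|lborel. u x powr p * \<phi> x)"
proof -
  have uH: "u \<in> Hs_dot s" and uL: "u \<in> Lp_space (q + 1)" and u1: "Lpow (p + 1) u = 1"
    using u(2) by (auto simp: admissible_iff)
  have fe: "u \<in> finite_energy s" by (rule Hs_dot_finite_energy[OF uH])
  note um[measurable] = finite_energy_measurable[OF fe] and \<phi>m[measurable] = test_function_measurable[OF \<phi>]
  have fu: "gag s u < \<infinity>" using fe by (simp add: finite_energy_iff)
  have f\<phi>: "gag s \<phi> < \<infinity>" by (rule test_function_finite_gag[OF s(1,2) \<phi>])
  have p1: "p + 1 > 2" and q1: "q + 1 > 2" using crit by linarith+
  have ub: "0 \<le> u x \<and> u x \<le> M" for x using rd_profileD[OF u(1)] by simp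
  define v where "v t x = u x + t * \<phi> x" for t x
  have [measurable]: "v t \<in> borel_measurable borel" for t unfolding v_def by measurable
  have vH: "v t \<in> Hs_dot s" for t unfolding v_def by (rule Hs_dot_add_test[OF uH \<phi>])
  have vL: "Lpow r (v t) < \<infinity>" if "Lpow r u < \<infinity>" "0 \<le> r" for r t
  proof -
    have "Lpow r (v t) \<le> ennreal (2 powr r) * (Lpow r u + Lpow r (\<lambda>x. t * \<phi> x))"
      unfolding v_def by (rule Lpow_add_le) (use that in auto)
    also have "\<dots> < \<infinity>"
      using that test_function_finite_Lpow[OF \<phi> that(2)] by (simp add: Lpow_cmult ennreal_mult_less_top)
    finally show ?thesis .
  qed
  have uq: "Lpow (q + 1) u < \<infinity>" using uL by (simp add: Lp_space_iff)
  define m where "m t = (LINT x|lborel. \<bar>v t x\<bar> powr (p + 1))" for t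
  define B where "B t = (LINT x|lborel. \<bar>v t x\<bar> powr (q + 1))" for t
  define G where "G t = gagliardo_form s (v t) (v t)" for t
  define P where "P = (LINT x|lborel. u x powr p * \<phi> x)"
  define Q where "Q = (LINT x|lborel. u x powr q * \<phi> x)"
  have dm: "(m has_real_derivative (p + 1) * P) (at 0)"
    using DERIV_integral_abs_powr[OF um ub _ _ \<phi>, of "p + 1"] u1 p1
    by (simp add: m_def[abs_def] v_def P_def)
  have dB: "(B has_real_derivative (q + 1) * Q) (at 0)"
    using DERIV_integral_abs_powr[OF um ub uq _ \<phi>] q1 by (simp add: B_def[abs_def] v_def Q_def)
  have Gt: "G t = gagliardo_form s u u + 2 * t * gagliardo_form s u \<phi> + t\<^sup>2 * gagliardo_form s \<phi> \<phi>" for t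
    unfolding G_def v_def by (rule gagliardo_form_expand[OF um \<phi>m fu f\<phi>])
  have dG: "(G has_real_derivative 2 * gagliardo_form s u \<phi>) (at 0)"
    unfolding Gt[abs_def] by (auto intro!: derivative_eq_intros)
  have mL: "Lpow (p + 1) (v t) = ennreal (m t)" for t
    using vL[of "p + 1" t] u1 p1 integral_Lpow[of "v t" "p + 1"] by (simp add: Lp_space_iff m_def)
  have v0: "v 0 = u" by (auto simp: v_def)
  have m0: "m 0 = 1"
    using mL[of 0] u1 by (metis ennreal_1 ennreal_inj ennreal_eq_1 v0)
  \<comment> \<open>The energy of c (u + t \<phi>) with c = (m t)^(-1/(p+1)), written out by
    homogeneity: c^2 in front of the form and c^(q+1) in front of the power integral.\<close>
  define \<Psi> where "\<Psi> t = 1 / 2 * (m t powr - (2 / (p + 1)) * G t)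
      + 1 / (q + 1) * (m t powr - ((q + 1) / (p + 1)) * B t)" for t
  have \<Psi>0: "\<Psi> 0 = energy s q u" by (simp add: \<Psi>_def m0 energy_def G_def B_def v0)
  have "isCont m 0" using dm by (rule DERIV_isCont)
  then have "eventually (\<lambda>t. 0 < m t) (at 0)"
    using m0 unfolding isCont_def by (intro order_tendstoD) auto
  then obtain d where d: "0 < d" "\<And>t. t \<noteq> 0 \<Longrightarrow> \<bar>t\<bar> < d \<Longrightarrow> 0 < m t"
    unfolding eventually_at by (auto simp: dist_real_def)
  have le: "\<Psi> 0 \<le> \<Psi> t" if "\<bar>0 - t\<bar> < d" for t
  proof -
    have mt: "0 < m t" using d(2)[of t] that m0 by (cases "t = 0") auto
    define c where "c = m t powr - (1 / (p + 1))"
    have c: "0 < c" using mt by (simp add: c_def)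
    have c2: "c\<^sup>2 = m t powr - (2 / (p + 1))"
      using mt by (simp add: c_def powr_powr powr_realpow[symmetric] del: powr_numeral)
    have cq: "c powr (q + 1) = m t powr - ((q + 1) / (p + 1))" by (simp add: c_def powr_powr)
    have cp: "c powr (p + 1) = 1 / m t"
    proof -
      have "c powr (p + 1) = m t powr - 1" using p1 by (simp add: c_def powr_powr)
      then show ?thesis using mt by (simp add: powr_minus_divide)
    qed
    have "Lpow (p + 1) (\<lambda>x. c * v t x) = 1"
      using c mt by (simp add: Lpow_cmult mL cp ennreal_mult'[symmetric])
    moreover have "Lpow (q + 1) (\<lambda>x. c * v t x) < \<infinity>"
      using vL[OF uq] q1 by (simp add: Lpow_cmult ennreal_mult_less_top)
    ultimately have "(\<lambda>x. c * v t x) \<in> admissible s p q"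
      using Hs_dot_cmult[OF vH] by (simp add: admissible_iff Lp_space_iff)
    then have "energy s q u \<le> energy s q (\<lambda>x. c * v t x)" by (rule min)
    also have "gagliardo_form s (\<lambda>x. c * v t x) (\<lambda>x. c * v t x) = c\<^sup>2 * G t"
    proof -
      have "gagliardo_integrand s (\<lambda>x. c * v t x) (\<lambda>x. c * v t x) z = c\<^sup>2 * gagliardo_integrand s (v t) (v t) z" for z
        by (cases z) (simp add: gagliardo_integrand_self power2_eq_square algebra_simps)
      then show ?thesis by (simp add: gagliardo_form_def G_def)
    qed
    then have "energy s q (\<lambda>x. c * v t x) = \<Psi> t"
      using c by (simp add: energy_def \<Psi>_def B_def abs_mult powr_mult c2 cq)
    finally show ?thesis by (simp add: \<Psi>0)
  qed
  define D where "D = 1 / 2 * (- (2 / (p + 1)) * ((p + 1) * P) * G 0 + 2 * gagliardo_form s u \<phi>)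
      + 1 / (q + 1) * (- ((q + 1) / (p + 1)) * ((p + 1) * P) * B 0 + (q + 1) * Q)"
  have dpow: "((\<lambda>t. m t powr k) has_real_derivative k * ((p + 1) * P)) (at 0)" for k
    using DERIV_chain2[OF has_real_derivative_powr[of "m 0" k] dm] m0 by simp
  have "(\<Psi> has_real_derivative D) (at 0)"
    unfolding \<Psi>_def[abs_def] D_def
    by (rule DERIV_cong[OF DERIV_add[OF DERIV_cmult[OF DERIV_mult[OF dpow dG]] DERIV_cmult[OF DERIV_mult[OF dpow dB]]]])
       (simp add: m0)
  then have "D = 0" by (rule DERIV_local_min[OF _ d(1)]) (use le in auto)
  moreover have "D = - P * G 0 + gagliardo_form s u \<phi> - P * B 0 + Q"
  proof -
    have e1: "- (2 / (p + 1)) * ((p + 1) * P) = - 2 * P"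
      and e2: "- ((q + 1) / (p + 1)) * ((p + 1) * P) = - ((q + 1) * P)"
      using p1 by simp_all
    have e3: "- ((q + 1) * P) * B 0 + (q + 1) * Q = (q + 1) * (Q - P * B 0)"
      by (simp add: algebra_simps)
    have e4: "1 / 2 * (- 2 * P * G 0 + 2 * gagliardo_form s u \<phi>) = - P * G 0 + gagliardo_form s u \<phi>"
      by simp
    have "D = - P * G 0 + gagliardo_form s u \<phi> + 1 / (q + 1) * ((q + 1) * (Q - P * B 0))"
      unfolding D_def e1 e2 e3 e4 ..
    then show ?thesis using q1 by simp
  qed
  moreover have "G 0 = gagliardo_form s u u" "B 0 = (LINT x|lborel. \<bar>u x\<bar> powr (q + 1))"
    by (simp_all add: G_def B_def v0)
  ultimately show ?thesis by (simp add: P_def Q_def algebra_simps)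
qed

end

section \<open>Weak solutions\<close>

lemma gagliardo_form_cmult_left: "gagliardo_form s (\<lambda>x. c * u x) v = c * gagliardo_form s u v"
proof -
  have "gagliardo_integrand s (\<lambda>x. c * u x) v = (\<lambda>z. c * gagliardo_integrand s u v z)"
    by (rule ext) (auto simp: gagliardo_integrand_def algebra_simps)
  then show ?thesis by (simp add: gagliardo_form_def)
qed

context fractional_problem
begin

text \<open>Young's inequality with the conjugate exponents r' and r. From r - 1 \<le> e follows e
  r' \<ge> r, so boundedness reduces the integral of w^(e r') to that of w^r. The weight t plays the
  role of Hoelder's product form.\<close>

lemma nonlinear_term_bound:
  fixes w \<phi> :: "real^'n \<Rightarrow> real"
  defines "r \<equiv> crit_exp (real CARD('n)) s"
  defines "r' \<equiv> r / (r - 1)"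
  assumes [measurable]: "w \<in> borel_measurable borel" "\<phi> \<in> borel_measurable borel"
    and w: "\<And>x. 0 \<le> w x \<and> w x \<le> M" and fw: "Lpow r w < \<infinity>" and f\<phi>: "\<phi> \<in> Lp_space r"
    and e: "r - 1 \<le> e" and t: "0 < t"
  shows "integrable lborel (\<lambda>x. w x powr e * \<phi> x)"
    "\<bar>LINT x|lborel. w x powr e * \<phi> x\<bar>
      \<le> t powr r' * (LINT x|lborel. \<bar>w x\<bar> powr (e * r')) + t powr - r * (LINT x|lborel. \<bar>\<phi> x\<bar> powr r)"
proof -
  have r: "2 < r" using crit by (simp add: r_def)
  have r': "1 < r'" "1 / r' + 1 / r = 1" using r by (auto simp: r'_def field_simps)
  have er: "r \<le> e * r'"
  proof -
    have "r = (r - 1) * r'" using r by (simp add: r'_def)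
    also have "\<dots> \<le> e * r'" using e r' by (intro mult_right_mono) auto
    finally show ?thesis .
  qed
  have "Lpow (e * r') w \<le> ennreal (M powr (e * r' - r)) * Lpow r w"
    using w r er by (intro Lpow_bounded_mono) auto
  also have "\<dots> < \<infinity>" using fw by (simp add: ennreal_mult_less_top)
  finally have iw: "integrable lborel (\<lambda>x. \<bar>w x\<bar> powr (e * r'))" by (simp add: integrable_Lpow_iff)
  have i\<phi>: "integrable lborel (\<lambda>x. \<bar>\<phi> x\<bar> powr r)" using f\<phi> by (simp add: Lp_space_def)
  let ?b = "\<lambda>x. t powr r' * \<bar>w x\<bar> powr (e * r') + t powr - r * \<bar>\<phi> x\<bar> powr r"
  have ib: "integrable lborel ?b" using iw i\<phi> by simp
  have pt: "\<bar>w x powr e * \<phi> x\<bar> \<le> ?b x" for x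
  proof -
    have "\<bar>w x powr e * \<phi> x\<bar> = (t * w x powr e) * (\<bar>\<phi> x\<bar> / t)" using t by (simp add: abs_mult)
    also have "\<dots> \<le> (t * w x powr e) powr r' / r' + (\<bar>\<phi> x\<bar> / t) powr r / r"
      using r r' t by (intro Youngs_inequality) auto
    also have "\<dots> \<le> (t * w x powr e) powr r' / 1 + (\<bar>\<phi> x\<bar> / t) powr r / 1"
      using r r' by (intro add_mono divide_left_mono) auto
    also have "\<dots> = ?b x"
    proof -
      have "(t * w x powr e) powr r' = t powr r' * \<bar>w x\<bar> powr (e * r')"
        using t w[of x] by (simp add: powr_mult powr_powr)
      moreover have "(\<bar>\<phi> x\<bar> / t) powr r = t powr - r * \<bar>\<phi> x\<bar> powr r"
        using t by (simp add: powr_divide powr_minus_divide)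
      ultimately show ?thesis by simp
    qed
    finally show ?thesis .
  qed
  show int: "integrable lborel (\<lambda>x. w x powr e * \<phi> x)"
    by (rule Bochner_Integration.integrable_bound[OF ib]) (auto intro!: AE_I2 order_trans[OF pt])
  have "\<bar>LINT x|lborel. w x powr e * \<phi> x\<bar> \<le> (LINT x|lborel. \<bar>w x powr e * \<phi> x\<bar>)"
    by (rule integral_abs_bound)
  also have "\<dots> \<le> (LINT x|lborel. ?b x)" using int ib pt by (intro integral_mono) auto
  also have "\<dots> = t powr r' * (LINT x|lborel. \<bar>w x\<bar> powr (e * r')) + t powr - r * (LINT x|lborel. \<bar>\<phi> x\<bar> powr r)"
    using iw i\<phi> by simp
  finally show "\<bar>LINT x|lborel. w x powr e * \<phi> x\<bar>
      \<le> t powr r' * (LINT x|lborel. \<bar>w x\<bar> powr (e * r')) + t powr - r * (LINT x|lborel. \<bar>\<phi> x\<bar> powr r)" .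
qed

text \<open>All three terms are continuous in \<phi> for the norm defining \<open>Hs_dot s\<close>,
  so the identity extends from test functions by density.\<close>

lemma weak_solutionI:
  fixes w :: "real^'n \<Rightarrow> real"
  assumes rd: "radially_decreasing w" and w0: "\<And>x. 0 \<le> w x" and fe: "w \<in> finite_energy s" and Lq: "w \<in> Lp_space (q + 1)"
    and eq: "\<And>\<phi>. \<phi> \<in> test_functions \<Longrightarrow> frac_const (real CARD('n)) s / 2 * gagliardo_form s w \<phi>
      = (LINT x|lborel. w x powr p * \<phi> x) - (LINT x|lborel. w x powr q * \<phi> x)"
  shows "weak_solution s p q w"
proof -
  let ?r = "crit_exp (real CARD('n)) s"
  have wH: "w \<in> Hs_dot s" by (rule radially_decreasing_Hs_dot[OF s rd w0 fe])
  have wm[measurable]: "w \<in> borel_measurable borel" by (rule finite_energy_measurable[OF fe])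
  have wb: "0 \<le> w x \<and> w x \<le> w 0" for x using w0 rd by (auto simp: radially_decreasing_def)
  have fw: "gag s w < \<infinity>" "Lpow ?r w < \<infinity>" using fe by (auto simp: finite_energy_iff)
  have exps: "?r - 1 \<le> p" "?r - 1 \<le> q" using p pq by auto
  have "integrable lborel (\<lambda>x. w x powr p * \<phi> x) \<and> integrable lborel (\<lambda>x. w x powr q * \<phi> x) \<and>
      frac_const (real CARD('n)) s / 2 * gagliardo_form s w \<phi>
        = (LINT x|lborel. w x powr p * \<phi> x) - (LINT x|lborel. w x powr q * \<phi> x)"
    if \<phi>: "\<phi> \<in> Hs_dot s" for \<phi> :: "real^'n \<Rightarrow> real"
  proof -
    have f\<phi>: "\<phi> \<in> finite_energy s" by (rule Hs_dot_finite_energy[OF \<phi>])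
    have \<phi>m[measurable]: "\<phi> \<in> borel_measurable borel" by (rule finite_energy_measurable[OF f\<phi>])
    have g\<phi>: "gag s \<phi> < \<infinity>" using f\<phi> by (simp add: finite_energy_iff)
    have L\<phi>: "\<phi> \<in> Lp_space ?r" using f\<phi> by (simp add: finite_energy_def)
    obtain \<psi> where \<psi>: "\<And>k. \<psi> k \<in> test_functions"
      "(\<lambda>k. gag s (\<lambda>x. \<phi> x - \<psi> k x)) \<longlonglongrightarrow> 0" "(\<lambda>k. Lpow ?r (\<lambda>x. \<phi> x - \<psi> k x)) \<longlonglongrightarrow> 0"
      using \<phi> unfolding Hs_dot_iff[OF s] by blast
    note \<psi>m[measurable] = test_function_measurable[OF \<psi>(1)]
    define d where "d k x = \<phi> x - \<psi> k x" for k x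
    have dfe: "d k \<in> finite_energy s" for k
      unfolding d_def by (rule finite_energy_diff_test[OF s f\<phi> \<psi>(1)])
    have dm[measurable]: "d k \<in> borel_measurable borel" for k by (rule finite_energy_measurable[OF dfe])
    have dg: "gag s (d k) < \<infinity>" for k using dfe[of k] by (simp add: finite_energy_iff)
    have dL: "d k \<in> Lp_space ?r" for k using dfe[of k] by (simp add: finite_energy_def)
    have \<psi>L: "\<psi> k \<in> Lp_space ?r" for k
      using test_function_finite_Lpow[OF \<psi>(1), of ?r] crit by (simp add: Lp_space_iff)
    define G where "G k = gagliardo_form s (d k) (d k)" for k
    define L where "L k = (LINT x|lborel. \<bar>d k x\<bar> powr ?r)" for k
    have G0: "0 \<le> G k" and L0: "0 \<le> L k" for k by (simp_all add: G_def L_def gagliardo_form_nonneg)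
    have Glim: "G \<longlonglongrightarrow> 0"
    proof -
      have "(\<lambda>k. ennreal (G k)) \<longlonglongrightarrow> ennreal 0"
        using \<psi>(2) gagliardo_form_gag[OF dm dg] by (simp add: G_def d_def[symmetric])
      then show ?thesis using G0 by (subst (asm) tendsto_ennreal_iff) auto
    qed
    have Llim: "L \<longlonglongrightarrow> 0"
    proof -
      have "(\<lambda>k. ennreal (L k)) \<longlonglongrightarrow> ennreal 0"
        using \<psi>(3) integral_Lpow[OF dL] by (simp add: L_def d_def[symmetric])
      then show ?thesis using L0 by (subst (asm) tendsto_ennreal_iff) auto
    qed
    \<comment> \<open>The summand 1/(k + 1) keeps D k positive, so that its powers can serve as
      weights in the Young-type bounds even when the errors vanish.\<close>
    define D where "D k = G k + L k + 1 / real (Suc k)" for k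
    have D0: "0 < D k" for k unfolding D_def using G0[of k] L0[of k] by (intro add_nonneg_pos) auto
    have "(\<lambda>k. G k + L k + 1 / real (Suc k)) \<longlonglongrightarrow> 0 + 0 + 0"
      by (intro tendsto_intros Glim Llim LIMSEQ_Suc[OF lim_1_over_n])
    then have Dlim: "D \<longlonglongrightarrow> 0" by (simp add: D_def[abs_def])
    have Dpow: "(\<lambda>k. D k powr a) \<longlonglongrightarrow> 0" if "0 < a" for a
      using tendsto_powr2[OF Dlim tendsto_const[of a]] D0 that by (simp add: less_imp_le)
    have form: "(\<lambda>k. gagliardo_form s w (\<psi> k)) \<longlonglongrightarrow> gagliardo_form s w \<phi>"
    proof -
      have "\<bar>gagliardo_form s w (d k)\<bar> \<le> D k powr (1 / 2) * gagliardo_form s w w + D k powr (1 / 2)" for k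
      proof -
        have "\<bar>gagliardo_form s w (d k)\<bar> \<le> D k powr (1 / 2) * gagliardo_form s w w + G k / D k powr (1 / 2)"
          unfolding G_def by (rule gagliardo_form_bound[OF wm dm fw(1) dg]) (use D0[of k] in simp)
        also have "G k / D k powr (1 / 2) \<le> D k / D k powr (1 / 2)"
          using L0[of k] by (intro divide_right_mono) (auto simp: D_def)
        also have "D k / D k powr (1 / 2) = D k powr (1 / 2)"
          using D0[of k] powr_diff[of "D k" 1 "1 / 2"] by simp
        finally show ?thesis by simp
      qed
      moreover have "(\<lambda>k. D k powr (1 / 2) * gagliardo_form s w w + D k powr (1 / 2)) \<longlonglongrightarrow> 0 * gagliardo_form s w w + 0"
        by (intro tendsto_intros Dpow) auto
      ultimately have "(\<lambda>k. gagliardo_form s w (d k)) \<longlonglongrightarrow> 0"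
        by (intro Lim_null_comparison[of "\<lambda>k. gagliardo_form s w (d k)" "\<lambda>k. D k powr (1 / 2) * gagliardo_form s w w + D k powr (1 / 2)"])
           (auto intro: always_eventually)
      moreover have "gagliardo_form s w (\<psi> k) = gagliardo_form s w \<phi> - gagliardo_form s w (d k)" for k
      proof -
        have "\<psi> k = (\<lambda>x. \<phi> x + (- 1) * d k x)" by (auto simp: d_def)
        then have "gagliardo_form s w (\<psi> k) = gagliardo_form s w (\<lambda>x. \<phi> x + (- 1) * d k x)" by simp
        also have "\<dots> = gagliardo_form s w \<phi> + (- 1) * gagliardo_form s w (d k)"
          by (rule gagliardo_form_add_right[OF wm \<phi>m dm fw(1) g\<phi> dg])
        finally show ?thesis by simp
      qed
      ultimately show ?thesis using tendsto_diff[OF tendsto_const[of "gagliardo_form s w \<phi>"]] by fastforce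
    qed
    have nonlinear: "integrable lborel (\<lambda>x. w x powr e * \<phi> x) \<and>
        (\<lambda>k. LINT x|lborel. w x powr e * \<psi> k x) \<longlonglongrightarrow> (LINT x|lborel. w x powr e * \<phi> x)"
      if e: "?r - 1 \<le> e" for e
    proof -
      define r' where "r' = ?r / (?r - 1)"
      have r: "2 < ?r" using crit by simp
      then have r'0: "0 < r'" by (simp add: r'_def)
      define K where "K = (LINT x|lborel. \<bar>w x\<bar> powr (e * r'))"
      have i: "integrable lborel (\<lambda>x. w x powr e * v x)"
        if "v \<in> Lp_space ?r" for v
        using nonlinear_term_bound(1)[OF wm _ wb fw(2) that e zero_less_one] that by (simp add: Lp_space_def)
      have "\<bar>LINT x|lborel. w x powr e * d k x\<bar> \<le> D k powr (r' / (2 * ?r)) * K + D k powr (1 / 2)" for k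
      proof -
        \<comment> \<open>Balances the two terms: t^(-r) D k becomes the square root of D k, while
          t^r' is still a positive power of D k.\<close>
        define t where "t = D k powr (1 / (2 * ?r))"
        have t: "0 < t" using D0[of k] by (simp add: t_def)
        have "\<bar>LINT x|lborel. w x powr e * d k x\<bar> \<le> t powr r' * K + t powr - ?r * L k"
          using nonlinear_term_bound(2)[OF wm dm wb fw(2) dL e t] by (simp add: r'_def K_def L_def)
        also have "t powr - ?r * L k \<le> t powr - ?r * D k"
          using G0[of k] by (intro mult_left_mono) (auto simp: D_def)
        also have "t powr - ?r * D k = D k powr (1 / 2)"
        proof -
          have "t powr - ?r = D k powr (- 1 / 2)" using r by (simp add: t_def powr_powr)
          then have "t powr - ?r * D k = D k powr (- 1 / 2) * D k powr 1" using D0[of k] by simp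
          then show ?thesis by (simp only: powr_add[symmetric]) simp
        qed
        also have "t powr r' = D k powr (r' / (2 * ?r))" by (simp add: t_def powr_powr)
        finally show ?thesis by simp
      qed
      moreover have "(\<lambda>k. D k powr (r' / (2 * ?r)) * K + D k powr (1 / 2)) \<longlonglongrightarrow> 0 * K + 0"
        using r r'0 by (intro tendsto_intros Dpow) auto
      ultimately have "(\<lambda>k. LINT x|lborel. w x powr e * d k x) \<longlonglongrightarrow> 0"
        by (intro Lim_null_comparison[of "\<lambda>k. LINT x|lborel. w x powr e * d k x" "\<lambda>k. D k powr (r' / (2 * ?r)) * K + D k powr (1 / 2)"])
           (auto intro: always_eventually)
      moreover have "(LINT x|lborel. w x powr e * \<psi> k x) = (LINT x|lborel. w x powr e * \<phi> x) - (LINT x|lborel. w x powr e * d k x)" for k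
      proof -
        have "(LINT x|lborel. w x powr e * \<psi> k x) = (LINT x|lborel. w x powr e * \<phi> x - w x powr e * d k x)"
          by (simp add: d_def algebra_simps)
        also have "\<dots> = (LINT x|lborel. w x powr e * \<phi> x) - (LINT x|lborel. w x powr e * d k x)"
          by (rule Bochner_Integration.integral_diff[OF i[OF L\<phi>] i[OF dL]])
        finally show ?thesis .
      qed
      ultimately have "(\<lambda>k. LINT x|lborel. w x powr e * \<psi> k x) \<longlonglongrightarrow> (LINT x|lborel. w x powr e * \<phi> x) - 0"
        by (simp only:) (intro tendsto_diff tendsto_const)
      then show ?thesis using i[OF L\<phi>] by simp
    qed
    have "(\<lambda>k. frac_const (real CARD('n)) s / 2 * gagliardo_form s w (\<psi> k)) \<longlonglongrightarrow> frac_const (real CARD('n)) s / 2 * gagliardo_form s w \<phi>"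
      by (intro tendsto_mult tendsto_const form)
    moreover have "(\<lambda>k. frac_const (real CARD('n)) s / 2 * gagliardo_form s w (\<psi> k))
        \<longlonglongrightarrow> (LINT x|lborel. w x powr p * \<phi> x) - (LINT x|lborel. w x powr q * \<phi> x)"
      unfolding eq[OF \<psi>(1)]
      using nonlinear[OF exps(1)] nonlinear[OF exps(2)] by (intro tendsto_diff) auto
    ultimately show ?thesis
      using nonlinear[OF exps(1)] nonlinear[OF exps(2)] LIMSEQ_unique by blast
  qed
  then show ?thesis using wH Lq w0 by (simp add: weak_solution_def)
qed

lemma solution_exists:
  obtains w :: "real^'n \<Rightarrow> real" where "radially_decreasing w" "\<And>x. 0 \<le> w x" "w \<in> finite_energy s" "w \<in> Lp_space (q + 1)"
    "\<And>\<phi>. \<phi> \<in> test_functions \<Longrightarrow> frac_const (real CARD('n)) s / 2 * gagliardo_form s w \<phi>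
      = (LINT x|lborel. w x powr p * \<phi> x) - (LINT x|lborel. w x powr q * \<phi> x)"
    "\<not> (AE x in lborel. w x = 0)"
proof -
  let ?n = "real CARD('n)"
  obtain u :: "real^'n \<Rightarrow> real" and M where u: "rd_profile M u" "u \<in> admissible s p q"
    and min: "\<And>v :: real^'n \<Rightarrow> real. v \<in> admissible s p q \<Longrightarrow> energy s q u \<le> energy s q v"
    by (rule minimiser_exists) (rule that)
  have uL: "u \<in> Lp_space (q + 1)" and u1: "Lpow (p + 1) u = 1" and fe: "u \<in> finite_energy s"
    using u(2) by (auto simp: admissible_iff Hs_dot_finite_energy)
  have um[measurable]: "u \<in> borel_measurable borel" by (rule finite_energy_measurable[OF fe])
  have fu: "gag s u < \<infinity>" using fe by (simp add: finite_energy_iff)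
  have u0: "0 \<le> u x" for x by (rule rd_profileD(2)[OF u(1)])
  define B where "B = (LINT x|lborel. \<bar>u x\<bar> powr (q + 1))"
  have "B \<noteq> 0"
  proof
    assume "B = 0"
    then have "Lpow (q + 1) u = 0" using integral_Lpow[OF uL] by (simp add: B_def)
    then have "Lpow (p + 1) u = 0" by (simp add: Lpow_eq_0_iff)
    then show False using u1 by simp
  qed
  moreover have "0 \<le> B" by (simp add: B_def)
  ultimately have B: "0 < B" by simp
  define \<Lambda> where "\<Lambda> = gagliardo_form s u u + B"
  have \<Lambda>: "0 < \<Lambda>" using B gagliardo_form_nonneg[of s u] by (simp add: \<Lambda>_def)
  define \<kappa> where "\<kappa> = frac_const ?n s / 2"
  have \<kappa>: "0 < \<kappa>" using frac_const_pos[OF s(1,2), of ?n] by (auto simp: \<kappa>_def)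
  \<comment> \<open>Inserting w = \<alpha> u (\<beta> x) scales the form by \<alpha> \<beta>^(2s -
    N) and the power terms by \<alpha>^p \<beta>^(-N) and \<alpha>^q \<beta>^(-N). Matching both
    coefficients requires \<alpha>^q \<Lambda> = \<alpha>^p, which fixes \<alpha>.\<close>
  define \<alpha> where "\<alpha> = \<Lambda> powr - (1 / (q - p))"
  have \<alpha>: "0 < \<alpha>" using \<Lambda> by (simp add: \<alpha>_def)
  \<comment> \<open>The remaining condition \<kappa> \<beta>^(2s) = \<alpha>^(q - 1) fixes \<beta>
    and absorbs the constant of the fractional Laplacian.\<close>
  define \<beta> where "\<beta> = (\<alpha> powr (q - 1) / \<kappa>) powr (1 / (2 * s))"
  have \<beta>: "0 < \<beta>" using \<alpha> \<kappa> by (simp add: \<beta>_def)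
  have \<beta>s: "\<kappa> * \<beta> powr (2 * s) = \<alpha> powr (q - 1)" using \<alpha> \<kappa> s by (simp add: \<beta>_def powr_powr)
  have \<alpha>p: "\<alpha> powr q * \<Lambda> = \<alpha> powr p"
  proof -
    have "\<alpha> powr (q - p) = \<Lambda> powr - 1" using pq by (simp add: \<alpha>_def powr_powr)
    then have "\<alpha> powr (q - p) * \<Lambda> = 1" using \<Lambda> by (simp add: powr_minus_divide)
    moreover have "\<alpha> powr q = \<alpha> powr p * \<alpha> powr (q - p)" by (simp add: powr_add[symmetric])
    ultimately show ?thesis by (simp add: mult.assoc)
  qed
  define w where "w x = \<alpha> * u (\<beta> *\<^sub>R x)" for x
  have wm[measurable]: "w \<in> borel_measurable borel" unfolding w_def by measurable
  have dm: "(\<lambda>x. u (\<beta> *\<^sub>R x)) \<in> borel_measurable borel" by measurable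
  have wL: "Lpow r w = ennreal (\<alpha> powr r) * (ennreal (\<beta> powr - ?n) * Lpow r u)" for r
    unfolding w_def using \<alpha> by (simp add: Lpow_cmult Lpow_dilate[OF um \<beta>])
  have rd: "radially_decreasing w"
    using rd_profileD(1)[OF u(1)] \<alpha> \<beta> by (auto simp: radially_decreasing_def w_def intro!: mult_left_mono)
  have w0: "0 \<le> w x" for x using u0 \<alpha> by (simp add: w_def)
  have "gag s w = ennreal (\<alpha>\<^sup>2) * (ennreal (\<beta> powr - (?n - 2 * s)) * gag s u)"
    unfolding w_def by (simp only: gag_cmult[OF dm] gag_dilate[OF um \<beta>])
  then have wfe: "w \<in> finite_energy s"
    using fe by (simp add: finite_energy_iff wL ennreal_mult_less_top)
  have wLq: "w \<in> Lp_space (q + 1)" using uL by (simp add: Lp_space_iff wL ennreal_mult_less_top)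
  have nz: "\<not> (AE x in lborel. w x = 0)"
  proof
    assume "AE x in lborel. w x = 0"
    then have "Lpow (p + 1) w = 0" by (simp add: Lpow_eq_0_iff)
    moreover have "0 < \<alpha> powr (p + 1) * \<beta> powr - ?n" using \<alpha> \<beta> by simp
    ultimately show False using u1 by (simp add: wL ennreal_mult'[symmetric] ennreal_eq_0_iff del: zero_less_mult_iff)
  qed
  have eq: "frac_const ?n s / 2 * gagliardo_form s w \<phi>
      = (LINT x|lborel. w x powr p * \<phi> x) - (LINT x|lborel. w x powr q * \<phi> x)"
    if \<phi>: "\<phi> \<in> test_functions" for \<phi> :: "real^'n \<Rightarrow> real"
  proof -
    define \<psi> where "\<psi> y = \<phi> ((1 / \<beta>) *\<^sub>R y)" for y
    have \<psi>: "\<psi> \<in> test_functions"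
      using test_function_affine[OF \<phi>, of "1 / \<beta>" 0] \<beta> by (simp add: \<psi>_def[abs_def])
    have \<phi>\<psi>: "\<phi> = (\<lambda>x. \<psi> (\<beta> *\<^sub>R x))" using \<beta> by (auto simp: \<psi>_def)
    have \<psi>m[measurable]: "\<psi> \<in> borel_measurable borel" by (rule test_function_measurable[OF \<psi>])
    define P where "P = (LINT x|lborel. u x powr p * \<psi> x)"
    define Q where "Q = (LINT x|lborel. u x powr q * \<psi> x)"
    have el: "gagliardo_form s u \<psi> = \<Lambda> * P - Q"
      using euler_lagrange[OF u min \<psi>] by (simp add: \<Lambda>_def B_def P_def Q_def)
    have "gagliardo_form s w \<phi> = \<alpha> * (\<beta> powr - (?n - 2 * s) * gagliardo_form s u \<psi>)"
      unfolding w_def \<phi>\<psi> gagliardo_form_cmult_left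
      using gagliardo_form_dilate[OF um \<psi>m fu test_function_finite_gag[OF s(1,2) \<psi>] \<beta>] by simp
    also have "\<beta> powr - (?n - 2 * s) = \<beta> powr - ?n * \<beta> powr (2 * s)" by (simp add: powr_add[symmetric])
    finally have "\<kappa> * gagliardo_form s w \<phi> = \<beta> powr - ?n * (\<alpha> * (\<kappa> * \<beta> powr (2 * s))) * (\<Lambda> * P - Q)"
      by (simp add: el mult_ac)
    also have "\<alpha> * (\<kappa> * \<beta> powr (2 * s)) = \<alpha> powr q"
      unfolding \<beta>s using \<alpha> powr_add[of \<alpha> 1 "q - 1"] by simp
    also have "\<beta> powr - ?n * \<alpha> powr q * (\<Lambda> * P - Q) = \<beta> powr - ?n * ((\<alpha> powr q * \<Lambda>) * P - \<alpha> powr q * Q)"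
      by (simp add: algebra_simps)
    also have "\<dots> = \<alpha> powr p * (\<beta> powr - ?n * P) - \<alpha> powr q * (\<beta> powr - ?n * Q)"
      unfolding \<alpha>p by (simp add: algebra_simps)
    finally have "\<kappa> * gagliardo_form s w \<phi> = \<alpha> powr p * (\<beta> powr - ?n * P) - \<alpha> powr q * (\<beta> powr - ?n * Q)" .
    moreover have "(LINT x|lborel. w x powr e * \<phi> x) = \<alpha> powr e * (\<beta> powr - ?n * (LINT x|lborel. u x powr e * \<psi> x))" for e
    proof -
      have "(LINT x|lborel. w x powr e * \<phi> x) = (LINT x|lborel. \<alpha> powr e * (u (\<beta> *\<^sub>R x) powr e * \<psi> (\<beta> *\<^sub>R x)))"
        unfolding w_def \<phi>\<psi> using \<alpha> u0 by (simp add: powr_mult mult.assoc)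
      also have "\<dots> = \<alpha> powr e * (LINT x|lborel. u (\<beta> *\<^sub>R x) powr e * \<psi> (\<beta> *\<^sub>R x))" by simp
      also have "(LINT x|lborel. u (\<beta> *\<^sub>R x) powr e * \<psi> (\<beta> *\<^sub>R x)) = \<beta> powr - ?n * (LINT x|lborel. u x powr e * \<psi> x)"
        using integral_lborel_dilate[of "\<lambda>x. u x powr e * \<psi> x" \<beta>] \<beta> by simp
      finally show ?thesis .
    qed
    ultimately show ?thesis by (simp add: \<kappa>_def P_def Q_def)
  qed
  show ?thesis by (rule that[OF rd w0 wfe wLq eq nz])
qed

text \<open>
  If \<open>w\<close> vanished somewhere, it would vanish outside a ball. Tested with a bump \<open>\<phi>\<close> supported there,
  the right-hand side of the equation is zero, while the Gagliardo integrand is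
  \<open>- (w x * \<phi> y + w y * \<phi> x)\<close> over a positive weight.
\<close>

lemma solution_positive:
  fixes w :: "real^'n \<Rightarrow> real"
  assumes rd: "radially_decreasing w" and w0: "\<And>x. 0 \<le> w x" and fe: "w \<in> finite_energy s"
    and eq: "\<And>\<phi>. \<phi> \<in> test_functions \<Longrightarrow> frac_const (real CARD('n)) s / 2 * gagliardo_form s w \<phi>
      = (LINT x|lborel. w x powr p * \<phi> x) - (LINT x|lborel. w x powr q * \<phi> x)"
    and nz: "\<not> (AE x in lborel. w x = 0)"
  shows "0 < w x"
proof (rule ccontr)
  assume "\<not> 0 < w x"
  then have out: "w y = 0" if "norm x \<le> norm y" for y
    using w0[of y] rd that by (auto simp: radially_decreasing_def intro!: antisym order_trans[of "w y" "w x" 0])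
  \<comment> \<open>At distance norm x + 1 from the origin, the unit ball around c stays in the
    region where w vanishes.\<close>
  obtain c :: "real^'n" where c: "norm c = norm x + 1" using vector_choose_size[of "norm x + 1"] by auto
  define \<phi> where "\<phi> y = bump (1 *\<^sub>R y + - c)" for y
  have \<phi>t: "\<phi> \<in> test_functions"
    unfolding \<phi>_def[abs_def] by (rule test_function_affine[OF bump_test]) simp
  have \<phi>m[measurable]: "\<phi> \<in> borel_measurable borel" by (rule test_function_measurable[OF \<phi>t])
  have wm[measurable]: "w \<in> borel_measurable borel" by (rule finite_energy_measurable[OF fe])
  have \<phi>0: "0 \<le> \<phi> y" for y by (simp add: \<phi>_def bump_nonneg)
  have disj: "w y * \<phi> y = 0" for y
  proof (cases "\<phi> y = 0")
    case False
    then have "norm (y - c) < 1" using bump_eq_0[of "y - c"] by (auto simp: \<phi>_def not_le[symmetric])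
    then have "norm x \<le> norm y" using norm_triangle_ineq2[of c y] c by (simp add: norm_minus_commute)
    then show ?thesis using out by simp
  qed simp
  have z: "(\<lambda>y. w y powr e * \<phi> y) = (\<lambda>_. 0)" for e
    using disj by (intro ext) auto
  have "gagliardo_form s w \<phi> = 0"
    using eq[OF \<phi>t] frac_const_pos[OF s(1,2), of "real CARD('n)"] unfolding z by auto
  moreover have int: "integrable (lborel \<Otimes>\<^sub>M lborel) (\<lambda>z. - gagliardo_integrand s w \<phi> z)"
    using fe test_function_finite_gag[OF s(1,2) \<phi>t]
    by (intro Bochner_Integration.integrable_minus integrable_gagliardo) (auto simp: finite_energy_iff)
  moreover have I: "- gagliardo_integrand s w \<phi> (a, b) = (w a * \<phi> b + w b * \<phi> a) / norm (a - b) powr (real CARD('n) + 2 * s)" for a b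
  proof -
    have "(w a - w b) * (\<phi> a - \<phi> b) = w a * \<phi> a + w b * \<phi> b - (w a * \<phi> b + w b * \<phi> a)"
      by (simp add: algebra_simps)
    then have "(w a - w b) * (\<phi> a - \<phi> b) = - (w a * \<phi> b + w b * \<phi> a)" unfolding disj by simp
    then show ?thesis by (simp only: gagliardo_integrand_def prod.case minus_divide_left[symmetric] minus_minus)
  qed
  have I0: "0 \<le> - gagliardo_integrand s w \<phi> z" for z
    using w0 \<phi>0 by (cases z) (simp only: I, simp)
  ultimately have "AE z in lborel \<Otimes>\<^sub>M lborel. - gagliardo_integrand s w \<phi> z = 0"
    using integral_nonneg_eq_0_iff_AE[OF int] by (simp add: gagliardo_form_def)
  then have "AE z in lborel \<Otimes>\<^sub>M lborel. ennreal (w (fst z)) * ennreal (\<phi> (snd z)) = 0"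
  proof eventually_elim
    case (elim z)
    obtain a b where z: "z = (a, b)" by (cases z)
    have "w a * \<phi> b = 0"
    \<comment> \<open>On the diagonal the quotient is 0 by convention and carries no information;
      there the disjointness of the supports suffices.\<close>
    proof (cases "a = b")
      case False
      then have "w a * \<phi> b + w b * \<phi> a = 0" using elim I[of a b] by (simp add: z)
      moreover have "0 \<le> w a * \<phi> b" "0 \<le> w b * \<phi> a" using w0 \<phi>0 by simp_all
      ultimately show ?thesis by linarith
    qed (simp add: disj)
    then show ?case using w0 \<phi>0 by (simp add: z ennreal_mult[symmetric])
  qed
  \<comment> \<open>The vanishing double integral factorises, so w or the bump would have to vanish
    almost everywhere.\<close>
  then have "(\<integral>\<^sup>+z. ennreal (w (fst z)) * ennreal (\<phi> (snd z)) \<partial>(lborel \<Otimes>\<^sub>M lborel)) = 0"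
    by (subst nn_integral_0_iff_AE) auto
  moreover have "(\<integral>\<^sup>+z. ennreal (w (fst z)) * ennreal (\<phi> (snd z)) \<partial>(lborel \<Otimes>\<^sub>M lborel))
      = (\<integral>\<^sup>+a. ennreal (w a) \<partial>lborel) * (\<integral>\<^sup>+b. ennreal (\<phi> b) \<partial>lborel)"
    by (subst lborel.nn_integral_fst[symmetric]) (auto simp: nn_integral_cmult nn_integral_multc)
  ultimately consider "(\<integral>\<^sup>+a. ennreal (w a) \<partial>lborel) = 0" | "(\<integral>\<^sup>+b. ennreal (\<phi> b) \<partial>lborel) = 0" by auto
  then show False
  proof cases
    case 1
    then have "AE a in lborel. ennreal (w a) = 0" by (subst (asm) nn_integral_0_iff_AE) auto
    then have "AE a in lborel. w a = 0" by eventually_elim (use w0 in \<open>auto simp: ennreal_eq_0_iff intro: antisym\<close>)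
    then show False using nz by simp
  next
    case 2
    then have "AE b in lborel. ennreal (\<phi> b) = 0" by (subst (asm) nn_integral_0_iff_AE) auto
    then have "AE b in lborel. \<phi> b = 0" by eventually_elim (use \<phi>0 in \<open>auto simp: ennreal_eq_0_iff intro: antisym\<close>)
    then have "\<phi> c = 0" by (rule continuous_AE_zero[OF test_function_continuous[OF \<phi>t]])
    then show False using bump_pos_iff[of "0::real^'n"] by (simp add: \<phi>_def)
  qed
qed

end

theorem theorem1p5:
  fixes s p q :: real
  assumes "0 < s" and "s < 1"
    and "2 * s < real CARD('n::finite)"
    and "crit_exp (real CARD('n)) s - 1 < p" and "p < q"
  shows "(\<exists>u :: real^'n \<Rightarrow> real. u \<in> admissible s p q \<and> radially_decreasing u \<and>
            energy s q u = (INF v\<in>(admissible s p q :: (real^'n \<Rightarrow> real) set). energy s q v)) \<and>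
         (\<exists>u :: real^'n \<Rightarrow> real. weak_solution s p q u \<and> \<not> (AE x in lborel. u x = 0)) \<and>
         ((p - 1) * (real CARD('n) / (2 * s)) - 1 < q \<longrightarrow>
            (\<exists>u :: real^'n \<Rightarrow> real. weak_solution s p q u \<and> (\<forall>x. 0 < u x)))"
proof -
  interpret fractional_problem s p q "TYPE('n)" by unfold_locales (use assms in auto)
  obtain u :: "real^'n \<Rightarrow> real" and M where u: "rd_profile M u" "u \<in> admissible s p q"
    and min: "\<And>v :: real^'n \<Rightarrow> real. v \<in> admissible s p q \<Longrightarrow> energy s q u \<le> energy s q v"
    by (rule minimiser_exists) (rule that)
  have "(INF v\<in>(admissible s p q :: (real^'n \<Rightarrow> real) set). energy s q v) = energy s q u"
    by (rule cInf_eq_minimum) (use u min in auto)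
  moreover obtain w :: "real^'n \<Rightarrow> real" where w: "radially_decreasing w" "\<And>x. 0 \<le> w x" "w \<in> finite_energy s"
    "w \<in> Lp_space (q + 1)"
    "\<And>\<phi>. \<phi> \<in> test_functions \<Longrightarrow> frac_const (real CARD('n)) s / 2 * gagliardo_form s w \<phi>
      = (LINT x|lborel. w x powr p * \<phi> x) - (LINT x|lborel. w x powr q * \<phi> x)"
    "\<not> (AE x in lborel. w x = 0)"
    by (rule solution_exists) (rule that)
  have "weak_solution s p q w" by (rule weak_solutionI[OF w(1-5)])
  moreover have "0 < w x" for x by (rule solution_positive[OF w(1-3,5,6)])
  ultimately show ?thesis using u rd_profileD(1)[OF u(1)] w(6) by metis
qed

end
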